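(* If $\mathbf K$ is a $\mu$-AEC which has chain bounds and $\downarrow$ is an invariant, transitive independence relation on $\mathbf K$ with existence, uniqueness and right local character, then $\downarrow$ is symmetric. Thus if $\downarrow$ has, in addition, the right (or left) witness property, it is a stable independence relation.
   Context: **$\mu$-AECs.** Let $\mu$ be a regular cardinal. A ($\mu$-ary) abstract class is a pair $\mathbf K=(K,\le_{\mathbf K})$ where $K$ is a class of structures in a fixed $\mu$-ary vocabulary $\tau(\mathbf K)$ (symbols of arity $<\mu$), $\le_{\mathbf K}$ is a partial order on $K$ refining the substructure relation $\subseteq$, and both are closed under isomorphism. $UM$ is the universe of $M$. A $\mu$-AEC is an abstract class satisfying: (Coherence) $M_0\subseteq M_1\le_{\mathbf K}M_2$ and $M_0\le_{\mathbf K}M_2$ imply $M_0\le_{\mathbf K}M_1$; (Chain axioms) for any $\mu$-directed system $\langle M_i:i\in I\rangle$ in $\mathbf K$, $M=\bigcup_iM_i$ is in $\mathbf K$, $M_i\le_{\mathbf K}M$ for all $i$, and if $M_i\le_{\mathbf K}N$ for all $i$ then $M\le_{\mathbf K}N$; (LST axiom) there is a cardinal $\lambda=\lambda^{<\mu}\ge|\tau(\mathbf K)|+\mu$ such that for any $M\in\mathbf K$ and $A\subseteq UM$ there is $M_0\le_{\mathbf K}M$ with $A\subseteq UM_0$ and $|UM_0|\le|A|^{<\mu}+\lambda$. A $\mathbf K$-embedding $f:M\to N$ is an isomorphism of $M$ onto some $f[M]\le_{\mathbf K}N$. $\mathbf K$ is viewed as a category whose morphisms are the $\mathbf K$-embeddings.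 $\mathbf K$ has chain bounds if for every ordinal $\delta$ and every $\le_{\mathbf K}$-increasing chain $\langle M_i:i<\delta\rangle$ there is $M\in\mathbf K$ with $M_i\le_{\mathbf K}M$ for all $i<\delta$. **Independence relations on a category $\mathcal K$.** A span is a pair of morphisms $(f_1:M_0\to M_1,\ f_2:M_0\to M_2)$. An amalgam of it is a pair $(g_1:M_1\to N,\ g_2:M_2\to N)$ with $g_1f_1=g_2f_2$; then $(f_1,f_2,g_1,g_2)$ is an amalgamation diagram. For two amalgams $(g_1^a,g_2^a)$ (into $N^a$), $(g_1^b,g_2^b)$ (into $N^b$) of the same span, write $(f_1,f_2,g_1^a,g_2^a)\sim^*(f_1,f_2,g_1^b,g_2^b)$ if there are $N_*$, $g^a:N^a\to N_*$, $g^b:N^b\to N_*$ with $g^ag_\ell^a=g^bg_\ell^b$ for $\ell=1,2$; $\sim$ is the transitive closure of $\sim^*$. An independence relation $\downarrow$ is a class of amalgamation diagrams closed under $\sim$; members are called independent. It is invariant if it is closed under isomorphism of amalgamation diagrams. The dual: $\downarrow^d(f_1,f_2,g_1,g_2)$ iff $\downarrow(f_2,f_1,g_2,g_1)$; symmetric: $\downarrow=\downarrow^d$. Existence: every span has an amalgam forming an independent diagram with it. Uniqueness: any two independent diagrams with the same span are $\sim$-related. Right transitive: $\downarrow(f_{0,1},f_{0,2},f_{1,3},f_{2,3})$ and $\downarrow(f_{2,3},f_{2,4},f_{3,5},f_{4,5})$ (with $f_{i,j}:M_i\to M_j$) imply $\downarrow(f_{0,1},f_{2,4}f_{0,2},f_{3,5}f_{1,3},f_{4,5})$;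 left transitive: $\downarrow^d$ is right transitive; transitive: both. For $\downarrow$ right transitive with existence, $\mathcal K_{\mathrm{NF}}$ is the category whose objects are morphisms of $\mathcal K$ and whose morphisms from $f:M_1\to M_2$ to $g:N_1\to N_2$ are pairs $(h_1:M_1\to N_1,h_2:M_2\to N_2)$ with $\downarrow(f,h_1,h_2,g)$. Right accessible: right transitive and $\mathcal K_{\mathrm{NF}}$ is accessible. Left accessible: $\downarrow^d$ is right accessible. Accessible: both. Stable: symmetric, transitive, accessible, with existence and uniqueness. Write $M_1\downarrow_{M_0}^{M_3}M_2$ if $M_0\le_{\mathbf K}M_\ell\le_{\mathbf K}M_3$ ($\ell=1,2$) and the square of inclusions is independent. Write $A\,\overline{\downarrow}_{N_0}^{N_3}B$ if $N_0\le_{\mathbf K}N_3$, $A\cup B\subseteq UN_3$, and there are $M_1,M_2,M_3$ with $A\subseteq UM_1$, $B\subseteq UM_2$, $N_3\le_{\mathbf K}M_3$ and $M_1\downarrow_{N_0}^{M_3}M_2$. **Galois types, local character, witness property.** For $B\subseteq UN$ and a sequence $\bar a$ from $N$, $\mathrm{gtp}(\bar a/B;N)$ is the class of $(\bar a,B,N)$ under the transitive closure of the relation: $(\bar a,B,N)$ and $(\bar a',B,N')$ are related iff there are $\mathbf K$-embeddings $g:N\to\bar N$, $g':N'\to\bar N$ with $g\restriction B=g'\restriction B$ and $g(\bar a)=g'(\bar a')$. $\mathrm{gS}^\alpha(M)$ is the set of $\mathrm{gtp}(\bar a/M;N)$ with $M\le_{\mathbf K}N$ and $\bar a$ of length $\alpha$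 in $N$. $\mathrm{gtp}(\bar a/B;N_3)$ does not fork over $N_0$ if $\mathrm{ran}(\bar a)\,\overline{\downarrow}_{N_0}^{N_3}B$. $\downarrow$ has right local character if for each cardinal $\alpha$ there is a cardinal $\lambda$ such that for every $M\in\mathbf K$ and $p\in\mathrm{gS}^\alpha(M)$ there is $M_0\le_{\mathbf K}M$ with $|UM_0|\le\lambda$ and $p$ not forking over $M_0$. $\downarrow$ has the right witness property if for some infinite cardinal $\theta$: $M_1\downarrow_{M_0}^{M_3}M_2$ holds whenever $M_0\le_{\mathbf K}M_\ell\le_{\mathbf K}M_3$ ($\ell=1,2$) and $UM_1\,\overline{\downarrow}_{M_0}^{M_3}A$ for all $A\subseteq UM_2$ with $|A|<\theta$. It has the left witness property if $\downarrow^d$ has the right witness property. *)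

theory Defs
  imports "HOL-Library.FuncSet"
begin

unbundle cardinal_syntax

section \<open>Sets and classes\<close>

text \<open>
  HOL has no proper classes.  Throughout, a type \<open>'v\<close> whose cardinality is strongly inaccessible
  plays the role of the set-theoretic universe: a subset of \<open>'v\<close> of smaller cardinality is a set
  (it is "small"), and a "class" of structures is an arbitrary set of structures with small
  universes.  Infinite cardinals, ordinals and index posets are relations on \<open>'v\<close> with small field.
  (Up to isomorphism of \<open>'v\<close> with a rank-initial segment \<open>V_kappa\<close>, \<open>kappa\<close> inaccessible, this is
  set theory inside \<open>V_kappa\<close>.)
\<close>

definition inaccessible_universe :: "'v itself \<Rightarrow> bool" where
  "inaccessible_universe _ \<longleftrightarrow>
     natLeq <o |UNIV :: 'v set| \<and>
     regularCard |UNIV :: 'v set| \<and>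
     (\<forall>A :: 'v set. |A| <o |UNIV :: 'v set| \<longrightarrow> |Pow A| <o |UNIV :: 'v set| )"

definition small :: "'v set \<Rightarrow> bool" where
  "small A \<longleftrightarrow> |A| <o |UNIV :: 'v set|"

definition is_cardinal :: "'v rel \<Rightarrow> bool" where
  "is_cardinal lam \<longleftrightarrow> Card_order lam \<and> small (Field lam)"

definition infinite_cardinal :: "'v rel \<Rightarrow> bool" where
  "infinite_cardinal lam \<longleftrightarrow> is_cardinal lam \<and> infinite (Field lam)"

definition regular_cardinal :: "'v rel \<Rightarrow> bool" where
  "regular_cardinal lam \<longleftrightarrow> infinite_cardinal lam \<and> regularCard lam"

text \<open>
  The sequences in \<open>A\<close> of length less than \<open>mu\<close> (the length is the first component);
  the cardinal \<open>|A|\<close> to the power \<open><mu\<close> is their number.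
\<close>

definition seqs_less :: "'v rel \<Rightarrow> 'v set \<Rightarrow> ('v \<times> ('v \<Rightarrow> 'v)) set" where
  "seqs_less mu A = (SIGMA i : Field mu. (underS mu i \<rightarrow>\<^sub>E A))"

definition directed_poset :: "'v rel \<Rightarrow> 'v rel \<Rightarrow> bool" where
  "directed_poset lam r \<longleftrightarrow>
     Partial_order r \<and> small (Field r) \<and>
     (\<forall>X \<subseteq> Field r. |X| <o lam \<longrightarrow> (\<exists>u \<in> Field r. \<forall>x \<in> X. (x, u) \<in> r))"


section \<open>Categories\<close>

text \<open>\<open>comp C g f\<close> is the composite "\<open>g\<close> after \<open>f\<close>"; it is meaningful only if \<open>src C g = tgt C f\<close>.\<close>

record ('o, 'm) cat =
  obj :: "'o set"
  arr :: "'m set"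
  src :: "'m \<Rightarrow> 'o"
  tgt :: "'m \<Rightarrow> 'o"
  ident :: "'o \<Rightarrow> 'm"
  comp :: "'m \<Rightarrow> 'm \<Rightarrow> 'm"

definition hom :: "('o, 'm) cat \<Rightarrow> 'o \<Rightarrow> 'o \<Rightarrow> 'm set" where
  "hom C X Y = {f \<in> arr C. src C f = X \<and> tgt C f = Y}"

definition category :: "('o, 'm) cat \<Rightarrow> bool" where
  "category C \<longleftrightarrow>
     (\<forall>f \<in> arr C. src C f \<in> obj C \<and> tgt C f \<in> obj C) \<and>
     (\<forall>X \<in> obj C. ident C X \<in> hom C X X) \<and>
     (\<forall>f \<in> arr C. \<forall>g \<in> arr C. src C g = tgt C f \<longrightarrow>
        comp C g f \<in> hom C (src C f) (tgt C g)) \<and>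
     (\<forall>f \<in> arr C. comp C f (ident C (src C f)) = f \<and> comp C (ident C (tgt C f)) f = f) \<and>
     (\<forall>f \<in> arr C. \<forall>g \<in> arr C. \<forall>h \<in> arr C. src C g = tgt C f \<longrightarrow> src C h = tgt C g \<longrightarrow>
        comp C h (comp C g f) = comp C (comp C h g) f)"

definition is_iso :: "('o, 'm) cat \<Rightarrow> 'm \<Rightarrow> bool" where
  "is_iso C f \<longleftrightarrow> f \<in> arr C \<and>
     (\<exists>g \<in> hom C (tgt C f) (src C f).
        comp C g f = ident C (src C f) \<and> comp C f g = ident C (tgt C f))"


subsection \<open>Accessible categories\<close>

definition diagram :: "('o, 'm) cat \<Rightarrow> 'v rel \<Rightarrow> ('v \<Rightarrow> 'o) \<Rightarrow> ('v \<Rightarrow> 'v \<Rightarrow> 'm) \<Rightarrow> bool" where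
  "diagram C r D d \<longleftrightarrow>
     (\<forall>i \<in> Field r. D i \<in> obj C \<and> d i i = ident C (D i)) \<and>
     (\<forall>i j. (i, j) \<in> r \<longrightarrow> d i j \<in> hom C (D i) (D j)) \<and>
     (\<forall>i j k. (i, j) \<in> r \<longrightarrow> (j, k) \<in> r \<longrightarrow> comp C (d j k) (d i j) = d i k)"

definition cocone ::
  "('o, 'm) cat \<Rightarrow> 'v rel \<Rightarrow> ('v \<Rightarrow> 'o) \<Rightarrow> ('v \<Rightarrow> 'v \<Rightarrow> 'm) \<Rightarrow> 'o \<Rightarrow> ('v \<Rightarrow> 'm) \<Rightarrow> bool" where
  "cocone C r D d X c \<longleftrightarrow>
     X \<in> obj C \<and>
     (\<forall>i \<in> Field r. c i \<in> hom C (D i) X) \<and>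
     (\<forall>i j. (i, j) \<in> r \<longrightarrow> comp C (c j) (d i j) = c i)"

definition colimit ::
  "('o, 'm) cat \<Rightarrow> 'v rel \<Rightarrow> ('v \<Rightarrow> 'o) \<Rightarrow> ('v \<Rightarrow> 'v \<Rightarrow> 'm) \<Rightarrow> 'o \<Rightarrow> ('v \<Rightarrow> 'm) \<Rightarrow> bool" where
  "colimit C r D d X c \<longleftrightarrow>
     cocone C r D d X c \<and>
     (\<forall>Y e. cocone C r D d Y e \<longrightarrow>
        (\<exists>!u. u \<in> hom C X Y \<and> (\<forall>i \<in> Field r. comp C u (c i) = e i)))"

text \<open>
  \<open>A\<close> is \<open>lam\<close>-presentable: \<open>Hom(A, -)\<close> preserves \<open>lam\<close>-directed colimits.  The two clauses
  say that the canonical map from the colimit of the sets \<open>Hom(A, D i)\<close> to \<open>Hom(A, X)\<close> is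
  surjective and injective, respectively.
\<close>

definition presentable :: "('o, 'm) cat \<Rightarrow> 'v rel \<Rightarrow> 'o \<Rightarrow> bool" where
  "presentable C lam A \<longleftrightarrow>
     A \<in> obj C \<and>
     (\<forall>(r :: 'v rel) D d X c.
        directed_poset lam r \<longrightarrow> diagram C r D d \<longrightarrow> colimit C r D d X c \<longrightarrow>
        (\<forall>f \<in> hom C A X. \<exists>i \<in> Field r. \<exists>g \<in> hom C A (D i). comp C (c i) g = f) \<and>
        (\<forall>i \<in> Field r. \<forall>j \<in> Field r. \<forall>g \<in> hom C A (D i). \<forall>h \<in> hom C A (D j).
           comp C (c i) g = comp C (c j) h \<longrightarrow>
           (\<exists>k. (i, k) \<in> r \<and> (j, k) \<in> r \<and> comp C (d i k) g = comp C (d j k) h)))"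

definition accessible_at :: "('o, 'm) cat \<Rightarrow> 'v rel \<Rightarrow> bool" where
  "accessible_at C lam \<longleftrightarrow>
     (\<forall>(r :: 'v rel) D d. directed_poset lam r \<longrightarrow> diagram C r D d \<longrightarrow>
        (\<exists>X c. colimit C r D d X c)) \<and>
     (\<exists>S. |S| <o |UNIV :: 'v set| \<and> (\<forall>A \<in> S. presentable C lam A) \<and>
        (\<forall>X \<in> obj C. \<exists>(r :: 'v rel) D d c.
           directed_poset lam r \<and> diagram C r D d \<and> (\<forall>i \<in> Field r. D i \<in> S) \<and>
           colimit C r D d X c))"

definition accessible :: "'v itself \<Rightarrow> ('o, 'm) cat \<Rightarrow> bool" where
  "accessible _ C \<longleftrightarrow>
     category C \<and> (\<exists>lam :: 'v rel. regular_cardinal lam \<and> accessible_at C lam)"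


section \<open>Independence relations on a category\<close>

definition is_span :: "('o, 'm) cat \<Rightarrow> 'm \<Rightarrow> 'm \<Rightarrow> bool" where
  "is_span C f1 f2 \<longleftrightarrow> f1 \<in> arr C \<and> f2 \<in> arr C \<and> src C f1 = src C f2"

definition amalgam :: "('o, 'm) cat \<Rightarrow> 'm \<Rightarrow> 'm \<Rightarrow> 'm \<Rightarrow> 'm \<Rightarrow> bool" where
  "amalgam C f1 f2 g1 g2 \<longleftrightarrow>
     is_span C f1 f2 \<and> g1 \<in> arr C \<and> g2 \<in> arr C \<and>
     src C g1 = tgt C f1 \<and> src C g2 = tgt C f2 \<and> tgt C g1 = tgt C g2 \<and>
     comp C g1 f1 = comp C g2 f2"

text \<open>For a fixed span, the relations \<open>\<sim>*\<close> and \<open>\<sim>\<close> are given as relations on its amalgams.\<close>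

definition sim_star :: "('o, 'm) cat \<Rightarrow> 'm \<Rightarrow> 'm \<Rightarrow> ('m \<times> 'm) rel" where
  "sim_star C f1 f2 =
     {((a1, a2), (b1, b2)). amalgam C f1 f2 a1 a2 \<and> amalgam C f1 f2 b1 b2 \<and>
        (\<exists>ga \<in> arr C. \<exists>gb \<in> arr C.
           src C ga = tgt C a1 \<and> src C gb = tgt C b1 \<and> tgt C ga = tgt C gb \<and>
           comp C ga a1 = comp C gb b1 \<and> comp C ga a2 = comp C gb b2)}"

definition sim :: "('o, 'm) cat \<Rightarrow> 'm \<Rightarrow> 'm \<Rightarrow> ('m \<times> 'm) rel" where
  "sim C f1 f2 = (sim_star C f1 f2)\<^sup>+"

type_synonym 'm square_rel = "'m \<Rightarrow> 'm \<Rightarrow> 'm \<Rightarrow> 'm \<Rightarrow> bool"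

definition independence_relation :: "('o, 'm) cat \<Rightarrow> 'm square_rel \<Rightarrow> bool" where
  "independence_relation C ind \<longleftrightarrow>
     (\<forall>f1 f2 g1 g2. ind f1 f2 g1 g2 \<longrightarrow> amalgam C f1 f2 g1 g2) \<and>
     (\<forall>f1 f2 a1 a2 b1 b2. ind f1 f2 a1 a2 \<longrightarrow> ((a1, a2), (b1, b2)) \<in> sim C f1 f2 \<longrightarrow>
        ind f1 f2 b1 b2)"

definition invariant :: "('o, 'm) cat \<Rightarrow> 'm square_rel \<Rightarrow> bool" where
  "invariant C ind \<longleftrightarrow>
     (\<forall>f1 f2 g1 g2 f1' f2' g1' g2' h0 h1 h2 h3.
        ind f1 f2 g1 g2 \<longrightarrow> amalgam C f1' f2' g1' g2' \<longrightarrow>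
        is_iso C h0 \<and> h0 \<in> hom C (src C f1) (src C f1') \<longrightarrow>
        is_iso C h1 \<and> h1 \<in> hom C (tgt C f1) (tgt C f1') \<longrightarrow>
        is_iso C h2 \<and> h2 \<in> hom C (tgt C f2) (tgt C f2') \<longrightarrow>
        is_iso C h3 \<and> h3 \<in> hom C (tgt C g1) (tgt C g1') \<longrightarrow>
        comp C f1' h0 = comp C h1 f1 \<longrightarrow> comp C f2' h0 = comp C h2 f2 \<longrightarrow>
        comp C g1' h1 = comp C h3 g1 \<longrightarrow> comp C g2' h2 = comp C h3 g2 \<longrightarrow>
        ind f1' f2' g1' g2')"

definition dual :: "'m square_rel \<Rightarrow> 'm square_rel" where
  "dual ind = (\<lambda>f1 f2 g1 g2. ind f2 f1 g2 g1)"

definition symmetric :: "'m square_rel \<Rightarrow> bool" where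
  "symmetric ind \<longleftrightarrow> ind = dual ind"

definition existence :: "('o, 'm) cat \<Rightarrow> 'm square_rel \<Rightarrow> bool" where
  "existence C ind \<longleftrightarrow> (\<forall>f1 f2. is_span C f1 f2 \<longrightarrow> (\<exists>g1 g2. ind f1 f2 g1 g2))"

definition uniqueness :: "('o, 'm) cat \<Rightarrow> 'm square_rel \<Rightarrow> bool" where
  "uniqueness C ind \<longleftrightarrow>
     (\<forall>f1 f2 a1 a2 b1 b2. ind f1 f2 a1 a2 \<longrightarrow> ind f1 f2 b1 b2 \<longrightarrow>
        ((a1, a2), (b1, b2)) \<in> sim C f1 f2)"

definition right_transitive :: "('o, 'm) cat \<Rightarrow> 'm square_rel \<Rightarrow> bool" where
  "right_transitive C ind \<longleftrightarrow>
     (\<forall>f01 f02 f13 f23 f24 f35 f45.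
        ind f01 f02 f13 f23 \<longrightarrow> ind f23 f24 f35 f45 \<longrightarrow>
        ind f01 (comp C f24 f02) (comp C f35 f13) f45)"

definition left_transitive :: "('o, 'm) cat \<Rightarrow> 'm square_rel \<Rightarrow> bool" where
  "left_transitive C ind \<longleftrightarrow> right_transitive C (dual ind)"

definition transitive :: "('o, 'm) cat \<Rightarrow> 'm square_rel \<Rightarrow> bool" where
  "transitive C ind \<longleftrightarrow> right_transitive C ind \<and> left_transitive C ind"

text \<open>
  The category \<open>K_NF\<close>.  A morphism \<open>(h1, h2)\<close> from \<open>f\<close> to \<open>g\<close> is encoded, together with its
  source and target, as \<open>(f, h1, h2, g)\<close>.
\<close>

definition NF_cat :: "('o, 'm) cat \<Rightarrow> 'm square_rel \<Rightarrow> ('m, 'm \<times> 'm \<times> 'm \<times> 'm) cat" where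
  "NF_cat C ind =
     \<lparr> obj = arr C,
       arr = {(f, h1, h2, g). ind f h1 h2 g},
       src = (\<lambda>(f, h1, h2, g). f),
       tgt = (\<lambda>(f, h1, h2, g). g),
       ident = (\<lambda>f. (f, ident C (src C f), ident C (tgt C f), f)),
       comp = (\<lambda>(f', k1, k2, g') (f, h1, h2, g). (f, comp C k1 h1, comp C k2 h2, g')) \<rparr>"

definition right_accessible :: "'v itself \<Rightarrow> ('o, 'm) cat \<Rightarrow> 'm square_rel \<Rightarrow> bool" where
  "right_accessible V C ind \<longleftrightarrow> right_transitive C ind \<and> accessible V (NF_cat C ind)"

definition left_accessible :: "'v itself \<Rightarrow> ('o, 'm) cat \<Rightarrow> 'm square_rel \<Rightarrow> bool" where
  "left_accessible V C ind \<longleftrightarrow> right_accessible V C (dual ind)"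

definition accessible_ind :: "'v itself \<Rightarrow> ('o, 'm) cat \<Rightarrow> 'm square_rel \<Rightarrow> bool" where
  "accessible_ind V C ind \<longleftrightarrow> right_accessible V C ind \<and> left_accessible V C ind"

definition stable_independence :: "'v itself \<Rightarrow> ('o, 'm) cat \<Rightarrow> 'm square_rel \<Rightarrow> bool" where
  "stable_independence V C ind \<longleftrightarrow>
     independence_relation C ind \<and>
     symmetric ind \<and> transitive C ind \<and> accessible_ind V C ind \<and>
     existence C ind \<and> uniqueness C ind"


section \<open>Structures in a \<open>mu\<close>-ary vocabulary\<close>

text \<open>
  The arity of a symbol is given by a set of argument positions, and an argument tuple from \<open>U\<close> is
  an element of \<open>arity \<rightarrow>\<^sub>E U\<close>.
\<close>

record 'v vocabulary =
  fsym :: "'v set"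
  rsym :: "'v set"
  farity :: "'v \<Rightarrow> 'v set"
  rarity :: "'v \<Rightarrow> 'v set"

record 'v struct =
  univ :: "'v set"
  fint :: "'v \<Rightarrow> ('v \<Rightarrow> 'v) \<Rightarrow> 'v"
  rint :: "'v \<Rightarrow> ('v \<Rightarrow> 'v) set"

definition mu_ary :: "'v rel \<Rightarrow> 'v vocabulary \<Rightarrow> bool" where
  "mu_ary mu tau \<longleftrightarrow>
     small (fsym tau) \<and> small (rsym tau) \<and>
     (\<forall>s \<in> fsym tau. |farity tau s| <o mu) \<and> (\<forall>s \<in> rsym tau. |rarity tau s| <o mu)"

text \<open>
  Off the vocabulary, and off the tuples from the universe, interpretations have a default value, so
  that two structures are equal as soon as they agree on the universe and on all symbols.
\<close>

definition is_struct :: "'v vocabulary \<Rightarrow> 'v struct \<Rightarrow> bool" where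
  "is_struct tau M \<longleftrightarrow>
     small (univ M) \<and>
     (\<forall>s \<in> fsym tau. fint M s \<in> (farity tau s \<rightarrow>\<^sub>E univ M) \<rightarrow>\<^sub>E univ M) \<and>
     (\<forall>s. s \<notin> fsym tau \<longrightarrow> fint M s = undefined) \<and>
     (\<forall>s \<in> rsym tau. rint M s \<subseteq> (rarity tau s \<rightarrow>\<^sub>E univ M)) \<and>
     (\<forall>s. s \<notin> rsym tau \<longrightarrow> rint M s = {})"

definition substructure :: "'v vocabulary \<Rightarrow> 'v struct \<Rightarrow> 'v struct \<Rightarrow> bool" where
  "substructure tau M N \<longleftrightarrow>
     is_struct tau M \<and> is_struct tau N \<and> univ M \<subseteq> univ N \<and>
     (\<forall>s \<in> fsym tau. \<forall>t \<in> farity tau s \<rightarrow>\<^sub>E univ M. fint M s t = fint N s t) \<and>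
     (\<forall>s \<in> rsym tau. rint M s = rint N s \<inter> (rarity tau s \<rightarrow>\<^sub>E univ M))"

definition struct_iso :: "'v vocabulary \<Rightarrow> ('v \<Rightarrow> 'v) \<Rightarrow> 'v struct \<Rightarrow> 'v struct \<Rightarrow> bool" where
  "struct_iso tau f M N \<longleftrightarrow>
     is_struct tau M \<and> is_struct tau N \<and> bij_betw f (univ M) (univ N) \<and>
     (\<forall>s \<in> fsym tau. \<forall>t \<in> farity tau s \<rightarrow>\<^sub>E univ M.
        f (fint M s t) = fint N s (compose (farity tau s) f t)) \<and>
     (\<forall>s \<in> rsym tau. \<forall>t \<in> rarity tau s \<rightarrow>\<^sub>E univ M.
        t \<in> rint M s \<longleftrightarrow> compose (rarity tau s) f t \<in> rint N s)"

text \<open>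
  The union of a \<open>mu\<close>-directed system: each argument tuple lies in some \<open>M i\<close>, and by directedness
  the value there does not depend on the choice of \<open>i\<close>.
\<close>

definition union_struct :: "'v vocabulary \<Rightarrow> 'v set \<Rightarrow> ('v \<Rightarrow> 'v struct) \<Rightarrow> 'v struct" where
  "union_struct tau I M =
     \<lparr> univ = (\<Union>i\<in>I. univ (M i)),
       fint = (\<lambda>s. if s \<in> fsym tau then
                 (\<lambda>t \<in> farity tau s \<rightarrow>\<^sub>E (\<Union>i\<in>I. univ (M i)).
                    fint (M (SOME i. i \<in> I \<and> t \<in> farity tau s \<rightarrow>\<^sub>E univ (M i))) s t)
               else undefined),
       rint = (\<lambda>s. \<Union>i\<in>I. rint (M i) s) \<rparr>"


section \<open>\<open>mu\<close>-abstract elementary classes\<close>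

record 'v aclass =
  voc :: "'v vocabulary"
  models :: "'v struct set"
  leK :: "'v struct rel"

definition abstract_class :: "'v rel \<Rightarrow> 'v aclass \<Rightarrow> bool" where
  "abstract_class mu K \<longleftrightarrow>
     mu_ary mu (voc K) \<and>
     (\<forall>M \<in> models K. is_struct (voc K) M) \<and>
     leK K \<subseteq> models K \<times> models K \<and> partial_order_on (models K) (leK K) \<and>
     (\<forall>(M, N) \<in> leK K. substructure (voc K) M N) \<and>
     (\<forall>M N f. M \<in> models K \<longrightarrow> struct_iso (voc K) f M N \<longrightarrow> N \<in> models K) \<and>
     (\<forall>M M0 N N0 f. (M0, M) \<in> leK K \<longrightarrow> struct_iso (voc K) f M N \<longrightarrow>
        struct_iso (voc K) f M0 N0 \<longrightarrow> substructure (voc K) N0 N \<longrightarrow> (N0, N) \<in> leK K)"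

definition directed_system :: "'v rel \<Rightarrow> 'v aclass \<Rightarrow> 'v rel \<Rightarrow> ('v \<Rightarrow> 'v struct) \<Rightarrow> bool" where
  "directed_system mu K r M \<longleftrightarrow>
     directed_poset mu r \<and> (\<forall>i \<in> Field r. M i \<in> models K) \<and>
     (\<forall>i j. (i, j) \<in> r \<longrightarrow> (M i, M j) \<in> leK K)"

definition coherence :: "'v aclass \<Rightarrow> bool" where
  "coherence K \<longleftrightarrow>
     (\<forall>M0 \<in> models K. \<forall>M1 \<in> models K. \<forall>M2 \<in> models K.
        substructure (voc K) M0 M1 \<longrightarrow> (M1, M2) \<in> leK K \<longrightarrow> (M0, M2) \<in> leK K \<longrightarrow>
        (M0, M1) \<in> leK K)"

definition chain_axioms :: "'v rel \<Rightarrow> 'v aclass \<Rightarrow> bool" where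
  "chain_axioms mu K \<longleftrightarrow>
     (\<forall>r M. directed_system mu K r M \<longrightarrow>
        (let U = union_struct (voc K) (Field r) M in
           U \<in> models K \<and> (\<forall>i \<in> Field r. (M i, U) \<in> leK K) \<and>
           (\<forall>N. (\<forall>i \<in> Field r. (M i, N) \<in> leK K) \<longrightarrow> (U, N) \<in> leK K)))"

definition LST_axiom :: "'v rel \<Rightarrow> 'v aclass \<Rightarrow> bool" where
  "LST_axiom mu K \<longleftrightarrow>
     (\<exists>lam. is_cardinal lam \<and> |seqs_less mu (Field lam)| =o lam \<and>
        |fsym (voc K) <+> rsym (voc K)| +c mu \<le>o lam \<and>
        (\<forall>M \<in> models K. \<forall>A \<subseteq> univ M. \<exists>M0. (M0, M) \<in> leK K \<and> A \<subseteq> univ M0 \<and>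
           |univ M0| \<le>o |seqs_less mu A| +c lam))"

definition mu_AEC :: "'v rel \<Rightarrow> 'v aclass \<Rightarrow> bool" where
  "mu_AEC mu K \<longleftrightarrow>
     abstract_class mu K \<and> coherence K \<and> chain_axioms mu K \<and> LST_axiom mu K"

definition chain_bounds :: "'v aclass \<Rightarrow> bool" where
  "chain_bounds K \<longleftrightarrow>
     (\<forall>(r :: 'v rel) M.
        Well_order r \<longrightarrow> small (Field r) \<longrightarrow> (\<forall>i \<in> Field r. M i \<in> models K) \<longrightarrow>
        (\<forall>i j. (i, j) \<in> r \<longrightarrow> (M i, M j) \<in> leK K) \<longrightarrow>
        (\<exists>N \<in> models K. \<forall>i \<in> Field r. (M i, N) \<in> leK K))"

definition K_embedding :: "'v aclass \<Rightarrow> ('v \<Rightarrow> 'v) \<Rightarrow> 'v struct \<Rightarrow> 'v struct \<Rightarrow> bool" where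
  "K_embedding K f M N \<longleftrightarrow>
     M \<in> models K \<and> N \<in> models K \<and> f \<in> extensional (univ M) \<and>
     (\<exists>N0. (N0, N) \<in> leK K \<and> struct_iso (voc K) f M N0)"

type_synonym 'v K_arrow = "'v struct \<times> ('v \<Rightarrow> 'v) \<times> 'v struct"

definition cat_of :: "'v aclass \<Rightarrow> ('v struct, 'v K_arrow) cat" where
  "cat_of K =
     \<lparr> obj = models K,
       arr = {(M, f, N). K_embedding K f M N},
       src = (\<lambda>(M, f, N). M),
       tgt = (\<lambda>(M, f, N). N),
       ident = (\<lambda>M. (M, restrict id (univ M), M)),
       comp = (\<lambda>(M', g, N') (M, f, N). (M, compose (univ M) g f, N')) \<rparr>"

definition inclusion :: "'v struct \<Rightarrow> 'v struct \<Rightarrow> 'v K_arrow" where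
  "inclusion M N = (M, restrict id (univ M), N)"


section \<open>Nonforking, Galois types, local character, witness property\<close>

definition ind_models ::
  "'v aclass \<Rightarrow> 'v K_arrow square_rel \<Rightarrow> 'v struct \<Rightarrow> 'v struct \<Rightarrow> 'v struct \<Rightarrow> 'v struct \<Rightarrow> bool" where
  "ind_models K ind M0 M1 M2 M3 \<longleftrightarrow>
     (M0, M1) \<in> leK K \<and> (M0, M2) \<in> leK K \<and> (M1, M3) \<in> leK K \<and> (M2, M3) \<in> leK K \<and>
     ind (inclusion M0 M1) (inclusion M0 M2) (inclusion M1 M3) (inclusion M2 M3)"

definition ind_sets ::
  "'v aclass \<Rightarrow> 'v K_arrow square_rel \<Rightarrow> 'v struct \<Rightarrow> 'v set \<Rightarrow> 'v set \<Rightarrow> 'v struct \<Rightarrow> bool" where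
  "ind_sets K ind N0 A B N3 \<longleftrightarrow>
     (N0, N3) \<in> leK K \<and> A \<union> B \<subseteq> univ N3 \<and>
     (\<exists>M1 M2 M3. A \<subseteq> univ M1 \<and> B \<subseteq> univ M2 \<and> (N3, M3) \<in> leK K \<and>
        ind_models K ind N0 M1 M2 M3)"

text \<open>
  Sequences of length \<open>alpha\<close> are functions on \<open>Field alpha\<close>.  A Galois type is an equivalence
  class of triples \<open>(a, B, N)\<close>.
\<close>

type_synonym 'v pretype = "('v \<Rightarrow> 'v) \<times> 'v set \<times> 'v struct"

definition gtp_step :: "'v aclass \<Rightarrow> 'v rel \<Rightarrow> 'v pretype rel" where
  "gtp_step K alpha =
     {((a, B, N), (a', B', N')).
        N \<in> models K \<and> N' \<in> models K \<and> B = B' \<and> B \<subseteq> univ N \<and> B \<subseteq> univ N' \<and>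
        a \<in> Field alpha \<rightarrow>\<^sub>E univ N \<and> a' \<in> Field alpha \<rightarrow>\<^sub>E univ N' \<and>
        (\<exists>g g' P. K_embedding K g N P \<and> K_embedding K g' N' P \<and>
           (\<forall>b \<in> B. g b = g' b) \<and> (\<forall>i \<in> Field alpha. g (a i) = g' (a' i)))}"

definition gtp :: "'v aclass \<Rightarrow> 'v rel \<Rightarrow> ('v \<Rightarrow> 'v) \<Rightarrow> 'v set \<Rightarrow> 'v struct \<Rightarrow> 'v pretype set" where
  "gtp K alpha a B N = {t. ((a, B, N), t) \<in> (gtp_step K alpha)\<^sup>+}"

definition gS :: "'v aclass \<Rightarrow> 'v rel \<Rightarrow> 'v struct \<Rightarrow> 'v pretype set set" where
  "gS K alpha M =
     {gtp K alpha a (univ M) N | a N. (M, N) \<in> leK K \<and> a \<in> Field alpha \<rightarrow>\<^sub>E univ N}"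

text \<open>A type does not fork over \<open>N0\<close> if this is witnessed by one of its representatives.\<close>

definition nonforking ::
  "'v aclass \<Rightarrow> 'v K_arrow square_rel \<Rightarrow> 'v rel \<Rightarrow> 'v pretype set \<Rightarrow> 'v struct \<Rightarrow> bool" where
  "nonforking K ind alpha p N0 \<longleftrightarrow>
     (\<exists>a B N3. (a, B, N3) \<in> p \<and> p = gtp K alpha a B N3 \<and>
        ind_sets K ind N0 (a ` Field alpha) B N3)"

definition right_local_character :: "'v aclass \<Rightarrow> 'v K_arrow square_rel \<Rightarrow> bool" where
  "right_local_character K ind \<longleftrightarrow>
     (\<forall>alpha :: 'v rel. is_cardinal alpha \<longrightarrow>
        (\<exists>lam :: 'v rel. is_cardinal lam \<and>
           (\<forall>M \<in> models K. \<forall>p \<in> gS K alpha M. \<exists>M0. (M0, M) \<in> leK K \<and>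
              |univ M0| \<le>o lam \<and> nonforking K ind alpha p M0)))"

definition right_witness :: "'v aclass \<Rightarrow> 'v K_arrow square_rel \<Rightarrow> bool" where
  "right_witness K ind \<longleftrightarrow>
     (\<exists>theta :: 'v rel. infinite_cardinal theta \<and>
        (\<forall>M0 M1 M2 M3.
           (M0, M1) \<in> leK K \<longrightarrow> (M0, M2) \<in> leK K \<longrightarrow> (M1, M3) \<in> leK K \<longrightarrow> (M2, M3) \<in> leK K \<longrightarrow>
           (\<forall>A \<subseteq> univ M2. |A| <o theta \<longrightarrow> ind_sets K ind M0 (univ M1) A M3) \<longrightarrow>
           ind_models K ind M0 M1 M2 M3))"

definition left_witness :: "'v aclass \<Rightarrow> 'v K_arrow square_rel \<Rightarrow> bool" where
  "left_witness K ind \<longleftrightarrow> right_witness K (dual ind)"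

end

theory Submission
  imports Defs
begin

text \<open>
  Existence and uniqueness reduce symmetry to finding, for each span \<open>M0 \<rightarrow> M1\<close>, \<open>M0 \<rightarrow> M2\<close>, one
  amalgam that is independent in both orders.  Chain bounds and existence give a long increasing
  chain of models above \<open>M0\<close> that keeps adding copies of \<open>M2\<close>, each independent, on the right, from
  all of the chain that precedes it.  Let \<open>U\<close> be the union of the chain and amalgamate \<open>M1\<close> with \<open>U\<close>
  over \<open>M0\<close>, with \<open>U\<close> on the left.  Every copy of \<open>M2\<close> is then to the left of \<open>M1\<close>.  On the other hand
  the type of \<open>M1\<close> over \<open>U\<close> does not fork over a small model, nor over any member of the chain above it,
  and left transitivity makes \<open>M1\<close> independent, on the left, from the next copy of \<open>M2\<close>.  This is
  \<open>doubly_independent_amalgam\<close>.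

  With symmetry the two witness properties coincide, and the dual relation is the relation itself, so
  stability amounts to accessibility of the category of independent squares.  Directed colimits are
  computed on sources and targets in \<open>K\<close>: independence involves only small subsets by the witness
  property, and these appear at some stage of the diagram (\<open>NF_covering_cocone_is_colimit\<close>,
  \<open>NF_covering_cocone_exists\<close>).  Hence small arrows are presentable (\<open>NF_presentable\<close>).  They generate
  since every arrow is a directed union of small subarrows that sit in it independently; these are
  obtained by closing off under bases for short sequences, which local character provides
  (\<open>small_independent_subsquare\<close>).

  Arguments about independence use arrows of the category and the relation \<open>free\<close> between a set and an
  arrow.  Existence gives amalgamation, so \<open>\<sim>\<close> is one-step, and all monotonicity properties follow by
  comparing a given square with a freely built one.
\<close>

section \<open>Independence relations on a category\<close>

lemma hom_arr: "f \<in> hom C X Y \<Longrightarrow> f \<in> arr C"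
  and hom_tgt: "f \<in> hom C X Y \<Longrightarrow> tgt C f = Y"
  by (auto simp: hom_def)

lemma arr_hom: "f \<in> arr C \<Longrightarrow> f \<in> hom C (src C f) (tgt C f)"
  by (auto simp: hom_def)

lemma amalgam_iff:
  "amalgam C f1 f2 g1 g2 \<longleftrightarrow>
     (\<exists>M0 M1 M2 M3. f1 \<in> hom C M0 M1 \<and> f2 \<in> hom C M0 M2 \<and> g1 \<in> hom C M1 M3 \<and>
        g2 \<in> hom C M2 M3 \<and> comp C g1 f1 = comp C g2 f2)"
  by (auto simp: amalgam_def is_span_def hom_def)

lemma sim_starI:
  assumes "amalgam C f1 f2 a1 a2" "amalgam C f1 f2 b1 b2" "ga \<in> hom C (tgt C a1) R"
    "gb \<in> hom C (tgt C b1) R" "comp C ga a1 = comp C gb b1" "comp C ga a2 = comp C gb b2"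
  shows "((a1, a2), (b1, b2)) \<in> sim_star C f1 f2"
  unfolding sim_star_def mem_Collect_eq prod.case
proof (intro conjI assms(1,2), rule bexI[of _ ga], rule bexI[of _ gb], intro conjI assms(5,6))
qed (use assms(3,4) in \<open>simp_all only: hom_def mem_Collect_eq\<close>)

locale category_laws =
  fixes C :: "('o, 'm) cat"
  assumes cat: "category C"
begin

lemma comp_hom: "f \<in> hom C X Y \<Longrightarrow> g \<in> hom C Y Z \<Longrightarrow> comp C g f \<in> hom C X Z"
  using cat by (auto simp: category_def hom_def)

lemma comp_assoc:
  "f \<in> hom C W X \<Longrightarrow> g \<in> hom C X Y \<Longrightarrow> h \<in> hom C Y Z \<Longrightarrow>
     comp C (comp C h g) f = comp C h (comp C g f)"
  using cat by (auto simp: category_def hom_def)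

lemma ident_hom: "X \<in> obj C \<Longrightarrow> ident C X \<in> hom C X X"
  using cat by (auto simp: category_def)

lemma comp_ident: "f \<in> hom C X Y \<Longrightarrow> comp C f (ident C X) = f"
  and ident_comp: "f \<in> hom C X Y \<Longrightarrow> comp C (ident C Y) f = f"
  using cat by (auto simp: category_def hom_def)

lemma hom_obj: "f \<in> hom C X Y \<Longrightarrow> X \<in> obj C" "f \<in> hom C X Y \<Longrightarrow> Y \<in> obj C"
  using cat by (auto simp: category_def hom_def)

end

locale independence = category_laws C for C :: "('o, 'm) cat" +
  fixes ind :: "'m square_rel"
  assumes rel: "independence_relation C ind"
    and exist: "existence C ind"
    and uniq: "uniqueness C ind"
    and trans: "transitive C ind"
begin

lemma ind_amalgam: "ind f1 f2 g1 g2 \<Longrightarrow> amalgam C f1 f2 g1 g2"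
  using rel by (auto simp: independence_relation_def)

lemma indE:
  assumes "ind f1 f2 g1 g2"
  obtains M0 M1 M2 M3 where "f1 \<in> hom C M0 M1" "f2 \<in> hom C M0 M2" "g1 \<in> hom C M1 M3"
    "g2 \<in> hom C M2 M3" "comp C g1 f1 = comp C g2 f2"
  using ind_amalgam[OF assms] unfolding amalgam_iff by blast

lemma ind_homs:
  assumes "ind f1 f2 g1 g2" "f1 \<in> hom C M0 M1" "f2 \<in> hom C M0 M2"
  obtains M3 where "g1 \<in> hom C M1 M3" "g2 \<in> hom C M2 M3" "comp C g1 f1 = comp C g2 f2"
proof -
  have e: "X = M0 \<and> Y = M1" if "f1 \<in> hom C X Y" for X Y
    using that assms(2) by (auto simp: hom_def)
  have e2: "X = M0 \<and> Y = M2" if "f2 \<in> hom C X Y" for X Y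
    using that assms(3) by (auto simp: hom_def)
  from assms(1) show thesis
    by (rule indE) (use e e2 that in metis)
qed

lemma ind_exists:
  assumes "f1 \<in> hom C M0 M1" "f2 \<in> hom C M0 M2"
  obtains M3 g1 g2 where "ind f1 f2 g1 g2" "g1 \<in> hom C M1 M3" "g2 \<in> hom C M2 M3"
    "comp C g1 f1 = comp C g2 f2"
proof -
  have "is_span C f1 f2" using assms by (auto simp: is_span_def hom_def)
  then obtain g1 g2 where i: "ind f1 f2 g1 g2" using exist unfolding existence_def by blast
  show thesis using ind_homs[OF i assms] i that by blast
qed

text \<open>Existence gives amalgamation of arbitrary spans, and two common extensions of amalgams, one of
  \<open>a\<close> and \<open>b\<close> and one of \<open>b\<close> and \<open>c\<close>, amalgamate over the target of \<open>b\<close>.\<close>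

lemma sim_eq_sim_star: "sim C f1 f2 = sim_star C f1 f2"
proof -
  have "trans (sim_star C f1 f2)"
  proof (rule transI)
    fix x y z assume xy: "(x, y) \<in> sim_star C f1 f2" and yz: "(y, z) \<in> sim_star C f1 f2"
    obtain a1 a2 b1 b2 c1 c2 where xyz: "x = (a1, a2)" "y = (b1, b2)" "z = (c1, c2)"
      by (metis surj_pair)
    obtain ga gb where 1: "ga \<in> arr C" "gb \<in> arr C"
      "src C ga = tgt C a1" "src C gb = tgt C b1" "tgt C ga = tgt C gb"
      "comp C ga a1 = comp C gb b1" "comp C ga a2 = comp C gb b2"
      and am: "amalgam C f1 f2 a1 a2" "amalgam C f1 f2 b1 b2"
      using xy unfolding xyz sim_star_def by auto
    obtain hb hc where 2: "hb \<in> arr C" "hc \<in> arr C"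
      "src C hb = tgt C b1" "src C hc = tgt C c1" "tgt C hb = tgt C hc"
      "comp C hb b1 = comp C hc c1" "comp C hb b2 = comp C hc c2"
      and am2: "amalgam C f1 f2 c1 c2"
      using yz unfolding xyz sim_star_def by auto
    let ?B = "tgt C b1" let ?P = "tgt C ga" let ?Q = "tgt C hb"
    have h1: "gb \<in> hom C ?B ?P" "ga \<in> hom C (tgt C a1) ?P" "hb \<in> hom C ?B ?Q"
      "hc \<in> hom C (tgt C c1) ?Q"
      using 1 2 by (auto simp: hom_def)
    obtain R p q where pq: "p \<in> hom C ?P R" "q \<in> hom C ?Q R" "comp C p gb = comp C q hb"
      using ind_exists[OF h1(1,3)] by metis
    have h2: "a1 \<in> hom C (src C a1) (tgt C a1)" "a2 \<in> hom C (src C a2) (tgt C a1)"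
      "b1 \<in> hom C (src C b1) ?B" "b2 \<in> hom C (src C b2) ?B"
      "c1 \<in> hom C (src C c1) (tgt C c1)" "c2 \<in> hom C (src C c2) (tgt C c1)"
      using am am2 by (auto simp: hom_def amalgam_def)
    have "comp C (comp C p ga) a1 = comp C (comp C q hc) c1"
      using comp_assoc[OF h2(1) h1(2) pq(1)] comp_assoc[OF h2(3) h1(1) pq(1)]
        comp_assoc[OF h2(3) h1(3) pq(2)] comp_assoc[OF h2(5) h1(4) pq(2)] 1(6) 2(6) pq(3) by simp
    moreover have "comp C (comp C p ga) a2 = comp C (comp C q hc) c2"
      using comp_assoc[OF h2(2) h1(2) pq(1)] comp_assoc[OF h2(4) h1(1) pq(1)]
        comp_assoc[OF h2(4) h1(3) pq(2)] comp_assoc[OF h2(6) h1(4) pq(2)] 1(7) 2(7) pq(3) by simp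
    moreover have "comp C p ga \<in> hom C (tgt C a1) R" "comp C q hc \<in> hom C (tgt C c1) R"
      using comp_hom h1 pq by blast+
    ultimately show "(x, z) \<in> sim_star C f1 f2"
      unfolding xyz using am(1) am2 sim_starI by metis
  qed
  then show ?thesis by (simp add: sim_def trancl_id)
qed

text \<open>Uniqueness in the form in which it is used: by the previous lemma no transitive closure is left.\<close>

lemma common_extension:
  assumes "ind f1 f2 a1 a2" "ind f1 f2 b1 b2" "a1 \<in> hom C M1 P" "b1 \<in> hom C M1 Q"
  obtains R ga gb where "ga \<in> hom C P R" "gb \<in> hom C Q R"
    "comp C ga a1 = comp C gb b1" "comp C ga a2 = comp C gb b2"
proof -
  have "((a1, a2), (b1, b2)) \<in> sim_star C f1 f2"
    using uniq assms(1,2) sim_eq_sim_star by (auto simp: uniqueness_def)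
  then obtain ga gb where g: "ga \<in> arr C" "gb \<in> arr C"
      "src C ga = tgt C a1" "src C gb = tgt C b1" "tgt C ga = tgt C gb"
      and c: "comp C ga a1 = comp C gb b1" "comp C ga a2 = comp C gb b2"
    unfolding sim_star_def by auto
  have "ga \<in> hom C P (tgt C gb)" "gb \<in> hom C Q (tgt C gb)"
    using g assms(3,4) by (simp_all add: hom_def)
  then show thesis by (rule that[OF _ _ c])
qed

lemma ind_common:
  assumes "ind f1 f2 a1 a2" "amalgam C f1 f2 b1 b2" "ga \<in> hom C (tgt C a1) R"
    "gb \<in> hom C (tgt C b1) R" "comp C ga a1 = comp C gb b1" "comp C ga a2 = comp C gb b2"
  shows "ind f1 f2 b1 b2"
proof -
  have "((a1, a2), (b1, b2)) \<in> sim_star C f1 f2"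
    by (rule sim_starI[OF ind_amalgam[OF assms(1)] assms(2-)])
  then have "((a1, a2), (b1, b2)) \<in> sim C f1 f2" using sim_eq_sim_star by simp
  then show ?thesis using rel assms(1) unfolding independence_relation_def by metis
qed

lemma ind_extend:
  assumes "ind f1 f2 a1 a2" "a1 \<in> hom C M1 P" "h \<in> hom C P Q"
  shows "ind f1 f2 (comp C h a1) (comp C h a2)"
proof -
  obtain X0 X1 X2 X3 where f: "f1 \<in> hom C X0 X1" "f2 \<in> hom C X0 X2" "a1 \<in> hom C X1 X3"
    "a2 \<in> hom C X2 X3" "comp C a1 f1 = comp C a2 f2" using indE[OF assms(1)] by metis
  have X: "X3 = P" "X1 = M1" using f assms by (auto simp: hom_def)
  have g: "comp C h a1 \<in> hom C X1 Q" "comp C h a2 \<in> hom C X2 Q"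
    using f assms comp_hom X by blast+
  have "comp C (comp C h a1) f1 = comp C (comp C h a2) f2"
    using comp_assoc[OF f(1) f(3)[unfolded X(1)] assms(3)] comp_assoc[OF f(2) f(4)[unfolded X(1)] assms(3)]
      f(5) by simp
  then have am: "amalgam C f1 f2 (comp C h a1) (comp C h a2)"
    unfolding amalgam_iff using f g by blast
  have I: "ident C Q \<in> hom C Q Q" using ident_hom hom_obj(2) assms(3) by blast
  show ?thesis
    by (rule ind_common[OF assms(1) am, of h Q "ident C Q"])
      (use assms(2,3) g I in \<open>auto simp: hom_tgt ident_comp\<close>)
qed

lemma ind_restrict:
  assumes "ind f1 f2 (comp C h a1) (comp C h a2)" "h \<in> hom C P Q"
    "f1 \<in> hom C M0 M1" "f2 \<in> hom C M0 M2" "a1 \<in> hom C M1 P" "a2 \<in> hom C M2 P"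
    "comp C a1 f1 = comp C a2 f2"
  shows "ind f1 f2 a1 a2"
proof -
  have am: "amalgam C f1 f2 a1 a2"
    unfolding amalgam_iff using assms by blast
  have I: "ident C Q \<in> hom C Q Q" using ident_hom hom_obj(2) assms(2) by blast
  have g: "comp C h a1 \<in> hom C M1 Q" "comp C h a2 \<in> hom C M2 Q"
    using assms comp_hom by blast+
  show ?thesis
    by (rule ind_common[OF assms(1) am, of "ident C Q" Q h])
      (use assms g I in \<open>auto simp: hom_tgt ident_comp\<close>)
qed

lemma right_trans:
  "ind f01 f02 f13 f23 \<Longrightarrow> ind f23 f24 f35 f45 \<Longrightarrow>
     ind f01 (comp C f24 f02) (comp C f35 f13) f45"
  using trans unfolding transitive_def right_transitive_def by blast

lemma left_trans:
  "ind f02 f01 f23 f13 \<Longrightarrow> ind f24 f23 f45 f35 \<Longrightarrow>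
     ind (comp C f24 f02) f01 f45 (comp C f35 f13)"
  using trans unfolding transitive_def left_transitive_def right_transitive_def dual_def by blast

text \<open>Base monotonicity: build an independent square over \<open>M0\<close> and \<open>M2\<close>, and over its right side an
independent square with \<open>f24\<close>.  By right transitivity the composite is independent, so by uniqueness
it is the given square up to a common extension.\<close>

lemma base_mono:
  assumes i: "ind f01 (comp C f24 f02) g1 g2"
    and h: "f01 \<in> hom C M0 M1" "f02 \<in> hom C M0 M2" "f24 \<in> hom C M2 M4"
      "g1 \<in> hom C M1 N"
  obtains M3 Q f13 f23 h k where "ind f01 f02 f13 f23" "ind f23 f24 k (comp C h g2)"
    "f13 \<in> hom C M1 M3" "f23 \<in> hom C M2 M3" "h \<in> hom C N Q" "k \<in> hom C M3 Q"
    "comp C k f13 = comp C h g1"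
proof -
  obtain M3 f13 f23 where 1: "ind f01 f02 f13 f23" "f13 \<in> hom C M1 M3" "f23 \<in> hom C M2 M3"
    using ind_exists[OF h(1,2)] by metis
  obtain M5 f35 f45 where 2: "ind f23 f24 f35 f45" "f35 \<in> hom C M3 M5" "f45 \<in> hom C M4 M5"
    using ind_exists[OF 1(3) h(3)] by metis
  have h4: "comp C f35 f13 \<in> hom C M1 M5" using 1 2 comp_hom by blast
  obtain Q ga gb where 3: "ga \<in> hom C N Q" "gb \<in> hom C M5 Q"
    "comp C ga g1 = comp C gb (comp C f35 f13)" "comp C ga g2 = comp C gb f45"
    using common_extension[OF i right_trans[OF 1(1) 2(1)] h(4) h4] by metis
  have A: "ind f23 f24 (comp C gb f35) (comp C ga g2)"
    using ind_extend[OF 2(1,2) 3(2)] 3(4) by simp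
  have B: "comp C (comp C gb f35) f13 = comp C ga g1"
    using 3(3) comp_assoc[OF 1(2) 2(2) 3(2)] by simp
  show thesis by (rule that[OF 1(1) A 1(2,3) 3(1) comp_hom[OF 2(2) 3(2)] B])
qed

text \<open>The square built for base monotonicity contains an independent square with right side \<open>f02\<close>.\<close>

lemma right_mono:
  assumes i: "ind f01 (comp C f24 f02) g1 g2"
    and h: "f02 \<in> hom C M0 M2" "f24 \<in> hom C M2 M4"
  shows "ind f01 f02 g1 (comp C g2 f24)"
proof -
  obtain X0 X1 X2 N where f: "f01 \<in> hom C X0 X1" "comp C f24 f02 \<in> hom C X0 X2" "g1 \<in> hom C X1 N"
    "g2 \<in> hom C X2 N" "comp C g1 f01 = comp C g2 (comp C f24 f02)" using indE[OF i] by metis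
  have X: "X0 = M0" "X2 = M4" using f(2) h comp_hom[OF h] by (auto simp: hom_def)
  note f = f[unfolded X]
  obtain M3 Q f13 f23 e k where 1: "ind f01 f02 f13 f23" "ind f23 f24 k (comp C e g2)"
    "f13 \<in> hom C X1 M3" "f23 \<in> hom C M2 M3" "e \<in> hom C N Q" "k \<in> hom C M3 Q"
    "comp C k f13 = comp C e g1"
    using base_mono[OF i f(1) h f(3)] by metis
  have "comp C k f23 = comp C (comp C e g2) f24"
    using ind_homs[OF 1(2,4) h(2)] by metis
  also have "\<dots> = comp C e (comp C g2 f24)" using comp_assoc[OF h(2) f(4) 1(5)] .
  finally have "ind f01 f02 (comp C e g1) (comp C e (comp C g2 f24))"
    using ind_extend[OF 1(1,3,6)] 1(7) by simp
  moreover have "comp C g2 f24 \<in> hom C M2 N" using comp_hom h f(4) by blast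
  moreover have "comp C g1 f01 = comp C (comp C g2 f24) f02"
    using f(5) comp_assoc[OF h f(4)] by simp
  ultimately show ?thesis using ind_restrict 1(5) f h by metis
qed

lemma dual_independence: "independence C (dual ind)"
proof
  have am: "amalgam C f1 f2 g1 g2 \<Longrightarrow> amalgam C f2 f1 g2 g1" for f1 f2 g1 g2
    by (auto simp: amalgam_def is_span_def)
  have st: "((a1, a2), (b1, b2)) \<in> sim_star C f1 f2 \<Longrightarrow> ((a2, a1), (b2, b1)) \<in> sim_star C f2 f1"
    for a1 a2 b1 b2 f1 f2
    unfolding sim_star_def using am by (auto simp: amalgam_def) metis
  have s: "((a1, a2), (b1, b2)) \<in> sim C f1 f2 \<Longrightarrow> ((a2, a1), (b2, b1)) \<in> sim C f2 f1"
    for a1 a2 b1 b2 f1 f2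
    using st sim_eq_sim_star by blast
  show "independence_relation C (dual ind)"
    using rel am s unfolding independence_relation_def dual_def by blast
  show "existence C (dual ind)"
    using exist unfolding existence_def dual_def is_span_def by metis
  show "uniqueness C (dual ind)"
    using uniq s unfolding uniqueness_def dual_def by blast
  show "transitive C (dual ind)"
    using trans by (auto simp: transitive_def left_transitive_def dual_def)
qed

lemma left_mono:
  assumes i: "ind (comp C f24 f02) f01 g2 g1"
    and h: "f02 \<in> hom C M0 M2" "f24 \<in> hom C M2 M4"
  shows "ind f02 f01 (comp C g2 f24) g1"
proof -
  interpret D: independence C "dual ind" by (rule dual_independence)
  show ?thesis using D.right_mono[of f01 f24 f02 g1 g2] assms by (simp add: dual_def)
qed

text \<open>A square whose side \<open>h0\<close> is invertible and whose opposite side \<open>h1\<close> has a left inverse \<open>k1\<close> is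
  independent: it maps, by way of \<open>k1\<close>, to any independent amalgam of its span.\<close>

lemma ind_iso:
  assumes h: "f \<in> hom C M0 M1" "h0 \<in> hom C M0 M2" "h1 \<in> hom C M1 M3" "g \<in> hom C M2 M3"
    and c: "comp C h1 f = comp C g h0"
    and k1: "k1 \<in> hom C M3 M1" "comp C k1 h1 = ident C M1"
    and k0: "k0 \<in> hom C M2 M0" "comp C k0 h0 = ident C M0" "comp C h0 k0 = ident C M2"
  shows "ind f h0 h1 g"
proof -
  obtain Q a b where ab: "ind f h0 a b" "a \<in> hom C M1 Q" "b \<in> hom C M2 Q"
    "comp C a f = comp C b h0" using ind_exists[OF h(1,2)] by metis
  let ?e = "comp C a k1"
  have e: "?e \<in> hom C M3 Q" using comp_hom ab k1 by blast
  have 1: "comp C ?e h1 = a" using comp_assoc[OF h(3) k1(1) ab(2)] k1(2) comp_ident[OF ab(2)] by simp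
  have g: "g = comp C (comp C h1 f) k0"
    using c comp_assoc[OF k0(1) h(2,4)] k0(3) comp_ident[OF h(4)] by simp
  have "comp C ?e g = comp C (comp C ?e (comp C h1 f)) k0"
    using g comp_assoc[OF k0(1) comp_hom[OF h(1,3)] e] by simp
  also have "comp C ?e (comp C h1 f) = comp C b h0"
    using comp_assoc[OF h(1,3) e] 1 ab(4) by simp
  also have "comp C (comp C b h0) k0 = b"
    using comp_assoc[OF k0(1) h(2) ab(3)] k0(3) comp_ident[OF ab(3)] by simp
  finally have 2: "comp C ?e g = b" .
  show ?thesis
    by (rule ind_restrict[of f h0 ?e h1 g, OF _ e h(1,2,3,4) c]) (use ab 1 2 in simp)
qed

lemma ind_ident: "f \<in> hom C M N \<Longrightarrow> ind f (ident C M) (ident C N) f"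
  by (rule ind_iso[of f M N _ M _ N _ "ident C N" "ident C M"])
    (use hom_obj[of f M N] ident_hom ident_comp comp_ident in auto)

text \<open>Isomorphisms of the span move into an independent square by transitivity, because a square two of
whose opposite sides are invertible is independent.\<close>

lemma ind_transport:
  assumes i: "ind f1 f2 g1 g2" and f: "f1 \<in> hom C M0 M1" "f2 \<in> hom C M0 M2"
    and f': "f1' \<in> hom C N0 N1" "f2' \<in> hom C N0 N2"
    and a0: "a0 \<in> hom C N0 M0" "b0 \<in> hom C M0 N0" "comp C b0 a0 = ident C N0" "comp C a0 b0 = ident C M0"
    and a1: "a1 \<in> hom C N1 M1" "b1 \<in> hom C M1 N1" "comp C b1 a1 = ident C N1"
    and a2: "a2 \<in> hom C N2 M2"
    and c: "comp C a1 f1' = comp C f1 a0" "comp C a2 f2' = comp C f2 a0"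
  shows "ind f1' f2' (comp C g1 a1) (comp C g2 a2)"
proof -
  have "ind f1' a0 a1 f1" by (rule ind_iso[OF f'(1) a0(1) a1(1) f(1) c(1) a1(2,3) a0(2-4)])
  from right_trans[OF this i] have "ind f1' (comp C a2 f2') (comp C g1 a1) g2" using c(2) by simp
  then show ?thesis by (rule right_mono[OF _ f'(2) a2])
qed

lemma NF_category: "category (NF_cat C ind)"
proof -
  have arrD: "src C h1 = src C f \<and> tgt C h1 = src C g \<and> src C h2 = tgt C f \<and> tgt C h2 = tgt C g \<and>
    f \<in> arr C \<and> h1 \<in> arr C \<and> h2 \<in> arr C \<and> g \<in> arr C" if "ind f h1 h2 g" for f h1 h2 g
    using ind_amalgam[OF that] by (auto simp: amalgam_def is_span_def)
  show ?thesis
    unfolding category_def NF_cat_def hom_def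
  proof (intro conjI ballI impI, goal_cases)
    case (1 a) then show ?case using arrD by auto
  next
    case (2 a) then show ?case using arrD by auto
  next
    case (3 f) then show ?case using ind_ident[OF arr_hom, of f] by auto
  next
    case (4 a b) then show ?case using right_trans by auto
  next
    case (5 a)
    then show ?case using arrD comp_ident[OF arr_hom] by auto metis+
  next
    case (6 a)
    then show ?case using arrD ident_comp[OF arr_hom] by auto metis+
  next
    case (7 a b c)
    obtain f h1 h2 g where a: "a = (f, h1, h2, g)" by (cases a)
    obtain k1 k2 g' where b: "b = (g, k1, k2, g')" using 7 a by (cases b) auto
    obtain l1 l2 g'' where c: "c = (g', l1, l2, g'')" using 7 b by (cases c) auto
    have "ind f h1 h2 g" "ind g k1 k2 g'" "ind g' l1 l2 g''" using 7 a b c by auto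
    then show ?case unfolding a b c
      using arrD comp_assoc[OF arr_hom, of h1 k1 _ l1] comp_assoc[OF arr_hom, of h2 k2 _ l2]
      by (auto simp: hom_def)
  qed
qed

end

section \<open>Small sets\<close>

text \<open>A set of any type counts as small if its cardinality is below \<open>\<V>\<close>, the cardinality of the type
that plays the universe.\<close>

locale universe =
  fixes mu :: "'v rel"
  assumes inacc: "inaccessible_universe TYPE('v)"
    and regmu: "regular_cardinal mu"
begin

abbreviation card_universe :: "'v rel" ("\<V>") where
  "\<V> \<equiv> |UNIV :: 'v set|"

lemma infinite_UNIV: "infinite (UNIV :: 'v set)"
  using inacc infinite_iff_natLeq_ordLeq ordLess_imp_ordLeq
  unfolding inaccessible_universe_def by blast

lemma stable_UNIV: "stable \<V>"
  using inacc infinite_UNIV unfolding inaccessible_universe_def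
  by (intro regularCard_stable card_of_Card_order) (auto simp: Field_card_of)

lemma vsmall_le: "|A| \<le>o |B| \<Longrightarrow> |B| <o \<V> \<Longrightarrow> |A| <o \<V>"
  by (rule ordLeq_ordLess_trans)

lemma vsmall_subset: "A \<subseteq> B \<Longrightarrow> |B| <o \<V> \<Longrightarrow> |A| <o \<V>"
  using vsmall_le card_of_mono1 by blast

lemma vsmall_image: "|A| <o \<V> \<Longrightarrow> |f ` A| <o \<V>"
  using vsmall_le card_of_image by blast

lemma vsmall_UN: "|I| <o \<V> \<Longrightarrow> (\<And>i. i \<in> I \<Longrightarrow> |A i| <o \<V>) \<Longrightarrow> |\<Union>i\<in>I. A i| <o \<V>"
  using stable_UNION[OF stable_UNIV] by blast

lemma vsmall_Sigma: "|I| <o \<V> \<Longrightarrow> (\<And>i. i \<in> I \<Longrightarrow> |A i| <o \<V>) \<Longrightarrow> |Sigma I A| <o \<V>"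
  using stable_elim[OF stable_UNIV] by blast

lemma vsmall_Un: "|A| <o \<V> \<Longrightarrow> |B| <o \<V> \<Longrightarrow> |A \<union> B| <o \<V>"
  using card_of_Un_ordLess_infinite[OF infinite_UNIV] by blast

lemma vsmall_inj: "inj_on f A \<Longrightarrow> f ` A \<subseteq> B \<Longrightarrow> |B| <o \<V> \<Longrightarrow> |A| <o \<V>"
  using vsmall_le card_of_ordLeq by blast

lemma vsmall_Pow:
  assumes "|A| <o \<V>" shows "|Pow A| <o \<V>"
proof -
  obtain f :: "'a \<Rightarrow> 'v" where f: "inj_on f A"
    using ordLess_imp_ordLeq[OF assms] unfolding card_of_ordLeq[symmetric] by blast
  have "|Pow (f ` A)| <o \<V>"
    using inacc vsmall_image[OF assms, of f] unfolding inaccessible_universe_def by blast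
  moreover have "inj_on (image f) (Pow A)" using f by (simp add: inj_on_image_Pow)
  ultimately show ?thesis using vsmall_inj[of "image f" "Pow A" "Pow (f ` A)"] by auto
qed

lemma vsmall_PiE:
  assumes "|A| <o \<V>" "\<And>a. a \<in> A \<Longrightarrow> |B a| <o \<V>"
  shows "|PiE A B| <o \<V>"
proof (rule vsmall_inj[of "\<lambda>f. (\<lambda>a. (a, f a)) ` A" _ "Pow (Sigma A B)"])
  show "inj_on (\<lambda>f. (\<lambda>a. (a, f a)) ` A) (PiE A B)"
  proof (rule inj_onI)
    fix f g assume fg: "f \<in> PiE A B" "g \<in> PiE A B" and e: "(\<lambda>a. (a, f a)) ` A = (\<lambda>a. (a, g a)) ` A"
    show "f = g"
    proof (rule PiE_ext[OF fg])
      fix a assume "a \<in> A"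
      then have "(a, f a) \<in> (\<lambda>a. (a, g a)) ` A" using e by blast
      then show "f a = g a" by auto
    qed
  qed
  show "|Pow (Sigma A B)| <o \<V>" using assms by (intro vsmall_Pow vsmall_Sigma)
qed auto

lemma vsmall_code:
  assumes "|A| <o \<V>" obtains e :: "'a \<Rightarrow> 'v" where "inj_on e A"
  using ordLess_imp_ordLeq[OF assms] unfolding card_of_ordLeq[symmetric] by blast

lemma vsmall_fresh_code:
  fixes A :: "'a set" and X :: "'v set"
  assumes "|A| <o \<V>" "small X" obtains e :: "'a \<Rightarrow> 'v" where "inj_on e A" "e ` A \<inter> X = {}"
proof -
  have "\<not> |UNIV - X| <o \<V>"
  proof
    assume "|UNIV - X| <o \<V>"
    then have "|(UNIV - X) \<union> X| <o \<V>"
      using vsmall_Un assms(2) unfolding small_def by blast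
    moreover have "(UNIV - X) \<union> X = UNIV" by blast
    ultimately show False using ordLess_irreflexive by metis
  qed
  then have "\<V> \<le>o |UNIV - X|"
    using card_of_Well_order not_ordLess_iff_ordLeq by blast
  then have "|A| \<le>o |UNIV - X|" using assms(1) ordLess_imp_ordLeq ordLeq_transitive by blast
  then obtain e where "inj_on e A" "e ` A \<subseteq> UNIV - X" unfolding card_of_ordLeq[symmetric] by blast
  then show thesis using that by blast
qed

lemma mu_card: "Card_order mu" "infinite (Field mu)" "regularCard mu" "|Field mu| <o \<V>"
  using regmu unfolding regular_cardinal_def infinite_cardinal_def is_cardinal_def small_def by auto

lemma vsmall_less_mu: "|A| <o mu \<Longrightarrow> |A| <o \<V>"
  using mu_card(1,4) card_of_Field_ordIso ordLess_imp_ordLeq ordIso_ordLeq_trans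
    ordIso_symmetric ordLess_ordIso_trans ordLess_transitive by meson

end

section \<open>Transport of structures\<close>

lemma compose_compose: "compose A g (compose A f t) = compose A (\<lambda>x. g (f x)) t"
  by (auto simp: compose_def restrict_def)

lemma compose_cong: "t \<in> A \<rightarrow>\<^sub>E U \<Longrightarrow> (\<And>x. x \<in> U \<Longrightarrow> f x = g x) \<Longrightarrow> compose A f t = compose A g t"
  by (fastforce simp: compose_def restrict_def)

lemma compose_ident: "t \<in> A \<rightarrow>\<^sub>E U \<Longrightarrow> (\<And>x. x \<in> U \<Longrightarrow> f x = x) \<Longrightarrow> compose A f t = t"
  by (intro ext) (fastforce simp: compose_def restrict_def PiE_def extensional_def)

lemma compose_PiE: "t \<in> A \<rightarrow>\<^sub>E U \<Longrightarrow> f ` U \<subseteq> W \<Longrightarrow> compose A f t \<in> A \<rightarrow>\<^sub>E W"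
  by (fastforce simp: compose_def)

text \<open>The structure on \<open>f ` univ M\<close> that makes \<open>f\<close> an isomorphism, for \<open>f\<close> injective on the universe
of \<open>M\<close>.  Being determined by \<open>f\<close> and \<open>M\<close>, it replaces the existentially quantified submodel in the
definition of a \<open>K\<close>-embedding.\<close>

definition image_struct :: "'v vocabulary \<Rightarrow> ('v \<Rightarrow> 'v) \<Rightarrow> 'v struct \<Rightarrow> 'v struct" where
  "image_struct tau f M =
     \<lparr> univ = f ` univ M,
       fint = (\<lambda>s. if s \<in> fsym tau then
                 (\<lambda>t \<in> farity tau s \<rightarrow>\<^sub>E f ` univ M.
                    f (fint M s (compose (farity tau s) (inv_into (univ M) f) t)))
               else undefined),
       rint = (\<lambda>s. if s \<in> rsym tau then compose (rarity tau s) f ` rint M s else {}) \<rparr>"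

lemma univ_image_struct [simp]: "univ (image_struct tau f M) = f ` univ M"
  by (simp add: image_struct_def)

lemma fint_in: "is_struct tau M \<Longrightarrow> s \<in> fsym tau \<Longrightarrow> t \<in> farity tau s \<rightarrow>\<^sub>E univ M \<Longrightarrow>
    fint M s t \<in> univ M"
  by (auto simp: is_struct_def)

lemma struct_iso_fint: "struct_iso tau f M N \<Longrightarrow> s \<in> fsym tau \<Longrightarrow> t \<in> farity tau s \<rightarrow>\<^sub>E univ M \<Longrightarrow>
    f (fint M s t) = fint N s (compose (farity tau s) f t)"
  and struct_iso_rint: "struct_iso tau f M N \<Longrightarrow> s \<in> rsym tau \<Longrightarrow> t \<in> rarity tau s \<rightarrow>\<^sub>E univ M \<Longrightarrow>
    t \<in> rint M s \<longleftrightarrow> compose (rarity tau s) f t \<in> rint N s"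
  by (simp_all add: struct_iso_def)

lemma substructure_fint: "substructure tau M N \<Longrightarrow> s \<in> fsym tau \<Longrightarrow>
    t \<in> farity tau s \<rightarrow>\<^sub>E univ M \<Longrightarrow> fint M s t = fint N s t"
  and substructure_rint: "substructure tau M N \<Longrightarrow> s \<in> rsym tau \<Longrightarrow>
    rint M s = rint N s \<inter> (rarity tau s \<rightarrow>\<^sub>E univ M)"
  by (simp_all add: substructure_def)

lemma struct_eqI:
  assumes M: "is_struct tau M" and N: "is_struct tau N" and U: "univ M = univ N"
    and F: "\<And>s t. s \<in> fsym tau \<Longrightarrow> t \<in> farity tau s \<rightarrow>\<^sub>E univ M \<Longrightarrow> fint M s t = fint N s t"
    and R: "\<And>s t. s \<in> rsym tau \<Longrightarrow> t \<in> rarity tau s \<rightarrow>\<^sub>E univ M \<Longrightarrow> t \<in> rint M s \<longleftrightarrow> t \<in> rint N s"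
  shows "M = N"
proof -
  have "fint M s = fint N s" for s
  proof (cases "s \<in> fsym tau")
    case True
    show ?thesis
      by (rule PiE_ext[of _ "farity tau s \<rightarrow>\<^sub>E univ M" "\<lambda>_. univ M"])
        (use M N U F True in \<open>auto simp: is_struct_def\<close>)
  qed (use M N in \<open>auto simp: is_struct_def\<close>)
  moreover have "rint M s = rint N s" for s
  proof (cases "s \<in> rsym tau")
    case True
    have 1: "rint M s \<subseteq> (rarity tau s \<rightarrow>\<^sub>E univ M)" "rint N s \<subseteq> (rarity tau s \<rightarrow>\<^sub>E univ M)"
      using M N U True unfolding is_struct_def by metis+
    then show ?thesis using R[OF True] by blast
  qed (use M N in \<open>auto simp: is_struct_def\<close>)
  ultimately show ?thesis using U by (simp add: ext)
qed

locale structures = universe mu for mu :: "'v rel" +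
  fixes tau :: "'v vocabulary"
begin

lemma struct_iso_image:
  assumes M: "is_struct tau M" and f: "inj_on f (univ M)"
  shows "struct_iso tau f M (image_struct tau f M)"
proof -
  let ?N = "image_struct tau f M" and ?i = "inv_into (univ M) f"
  have i: "?i ` f ` univ M \<subseteq> univ M" using f by auto
  have N: "is_struct tau ?N"
    unfolding is_struct_def
  proof (intro conjI ballI allI impI)
    show "small (univ ?N)" using M vsmall_image[of "univ M" f] by (simp add: is_struct_def small_def)
    fix s assume s: "s \<in> fsym tau"
    have "f (fint M s (compose (farity tau s) ?i t)) \<in> f ` univ M"
      if "t \<in> farity tau s \<rightarrow>\<^sub>E f ` univ M" for t
      using fint_in[OF M s compose_PiE[OF that i]] by blast
    then show "fint ?N s \<in> (farity tau s \<rightarrow>\<^sub>E univ ?N) \<rightarrow>\<^sub>E univ ?N"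
      using s by (auto simp: image_struct_def)
  next
    fix s assume s: "s \<in> rsym tau"
    then have "rint M s \<subseteq> (rarity tau s \<rightarrow>\<^sub>E univ M)" using M by (auto simp: is_struct_def)
    then show "rint ?N s \<subseteq> rarity tau s \<rightarrow>\<^sub>E univ ?N"
      using s compose_PiE[of _ "rarity tau s" "univ M" f "f ` univ M"]
      by (simp only: image_struct_def struct.simps if_True) blast
  qed (auto simp: image_struct_def)
  have *: "compose A ?i (compose A f t) = t" if "t \<in> A \<rightarrow>\<^sub>E univ M" for A :: "'v set" and t
    using compose_ident[OF that, of "\<lambda>x. ?i (f x)"] f by (simp add: compose_compose)
  show ?thesis
    unfolding struct_iso_def
  proof (intro conjI ballI)
    show "bij_betw f (univ M) (univ ?N)" using f by (simp add: bij_betw_def)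
  next
    fix s t assume s: "s \<in> fsym tau" and t: "t \<in> farity tau s \<rightarrow>\<^sub>E univ M"
    show "f (fint M s t) = fint ?N s (compose (farity tau s) f t)"
      using s *[OF t] by (simp only: image_struct_def struct.simps if_True
          restrict_apply'[OF compose_PiE[OF t subset_refl]])
  next
    fix s t assume s: "s \<in> rsym tau" and t: "t \<in> rarity tau s \<rightarrow>\<^sub>E univ M"
    have "rint M s \<subseteq> (rarity tau s \<rightarrow>\<^sub>E univ M)" using M s by (auto simp: is_struct_def)
    then have "t' = t" if "t' \<in> rint M s" "compose (rarity tau s) f t = compose (rarity tau s) f t'" for t'
      using *[OF t] *[of t' "rarity tau s"] that by (metis subsetD)
    then show "t \<in> rint M s \<longleftrightarrow> compose (rarity tau s) f t \<in> rint ?N s"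
      using s by (auto simp: image_struct_def)
  qed (use M N in auto)
qed

lemma struct_iso_inv:
  assumes f: "struct_iso tau f M N" shows "struct_iso tau (inv_into (univ M) f) N M"
proof -
  let ?i = "inv_into (univ M) f"
  have b: "bij_betw f (univ M) (univ N)" using f by (simp add: struct_iso_def)
  have i: "?i ` univ N \<subseteq> univ M" using b by (auto simp: bij_betw_def inv_into_into)
  have *: "compose A f (compose A ?i t) = t" if "t \<in> A \<rightarrow>\<^sub>E univ N" for A :: "'v set" and t
    using compose_ident[OF that, of "\<lambda>x. f (?i x)"] b
    by (simp add: compose_compose bij_betw_inv_into_right)
  show ?thesis
    unfolding struct_iso_def
  proof (intro conjI ballI)
    show "bij_betw ?i (univ N) (univ M)" using b by (rule bij_betw_inv_into)
  next
    fix s t assume s: "s \<in> fsym tau" and t: "t \<in> farity tau s \<rightarrow>\<^sub>E univ N"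
    have M: "is_struct tau M" using f by (simp add: struct_iso_def)
    have t': "compose (farity tau s) ?i t \<in> farity tau s \<rightarrow>\<^sub>E univ M" using compose_PiE[OF t i] .
    have "f (fint M s (compose (farity tau s) ?i t)) = fint N s t"
      using struct_iso_fint[OF f s t'] *[OF t] by simp
    then show "?i (fint N s t) = fint M s (compose (farity tau s) ?i t)"
      using bij_betw_inv_into_left[OF b fint_in[OF M s t']] by metis
  next
    fix s t assume s: "s \<in> rsym tau" and t: "t \<in> rarity tau s \<rightarrow>\<^sub>E univ N"
    have t': "compose (rarity tau s) ?i t \<in> rarity tau s \<rightarrow>\<^sub>E univ M" using compose_PiE[OF t i] .
    show "t \<in> rint N s \<longleftrightarrow> compose (rarity tau s) ?i t \<in> rint M s"
      using struct_iso_rint[OF f s t'] *[OF t] by simp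
  qed (use f in \<open>auto simp: struct_iso_def\<close>)
qed

lemma struct_iso_comp:
  assumes f: "struct_iso tau f M N" and g: "struct_iso tau g N P"
    and h: "\<And>x. x \<in> univ M \<Longrightarrow> h x = g (f x)"
  shows "struct_iso tau h M P"
proof -
  have b: "bij_betw f (univ M) (univ N)" "bij_betw g (univ N) (univ P)"
    using f g by (auto simp: struct_iso_def)
  have fi: "f ` univ M \<subseteq> univ N" using b by (simp add: bij_betw_def)
  have *: "compose A h t = compose A g (compose A f t)" if "t \<in> A \<rightarrow>\<^sub>E univ M" for A :: "'v set" and t
    using compose_cong[OF that, of h "\<lambda>x. g (f x)"] h by (simp add: compose_compose)
  show ?thesis
    unfolding struct_iso_def
  proof (intro conjI ballI)
    show "bij_betw h (univ M) (univ P)"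
      using bij_betw_trans[OF b] by (rule bij_betw_cong[THEN iffD1, rotated]) (simp add: h)
  next
    fix s t assume s: "s \<in> fsym tau" and t: "t \<in> farity tau s \<rightarrow>\<^sub>E univ M"
    have M: "is_struct tau M" using f by (simp add: struct_iso_def)
    show "h (fint M s t) = fint P s (compose (farity tau s) h t)"
      using f g s t compose_PiE[OF t fi] h[OF fint_in[OF M s t]] *[OF t] unfolding struct_iso_def by simp
  next
    fix s t assume s: "s \<in> rsym tau" and t: "t \<in> rarity tau s \<rightarrow>\<^sub>E univ M"
    show "t \<in> rint M s \<longleftrightarrow> compose (rarity tau s) h t \<in> rint P s"
      using f g s t compose_PiE[OF t fi] *[OF t] unfolding struct_iso_def by simp
  qed (use f g in \<open>auto simp: struct_iso_def\<close>)
qed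

lemma struct_iso_id: "is_struct tau M \<Longrightarrow> (\<And>x. x \<in> univ M \<Longrightarrow> f x = x) \<Longrightarrow> struct_iso tau f M M"
proof -
  assume M: "is_struct tau M" and f: "\<And>x. x \<in> univ M \<Longrightarrow> f x = x"
  have c: "compose A f t = t" if "t \<in> A \<rightarrow>\<^sub>E univ M" for A :: "'v set" and t using compose_ident[OF that f] .
  have "bij_betw f (univ M) (univ M)" using f by (auto simp: bij_betw_def inj_on_def)
  then show ?thesis using M f c fint_in[OF M] unfolding struct_iso_def by simp
qed

lemma struct_iso_unique:
  assumes f: "struct_iso tau f M N" and g: "struct_iso tau g M N'"
    and e: "\<And>x. x \<in> univ M \<Longrightarrow> f x = g x"
  shows "N = N'"
proof -
  have i: "struct_iso tau (\<lambda>x. g (inv_into (univ M) f x)) N N'"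
    using struct_iso_comp[OF struct_iso_inv[OF f] g] by simp
  have id: "g (inv_into (univ M) f x) = x" if "x \<in> univ N" for x
    using f that e[of "inv_into (univ M) f x"]
    by (auto simp: struct_iso_def bij_betw_def inv_into_into f_inv_into_f)
  have N: "is_struct tau N" using f by (simp add: struct_iso_def)
  have U: "univ N = univ N'" using f g e by (auto simp: struct_iso_def bij_betw_def)
  show ?thesis
  proof (rule struct_eqI[OF _ _ U])
    show "fint N s t = fint N' s t" if "s \<in> fsym tau" "t \<in> farity tau s \<rightarrow>\<^sub>E univ N" for s t
      using struct_iso_fint[OF i that] compose_ident[OF that(2) id] id[OF fint_in[OF N that]] by simp
    show "t \<in> rint N s \<longleftrightarrow> t \<in> rint N' s" if "s \<in> rsym tau" "t \<in> rarity tau s \<rightarrow>\<^sub>E univ N" for s t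
      using struct_iso_rint[OF i that] compose_ident[OF that(2) id] by simp
  qed (use f g in \<open>auto simp: struct_iso_def\<close>)
qed

lemma struct_iso_eq_image: "struct_iso tau f M N \<Longrightarrow> N = image_struct tau f M"
  by (rule struct_iso_unique[OF _ struct_iso_image]) (simp_all add: struct_iso_def bij_betw_def)

lemma substructure_within:
  assumes "substructure tau A Q" "substructure tau B Q" "univ A \<subseteq> univ B"
  shows "substructure tau A B"
proof -
  have "(I \<rightarrow>\<^sub>E univ A) \<subseteq> (I \<rightarrow>\<^sub>E univ B)" for I :: "'v set" using assms(3) by (rule PiE_mono)
  then have in_B: "t \<in> I \<rightarrow>\<^sub>E univ A \<Longrightarrow> t \<in> I \<rightarrow>\<^sub>E univ B" for I :: "'v set" and t by blast
  show ?thesis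
    unfolding substructure_def
  proof (intro conjI ballI)
    show "fint A s t = fint B s t" if "s \<in> fsym tau" "t \<in> farity tau s \<rightarrow>\<^sub>E univ A" for s t
      using substructure_fint[OF assms(1) that] substructure_fint[OF assms(2) that(1) in_B[OF that(2)]] by simp
    show "rint A s = rint B s \<inter> (rarity tau s \<rightarrow>\<^sub>E univ A)" if "s \<in> rsym tau" for s
      using substructure_rint[OF assms(1) that] substructure_rint[OF assms(2) that]
        in_B[of _ "rarity tau s"] by blast
  qed (use assms in \<open>auto simp: substructure_def\<close>)
qed

lemma substructure_eq:
  assumes "substructure tau A Q" "substructure tau B Q" "univ A = univ B"
  shows "A = B"
  by (rule struct_eqI[of tau]) (use assms in \<open>auto simp: substructure_def\<close>)

lemma substructure_image:
  assumes s: "substructure tau A M" and f: "struct_iso tau f M N"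
  shows "substructure tau (image_struct tau f A) N" "struct_iso tau f A (image_struct tau f A)"
proof -
  have sub: "univ A \<subseteq> univ M" "is_struct tau A" using s by (auto simp: substructure_def)
  have inj: "inj_on f (univ A)" using f sub inj_on_subset by (auto simp: struct_iso_def bij_betw_def)
  show iso: "struct_iso tau f A (image_struct tau f A)" by (rule struct_iso_image[OF sub(2) inj])
  let ?B = "image_struct tau f A" and ?i = "inv_into (univ A) f"
  have i: "?i ` univ ?B \<subseteq> univ A" using inj by auto
  have *: "compose I f (compose I ?i t) = t" if "t \<in> I \<rightarrow>\<^sub>E univ ?B" for I :: "'v set" and t
    using compose_ident[OF that, of "\<lambda>x. f (?i x)"] inj by (auto simp: compose_compose f_inv_into_f)
  have le: "t \<in> I \<rightarrow>\<^sub>E univ A \<Longrightarrow> t \<in> I \<rightarrow>\<^sub>E univ M" for I :: "'v set" and t using sub(1) by auto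
  have fN: "f ` univ M = univ N" using f by (auto simp: struct_iso_def bij_betw_def)
  show "substructure tau ?B N"
    unfolding substructure_def
  proof (intro conjI ballI)
    show "is_struct tau ?B" "is_struct tau N" using iso f by (auto simp: struct_iso_def)
    show "univ ?B \<subseteq> univ N" using fN sub by auto
  next
    fix s t assume s1: "s \<in> fsym tau" and t: "t \<in> farity tau s \<rightarrow>\<^sub>E univ ?B"
    let ?t = "compose (farity tau s) ?i t"
    have t': "?t \<in> farity tau s \<rightarrow>\<^sub>E univ A" by (rule compose_PiE[OF t i])
    have "fint ?B s t = f (fint A s ?t)" using struct_iso_fint[OF iso s1 t'] *[OF t] by simp
    moreover have "fint N s t = f (fint M s ?t)" using struct_iso_fint[OF f s1 le[OF t']] *[OF t] by simp
    moreover have "fint A s ?t = fint M s ?t" using substructure_fint[OF s s1 t'] .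
    ultimately show "fint ?B s t = fint N s t" by simp
  next
    fix s assume s1: "s \<in> rsym tau"
    have B: "rint ?B s \<subseteq> rarity tau s \<rightarrow>\<^sub>E univ ?B" using iso s1 by (simp add: struct_iso_def is_struct_def)
    have "t \<in> rint ?B s \<longleftrightarrow> t \<in> rint N s" if t: "t \<in> rarity tau s \<rightarrow>\<^sub>E univ ?B" for t
    proof -
      let ?t = "compose (rarity tau s) ?i t"
      have t': "?t \<in> rarity tau s \<rightarrow>\<^sub>E univ A" by (rule compose_PiE[OF t i])
      have "t \<in> rint ?B s \<longleftrightarrow> ?t \<in> rint A s" using struct_iso_rint[OF iso s1 t'] *[OF t] by simp
      moreover have "t \<in> rint N s \<longleftrightarrow> ?t \<in> rint M s" using struct_iso_rint[OF f s1 le[OF t']] *[OF t] by simp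
      moreover have "rint A s = rint M s \<inter> (rarity tau s \<rightarrow>\<^sub>E univ A)" using substructure_rint[OF s s1] .
      ultimately show ?thesis using t' by blast
    qed
    then show "rint ?B s = rint N s \<inter> (rarity tau s \<rightarrow>\<^sub>E univ ?B)" using B by blast
  qed
qed

end

section \<open>The category of a \<open>mu\<close>-abstract elementary class\<close>

definition app :: "'v K_arrow \<Rightarrow> 'v \<Rightarrow> 'v" where
  "app a = fst (snd a)"

definition rng :: "'v K_arrow \<Rightarrow> 'v set" where
  "rng a = app a ` univ (fst a)"

definition arrow :: "'v struct \<Rightarrow> ('v \<Rightarrow> 'v) \<Rightarrow> 'v struct \<Rightarrow> 'v K_arrow" where
  "arrow M f N = (M, restrict f (univ M), N)"

lemma app_arrow: "x \<in> univ M \<Longrightarrow> app (arrow M f N) x = f x"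
  by (simp add: app_def arrow_def)

lemma inclusion_eq_arrow: "inclusion M N = arrow M id N"
  by (simp add: inclusion_def arrow_def)

lemma app_inclusion [simp]: "x \<in> univ M \<Longrightarrow> app (inclusion M N) x = x"
  by (simp add: inclusion_eq_arrow app_arrow)

lemma rng_inclusion [simp]: "rng (inclusion M N) = univ M"
  by (simp add: rng_def inclusion_def app_def)

lemma src_cat_of [simp]: "src (cat_of K) a = fst a"
  and tgt_cat_of [simp]: "tgt (cat_of K) a = snd (snd a)"
  and obj_cat_of [simp]: "obj (cat_of K) = models K"
  and ident_cat_of: "ident (cat_of K) M = inclusion M M"
  by (auto simp: cat_of_def inclusion_def split: prod.splits)

locale mu_aec = structures mu "voc K" for mu :: "'v rel" and K :: "'v aclass" +
  assumes aec: "mu_AEC mu K"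
begin

abbreviation C :: "('v struct, 'v K_arrow) cat" where "C \<equiv> cat_of K"

abbreviation image :: "('v \<Rightarrow> 'v) \<Rightarrow> 'v struct \<Rightarrow> 'v struct" where
  "image \<equiv> image_struct (voc K)"

abbreviation iso :: "('v \<Rightarrow> 'v) \<Rightarrow> 'v struct \<Rightarrow> 'v struct \<Rightarrow> bool" where
  "iso \<equiv> struct_iso (voc K)"

lemma abs_class: "abstract_class mu K"
  using aec by (simp add: mu_AEC_def)

lemma model_struct: "M \<in> models K \<Longrightarrow> is_struct (voc K) M"
  using abs_class by (simp add: abstract_class_def)

lemma model_small: "M \<in> models K \<Longrightarrow> |univ M| <o \<V>"
  using model_struct[of M] by (simp add: is_struct_def small_def)

lemma leK_models: "(M, N) \<in> leK K \<Longrightarrow> M \<in> models K" "(M, N) \<in> leK K \<Longrightarrow> N \<in> models K"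
  using abs_class by (auto simp: abstract_class_def)

lemma leK_sub: "(M, N) \<in> leK K \<Longrightarrow> substructure (voc K) M N"
  using abs_class by (auto simp: abstract_class_def)

lemma leK_univ: "(M, N) \<in> leK K \<Longrightarrow> univ M \<subseteq> univ N"
  using leK_sub[of M N] by (simp add: substructure_def)

lemma leK_po: "partial_order_on (models K) (leK K)"
  using abs_class by (simp add: abstract_class_def)

lemma leK_refl: "M \<in> models K \<Longrightarrow> (M, M) \<in> leK K"
  using leK_po by (simp add: partial_order_on_def preorder_on_def refl_on_def)

lemma leK_trans: "(M, N) \<in> leK K \<Longrightarrow> (N, P) \<in> leK K \<Longrightarrow> (M, P) \<in> leK K"
  using leK_po unfolding partial_order_on_def preorder_on_def by (blast dest: transD)

lemma leK_within:
  assumes "(A, Q) \<in> leK K" "(B, Q) \<in> leK K" "univ A \<subseteq> univ B"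
  shows "(A, B) \<in> leK K"
proof -
  have "substructure (voc K) A B" using substructure_within[OF leK_sub leK_sub] assms by blast
  then show ?thesis
    using aec assms leK_models unfolding mu_AEC_def coherence_def by blast
qed

lemma leK_eq: "(A, Q) \<in> leK K \<Longrightarrow> (B, Q) \<in> leK K \<Longrightarrow> univ A = univ B \<Longrightarrow> A = B"
  using substructure_eq[OF leK_sub leK_sub] by blast

lemma models_iso: "M \<in> models K \<Longrightarrow> iso f M N \<Longrightarrow> N \<in> models K"
  using abs_class unfolding abstract_class_def by blast

lemma leK_iso:
  assumes "(A, M) \<in> leK K" "iso f M N"
  shows "(image f A, N) \<in> leK K" "iso f A (image f A)"
proof -
  note s = substructure_image[OF leK_sub[OF assms(1)] assms(2)]
  show "iso f A (image f A)" by (rule s(2))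
  show "(image f A, N) \<in> leK K"
    using abs_class assms s unfolding abstract_class_def by blast
qed

lemma image_comp:
  assumes "iso f M N" "iso g N P" "\<And>x. x \<in> univ M \<Longrightarrow> h x = g (f x)"
  shows "image h M = P"
  using struct_iso_eq_image[OF struct_iso_comp[OF assms]] by simp

lemma K_embedding_iff:
  "K_embedding K f M N \<longleftrightarrow> M \<in> models K \<and> f \<in> extensional (univ M) \<and> inj_on f (univ M) \<and>
     (image f M, N) \<in> leK K" (is "?l \<longleftrightarrow> ?r")
proof
  assume ?l
  then obtain N0 where 1: "M \<in> models K" "f \<in> extensional (univ M)" "(N0, N) \<in> leK K" "iso f M N0"
    unfolding K_embedding_def by blast
  have "inj_on f (univ M)" using 1(4) by (simp add: struct_iso_def bij_betw_def)
  then show ?r using 1 struct_iso_eq_image[OF 1(4)] by simp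
next
  assume r: ?r
  then have "iso f M (image f M)" using struct_iso_image model_struct by blast
  then show ?l using r leK_models(2) unfolding K_embedding_def by blast
qed

definition img :: "'v K_arrow \<Rightarrow> 'v struct" where
  "img a = image (app a) (fst a)"

lemma hom_iff: "a \<in> hom C M N \<longleftrightarrow> (\<exists>f. a = (M, f, N) \<and> K_embedding K f M N)"
  by (auto simp: hom_def cat_of_def)

lemma univ_img [simp]: "univ (img a) = rng a"
  by (simp add: img_def rng_def)

lemma homD:
  assumes "a \<in> hom C M N"
  shows "M \<in> models K" "N \<in> models K" "inj_on (app a) (univ M)" "(img a, N) \<in> leK K"
    "iso (app a) M (img a)" "fst a = M" "app a \<in> extensional (univ M)" "rng a = app a ` univ M"
    "rng a \<subseteq> univ N" "snd (snd a) = N"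
proof -
  obtain f where f: "a = (M, f, N)" "K_embedding K f M N" using assms unfolding hom_iff by blast
  note e = f(2)[unfolded K_embedding_iff]
  have a: "app a = f" "fst a = M" "img a = image f M" using f by (simp_all add: app_def img_def)
  show "M \<in> models K" "inj_on (app a) (univ M)" "(img a, N) \<in> leK K" "app a \<in> extensional (univ M)"
    "fst a = M" "rng a = app a ` univ M"
    using e a by (simp_all add: rng_def)
  show "snd (snd a) = N" using f by simp
  show "N \<in> models K" using e leK_models(2) by blast
  show "iso (app a) M (img a)" using e a struct_iso_image[OF model_struct] by simp
  show "rng a \<subseteq> univ N" using leK_univ[of "image f M" N] e a by (simp add: rng_def)
qed

lemma app_in: "a \<in> hom C M N \<Longrightarrow> x \<in> univ M \<Longrightarrow> app a x \<in> univ N"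
  using homD(8,9)[of a M N] by blast

lemma app_rng: "a \<in> hom C M N \<Longrightarrow> x \<in> univ M \<Longrightarrow> app a x \<in> rng a"
  using homD(8)[of a M N] by blast

lemma app_inj: "a \<in> hom C M N \<Longrightarrow> x \<in> univ M \<Longrightarrow> y \<in> univ M \<Longrightarrow> app a x = app a y \<longleftrightarrow> x = y"
  using homD(3)[of a M N] by (auto dest: inj_onD)

lemma arrow_hom:
  assumes f: "iso f M N0" and M: "M \<in> models K" and N: "(N0, N) \<in> leK K"
  shows "arrow M f N \<in> hom C M N" "img (arrow M f N) = N0" "rng (arrow M f N) = univ N0"
proof -
  let ?f = "restrict f (univ M)"
  have i: "iso ?f M N0" by (rule struct_iso_comp[OF f struct_iso_id]) (use f in \<open>auto simp: struct_iso_def\<close>)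
  have e: "image ?f M = N0" using struct_iso_eq_image[OF i] by simp
  have "inj_on ?f (univ M)" using i by (simp add: struct_iso_def bij_betw_def)
  then have "K_embedding K ?f M N" unfolding K_embedding_iff using M N e by simp
  then show "arrow M f N \<in> hom C M N" unfolding hom_iff arrow_def by blast
  show im: "img (arrow M f N) = N0" using e by (simp add: img_def arrow_def app_def)
  show "rng (arrow M f N) = univ N0" using im univ_img by metis
qed

lemma inclusion_hom: "(M, N) \<in> leK K \<Longrightarrow> inclusion M N \<in> hom C M N"
  using arrow_hom[of id M M N] struct_iso_id[OF model_struct, of M id] leK_models
  by (simp add: inclusion_eq_arrow)

lemma arrow_eqI:
  assumes "a \<in> hom C M N" "b \<in> hom C M N" "\<And>x. x \<in> univ M \<Longrightarrow> app a x = app b x"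
  shows "a = b"
proof -
  obtain f g where f: "a = (M, f, N)" "b = (M, g, N)" using assms unfolding hom_iff by blast
  have "f = g" using extensionalityI[OF homD(7)[OF assms(1)] homD(7)[OF assms(2)]] assms(3) f
    by (simp add: app_def)
  then show ?thesis using f by simp
qed

lemma comp_eq: "a \<in> hom C M N \<Longrightarrow> b \<in> hom C N P \<Longrightarrow> comp C b a = arrow M (\<lambda>x. app b (app a x)) P"
proof -
  assume "a \<in> hom C M N" "b \<in> hom C N P"
  then obtain f g where "a = (M, f, N)" "b = (N, g, P)" unfolding hom_iff by blast
  then show ?thesis by (simp add: cat_of_def arrow_def app_def compose_def restrict_def)
qed

lemma comp_hom_K: assumes a: "a \<in> hom C M N" and b: "b \<in> hom C N P"
  shows "comp C b a \<in> hom C M P" "x \<in> univ M \<Longrightarrow> app (comp C b a) x = app b (app a x)"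
    "rng (comp C b a) = app b ` rng a"
proof -
  note l = leK_iso[OF homD(4)[OF a] homD(5)[OF b]]
  have i: "iso (\<lambda>x. app b (app a x)) M (image (app b) (img a))"
    by (rule struct_iso_comp[OF homD(5)[OF a] l(2)]) simp
  note r = arrow_hom[OF i homD(1)[OF a] leK_trans[OF l(1) homD(4)[OF b]]]
  show "comp C b a \<in> hom C M P" using r(1) comp_eq[OF a b] by simp
  show "x \<in> univ M \<Longrightarrow> app (comp C b a) x = app b (app a x)" using comp_eq[OF a b] by (simp add: app_arrow)
  show "rng (comp C b a) = app b ` rng a" using r(3) comp_eq[OF a b] by simp
qed

lemma category_K: "category C"
proof -
  have h: "f \<in> hom C (fst f) (snd (snd f))" if "f \<in> arr C" for f
    using arr_hom[OF that] by simp
  have I: "inclusion M M \<in> hom C M M" if "M \<in> models K" for M using inclusion_hom[OF leK_refl[OF that]] .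
  show ?thesis
    unfolding category_def src_cat_of tgt_cat_of obj_cat_of ident_cat_of
  proof (intro conjI ballI impI)
    fix f assume f: "f \<in> arr C"
    note H = homD[OF h[OF f]]
    show "fst f \<in> models K" "snd (snd f) \<in> models K" using H by auto
    note c = comp_hom_K[OF I[OF H(1)] h[OF f]] comp_hom_K[OF h[OF f] I[OF H(2)]]
    show "comp C f (inclusion (fst f) (fst f)) = f"
      by (rule arrow_eqI[OF c(1) h[OF f]]) (use c in simp)
    show "comp C (inclusion (snd (snd f)) (snd (snd f))) f = f"
      by (rule arrow_eqI[OF c(4) h[OF f]]) (use c app_in[OF h[OF f]] in simp)
  next
    fix f g assume "f \<in> arr C" "g \<in> arr C" "fst g = snd (snd f)"
    then show "comp C g f \<in> hom C (fst f) (snd (snd g))" using comp_hom_K(1)[OF h] h by metis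
  next
    fix M assume "M \<in> models K" then show "inclusion M M \<in> hom C M M" by (rule I)
  next
    fix f g k assume a: "f \<in> arr C" "g \<in> arr C" "k \<in> arr C" and e: "fst g = snd (snd f)" "fst k = snd (snd g)"
    note hf = h[OF a(1)] and hg = h[OF a(2), unfolded e] and hk = h[OF a(3), unfolded e]
    note gf = comp_hom_K[OF hf hg] and kg = comp_hom_K[OF hg hk]
    note l = comp_hom_K[OF gf(1) hk] and r = comp_hom_K[OF hf kg(1)]
    show "comp C k (comp C g f) = comp C (comp C k g) f"
      by (rule arrow_eqI[OF l(1) r(1)]) (use l(2) r(2) gf(2) kg(2) app_in[OF hf] in simp)
  qed
qed

sublocale category_laws C by unfold_locales (rule category_K)

lemma app_comp: "a \<in> hom C M N \<Longrightarrow> b \<in> hom C N P \<Longrightarrow> x \<in> univ M \<Longrightarrow> app (comp C b a) x = app b (app a x)"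
  by (rule comp_hom_K(2))

lemma rng_comp: "a \<in> hom C M N \<Longrightarrow> b \<in> hom C N P \<Longrightarrow> rng (comp C b a) = app b ` rng a"
  by (rule comp_hom_K(3))

lemma rng_comp_subset: "a \<in> hom C M N \<Longrightarrow> b \<in> hom C N P \<Longrightarrow> rng (comp C b a) \<subseteq> rng b"
  using rng_comp[of a M N b P] homD(8)[of b N P] homD(9)[of a M N] by blast

lemma mono:
  assumes a: "a \<in> hom C M N" "b \<in> hom C M N" "m \<in> hom C N P" and e: "comp C m a = comp C m b"
  shows "a = b"
proof (rule arrow_eqI[OF a(1,2)])
  fix x assume x: "x \<in> univ M"
  have "app m (app a x) = app m (app b x)"
    using app_comp[OF a(1,3) x] app_comp[OF a(2,3) x] e by simp
  then show "app a x = app b x" using app_inj[OF a(3) app_in[OF a(1) x] app_in[OF a(2) x]] by simp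
qed

lemma inclusion_comp:
  assumes "(M, N) \<in> leK K" "(N, P) \<in> leK K"
  shows "comp C (inclusion N P) (inclusion M N) = inclusion M P"
proof -
  note h = inclusion_hom[OF assms(1)] inclusion_hom[OF assms(2)] inclusion_hom[OF leK_trans[OF assms]]
  show ?thesis
  proof (rule arrow_eqI[OF comp_hom[OF h(1,2)] h(3)])
    fix x assume x: "x \<in> univ M"
    then have "x \<in> univ N" using leK_univ[OF assms(1)] by blast
    then show "app (comp C (inclusion N P) (inclusion M N)) x = app (inclusion M P) x"
      using app_comp[OF h(1,2) x] x by simp
  qed
qed

text \<open>Coherence compares the two images inside \<open>Q\<close>; pulling back along \<open>b\<close> then gives an embedding.
This is how arrows are constructed throughout, as arrows are determined by their values.\<close>

lemma factor:
  assumes a: "a \<in> hom C M Q" and b: "b \<in> hom C N Q" and r: "rng a \<subseteq> rng b"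
  obtains c where "c \<in> hom C M N" "comp C b c = a"
proof -
  have l: "(img a, img b) \<in> leK K" by (rule leK_within[OF homD(4)[OF a] homD(4)[OF b]]) (use r in simp)
  let ?i = "inv_into (univ N) (app b)"
  note l2 = leK_iso[OF l struct_iso_inv[OF homD(5)[OF b]]]
  have i: "iso (\<lambda>x. ?i (app a x)) M (image ?i (img a))"
    by (rule struct_iso_comp[OF homD(5)[OF a] l2(2)]) simp
  let ?c = "arrow M (\<lambda>x. ?i (app a x)) N"
  note c = arrow_hom[OF i homD(1)[OF a] l2(1)]
  have "comp C b ?c = a"
  proof (rule arrow_eqI[OF comp_hom[OF c(1) b] a])
    fix x assume x: "x \<in> univ M"
    have "app a x \<in> app b ` univ N" using app_rng[OF a x] r homD(8)[OF b] by blast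
    then show "app (comp C b ?c) x = app a x"
      using app_comp[OF c(1) b x] app_arrow[OF x] by (simp add: f_inv_into_f)
  qed
  then show thesis using that c(1) by blast
qed

text \<open>Move the elements of the target outside the range onto fresh elements, and the range back onto
  \<open>M\<close>.\<close>

lemma rename_to_inclusion:
  assumes a: "a \<in> hom C M N"
  obtains N' j where "(M, N') \<in> leK K" "j \<in> hom C N N'" "comp C j a = inclusion M N'"
    "rng j = univ N'"
proof -
  have "|univ N - rng a| <o \<V>" "small (univ M)"
    using vsmall_subset[OF _ model_small[OF homD(2)[OF a]], of "univ N - rng a"]
      model_small[OF homD(1)[OF a]] by (auto simp: small_def)
  then obtain e where e: "inj_on e (univ N - rng a)" "e ` (univ N - rng a) \<inter> univ M = {}"
    by (rule vsmall_fresh_code)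
  let ?i = "inv_into (univ M) (app a)"
  define b where "b y = (if y \<in> rng a then ?i y else e y)" for y
  have i: "?i y \<in> univ M" "app a (?i y) = y" if "y \<in> rng a" for y
    using that homD(8)[OF a] by (auto simp: inv_into_into f_inv_into_f)
  have ba: "b (app a x) = x" if "x \<in> univ M" for x
    using app_rng[OF a that] inv_into_f_f[OF homD(3)[OF a] that] by (simp add: b_def)
  have inj: "inj_on b (univ N)"
  proof (rule inj_onI)
    fix x y assume xy: "x \<in> univ N" "y \<in> univ N" "b x = b y"
    consider "x \<in> rng a" "y \<in> rng a" | "x \<in> rng a" "y \<notin> rng a" | "x \<notin> rng a" "y \<in> rng a"
      | "x \<notin> rng a" "y \<notin> rng a" by blast
    then show "x = y"
    proof cases
      case 1 then show ?thesis using xy(3) i(2) unfolding b_def by metis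
    next
      case 2 then show ?thesis using xy e(2) i(1)[of x] unfolding b_def by auto
    next
      case 3 then show ?thesis using xy e(2) i(1)[of y] unfolding b_def by auto
    next
      case 4 then show ?thesis using xy e(1) unfolding b_def by (auto dest: inj_onD)
    qed
  qed
  let ?N = "image b N"
  have b: "iso b N ?N" using struct_iso_image[OF model_struct[OF homD(2)[OF a]] inj] .
  have N: "?N \<in> models K" using models_iso[OF homD(2)[OF a] b] .
  note j = arrow_hom[OF b homD(2)[OF a] leK_refl[OF N]]
  let ?j = "arrow N b ?N"
  note l = leK_iso[OF homD(4)[OF a] b]
  have iM: "iso (\<lambda>x. x) M (image b (img a))"
    by (rule struct_iso_comp[OF homD(5)[OF a] l(2)]) (use ba in simp)
  have "M = image b (img a)"
    by (rule struct_iso_unique[OF struct_iso_id[OF model_struct[OF homD(1)[OF a]]] iM]) auto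
  then have le: "(M, ?N) \<in> leK K" using l(1) by simp
  have "comp C ?j a = inclusion M ?N"
  proof (rule arrow_eqI[OF comp_hom[OF a j(1)] inclusion_hom[OF le]])
    fix x assume x: "x \<in> univ M"
    show "app (comp C ?j a) x = app (inclusion M ?N) x"
      using app_comp[OF a j(1) x] app_arrow[OF app_in[OF a x], of b] ba[OF x] x by simp
  qed
  then show thesis by (rule that[OF le j(1) _ j(3)])
qed

lemma surj_iso:
  assumes j: "j \<in> hom C M N" and s: "rng j = univ N"
  obtains k where "k \<in> hom C N M" "comp C k j = ident C M" "comp C j k = ident C N"
proof -
  have I: "ident C N \<in> hom C N N" "ident C M \<in> hom C M M" using ident_hom homD(1,2)[OF j] by auto
  have r: "rng (ident C N) \<subseteq> rng j" using s by (simp add: ident_cat_of)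
  obtain k where k: "k \<in> hom C N M" "comp C j k = ident C N" by (rule factor[OF I(1) j r])
  have "comp C j (comp C k j) = comp C j (ident C M)"
    using comp_assoc[OF j k(1) j] k(2) ident_comp[OF j] comp_ident[OF j] by simp
  then have "comp C k j = ident C M" by (rule mono[OF comp_hom[OF j k(1)] I(2) j])
  then show thesis using that k by blast
qed

end

section \<open>Directed colimits\<close>

context mu_aec
begin

lemma directed_posetD:
  fixes r :: "'v rel"
  assumes "directed_poset l r"
  shows "\<And>i. i \<in> Field r \<Longrightarrow> (i, i) \<in> r"
    "\<And>i j k. (i, j) \<in> r \<Longrightarrow> (j, k) \<in> r \<Longrightarrow> (i, k) \<in> r"
    "\<And>i j. (i, j) \<in> r \<Longrightarrow> i \<in> Field r" "\<And>i j. (i, j) \<in> r \<Longrightarrow> j \<in> Field r"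
    "|Field r| <o \<V>"
    "\<And>X. X \<subseteq> Field r \<Longrightarrow> |X| <o l \<Longrightarrow> \<exists>u\<in>Field r. \<forall>x\<in>X. (x, u) \<in> r"
  using assms unfolding directed_poset_def partial_order_on_def preorder_on_def small_def
  by (auto dest: transD refl_onD intro: FieldI1 FieldI2)

lemma directed_mono:
  assumes "directed_poset l r" "l' \<le>o l" shows "directed_poset l' r"
  using assms ordLess_ordLeq_trans unfolding directed_poset_def by blast

lemma directed_cover:
  fixes r :: "'v rel"
  assumes r: "directed_poset l r" and A: "|A| <o l" "\<And>x. x \<in> A \<Longrightarrow> \<exists>i\<in>Field r. x \<in> U i"
    and mono: "\<And>i j. (i, j) \<in> r \<Longrightarrow> U i \<subseteq> U j"
  obtains i where "i \<in> Field r" "A \<subseteq> U i"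
proof -
  obtain f where f: "\<And>x. x \<in> A \<Longrightarrow> f x \<in> Field r \<and> x \<in> U (f x)" using A(2) by metis
  have "f ` A \<subseteq> Field r" using f by blast
  moreover have "|f ` A| <o l" using A(1) card_of_image ordLeq_ordLess_trans by blast
  ultimately have "\<exists>u\<in>Field r. \<forall>y\<in>f ` A. (y, u) \<in> r" by (rule directed_posetD(6)[OF r])
  then obtain u where u: "u \<in> Field r" "\<And>x. x \<in> A \<Longrightarrow> (f x, u) \<in> r" by auto
  have "A \<subseteq> U u"
  proof
    fix x assume "x \<in> A" then show "x \<in> U u" using f[of x] mono[OF u(2)] by blast
  qed
  then show thesis using that u(1) by blast
qed

lemma finite_less_mu: "finite A \<Longrightarrow> |A| <o mu"
  by (metis mu_card(1,2) card_of_Field_ordIso card_of_Well_order card_of_ordLeq_finite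
      not_ordLess_iff_ordLeq ordLess_ordIso_trans)

lemma directed_two:
  assumes r: "directed_poset mu r" and "i \<in> Field r" "j \<in> Field r"
  obtains k where "(i, k) \<in> r" "(j, k) \<in> r"
  using directed_posetD(6)[OF r, of "{i, j}"] assms finite_less_mu[of "{i, j}"] by auto

lemma directed_nonempty: "directed_poset mu r \<Longrightarrow> Field r \<noteq> {}"
  using directed_posetD(6)[of mu r "{}"] finite_less_mu[of "{}"] by auto

lemma directed_union:
  assumes r: "directed_poset mu r" and M: "\<And>i. i \<in> Field r \<Longrightarrow> M i \<in> models K"
    "\<And>i j. (i, j) \<in> r \<Longrightarrow> (M i, M j) \<in> leK K"
  obtains U where "U \<in> models K" "univ U = (\<Union>i\<in>Field r. univ (M i))"
    "\<And>i. i \<in> Field r \<Longrightarrow> (M i, U) \<in> leK K"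
    "\<And>N. (\<And>i. i \<in> Field r \<Longrightarrow> (M i, N) \<in> leK K) \<Longrightarrow> (U, N) \<in> leK K"
proof -
  let ?U = "union_struct (voc K) (Field r) M"
  have "directed_system mu K r M" using assms by (simp add: directed_system_def)
  then have "?U \<in> models K" "\<forall>i\<in>Field r. (M i, ?U) \<in> leK K"
    "\<forall>N. (\<forall>i\<in>Field r. (M i, N) \<in> leK K) \<longrightarrow> (?U, N) \<in> leK K"
    using aec unfolding mu_AEC_def chain_axioms_def Let_def by blast+
  then show thesis using that[of ?U] by (simp add: union_struct_def)
qed

lemma directed_union_within:
  assumes r: "directed_poset mu r" and M: "\<And>i. i \<in> Field r \<Longrightarrow> (M i, N) \<in> leK K"
    "\<And>i j. (i, j) \<in> r \<Longrightarrow> univ (M i) \<subseteq> univ (M j)"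
  obtains U where "(U, N) \<in> leK K" "univ U = (\<Union>i\<in>Field r. univ (M i))"
    "\<And>i. i \<in> Field r \<Longrightarrow> (M i, U) \<in> leK K"
proof (rule directed_union[OF r, of M])
  show "M i \<in> models K" if "i \<in> Field r" for i using leK_models(1)[OF M(1)[OF that]] .
  show "(M i, M j) \<in> leK K" if "(i, j) \<in> r" for i j
    using leK_within[OF M(1) M(1) M(2)] that directed_posetD(3,4)[OF r] by blast
  fix U assume U: "univ U = (\<Union>i\<in>Field r. univ (M i))" "\<And>i. i \<in> Field r \<Longrightarrow> (M i, U) \<in> leK K"
    "\<And>N. (\<And>i. i \<in> Field r \<Longrightarrow> (M i, N) \<in> leK K) \<Longrightarrow> (U, N) \<in> leK K"
  show thesis by (rule that[OF U(3) U(1,2)]) (rule M(1))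
qed

text \<open>An argument tuple from a \<open>mu\<close>-directed union lies in one of the members, so that being an
  isomorphism onto the image can be tested on the members.\<close>

lemma iso_directed_union:
  assumes r: "directed_poset mu r"
    and U: "U \<in> models K" "univ U = (\<Union>i\<in>Field r. univ (M i))" "\<And>i. i \<in> Field r \<Longrightarrow> (M i, U) \<in> leK K"
    and mono: "\<And>i j. (i, j) \<in> r \<Longrightarrow> univ (M i) \<subseteq> univ (M j)"
    and f: "inj_on f (univ U)" "\<And>i. i \<in> Field r \<Longrightarrow> (image f (M i), N) \<in> leK K"
  shows "(image f U, N) \<in> leK K"
proof -
  have sub: "univ (M i) \<subseteq> univ U" if "i \<in> Field r" for i using leK_univ[OF U(3)[OF that]] .
  have isoM: "iso f (M i) (image f (M i))" if "i \<in> Field r" for i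
    using struct_iso_image[OF model_struct[OF leK_models(1)[OF U(3)[OF that]]]]
      inj_on_subset[OF f(1) sub[OF that]] by blast
  obtain Z where Z: "(Z, N) \<in> leK K" "univ Z = (\<Union>i\<in>Field r. univ (image f (M i)))"
    "\<And>i. i \<in> Field r \<Longrightarrow> (image f (M i), Z) \<in> leK K"
    using directed_union_within[OF r, of "\<lambda>i. image f (M i)" N] f(2) mono
    by (auto simp: image_mono)
  have tuple: "\<exists>i\<in>Field r. t \<in> I \<rightarrow>\<^sub>E univ (M i)"
    if t: "t \<in> I \<rightarrow>\<^sub>E univ U" and I: "|I| <o mu" for t and I :: "'v set"
  proof -
    have "|t ` I| <o mu" using I card_of_image ordLeq_ordLess_trans by blast
    moreover have "\<exists>i\<in>Field r. x \<in> univ (M i)" if "x \<in> t ` I" for x using that t U(2) by auto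
    ultimately obtain i where "i \<in> Field r" "t ` I \<subseteq> univ (M i)"
      using directed_cover[OF r, of "t ` I" "\<lambda>i. univ (M i)"] mono by blast
    then show ?thesis using t by (intro bexI[of _ i]) (auto simp: PiE_iff)
  qed
  have ar: "mu_ary mu (voc K)" using abs_class by (simp add: abstract_class_def)
  have "iso f U Z"
    unfolding struct_iso_def
  proof (intro conjI ballI)
    show "is_struct (voc K) U" "is_struct (voc K) Z"
      using model_struct U(1) leK_models(1)[OF Z(1)] by auto
    show "bij_betw f (univ U) (univ Z)" using f(1) Z(2) U(2) by (auto simp: bij_betw_def)
  next
    fix s t assume s: "s \<in> fsym (voc K)" and t: "t \<in> farity (voc K) s \<rightarrow>\<^sub>E univ U"
    obtain i where i: "i \<in> Field r" "t \<in> farity (voc K) s \<rightarrow>\<^sub>E univ (M i)"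
      using tuple[OF t] ar s unfolding mu_ary_def by blast
    let ?t = "compose (farity (voc K) s) f t"
    have t': "?t \<in> farity (voc K) s \<rightarrow>\<^sub>E univ (image f (M i))"
      using compose_PiE[OF i(2) subset_refl] by simp
    show "f (fint U s t) = fint Z s ?t"
      using struct_iso_fint[OF isoM[OF i(1)] s i(2)] substructure_fint[OF leK_sub[OF U(3)[OF i(1)]] s i(2)]
        substructure_fint[OF leK_sub[OF Z(3)[OF i(1)]] s t'] by simp
  next
    fix s t assume s: "s \<in> rsym (voc K)" and t: "t \<in> rarity (voc K) s \<rightarrow>\<^sub>E univ U"
    obtain i where i: "i \<in> Field r" "t \<in> rarity (voc K) s \<rightarrow>\<^sub>E univ (M i)"
      using tuple[OF t] ar s unfolding mu_ary_def by blast
    let ?t = "compose (rarity (voc K) s) f t"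
    have t': "?t \<in> rarity (voc K) s \<rightarrow>\<^sub>E univ (image f (M i))"
      using compose_PiE[OF i(2) subset_refl] by simp
    show "t \<in> rint U s \<longleftrightarrow> ?t \<in> rint Z s"
      using struct_iso_rint[OF isoM[OF i(1)] s i(2)] substructure_rint[OF leK_sub[OF U(3)[OF i(1)]] s]
        substructure_rint[OF leK_sub[OF Z(3)[OF i(1)]] s] i(2) t' by blast
  qed
  then show ?thesis using struct_iso_eq_image Z(1) by metis
qed

lemma diagramD:
  assumes "diagram C r D d"
  shows "\<And>i j. (i, j) \<in> r \<Longrightarrow> d i j \<in> hom C (D i) (D j)"
    "\<And>i j k. (i, j) \<in> r \<Longrightarrow> (j, k) \<in> r \<Longrightarrow> comp C (d j k) (d i j) = d i k"
    "\<And>i. i \<in> Field r \<Longrightarrow> D i \<in> models K"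
  using assms by (auto simp: diagram_def)

lemma coconeD:
  assumes "cocone C r D d X c"
  shows "\<And>i. i \<in> Field r \<Longrightarrow> c i \<in> hom C (D i) X"
    "\<And>i j. (i, j) \<in> r \<Longrightarrow> comp C (c j) (d i j) = c i" "X \<in> models K"
  using assms by (auto simp: cocone_def)

lemma cocone_app:
  assumes r: "directed_poset mu r" and d: "diagram C r D d" and c: "cocone C r D d X c"
    and ij: "(i, j) \<in> r" and x: "x \<in> univ (D i)"
  shows "app (c i) x = app (c j) (app (d i j) x)" "app (d i j) x \<in> univ (D j)"
proof -
  note h = diagramD(1)[OF d ij] coconeD(1)[OF c directed_posetD(4)[OF r ij]]
  show "app (c i) x = app (c j) (app (d i j) x)" using app_comp[OF h x] coconeD(2)[OF c ij] by simp
  show "app (d i j) x \<in> univ (D j)" by (rule app_in[OF h(1) x])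
qed

lemma cocone_rng_mono:
  assumes r: "directed_poset mu r" and d: "diagram C r D d" and c: "cocone C r D d X c"
    and ij: "(i, j) \<in> r"
  shows "rng (c i) \<subseteq> rng (c j)"
  using rng_comp_subset[OF diagramD(1)[OF d ij] coconeD(1)[OF c directed_posetD(4)[OF r ij]]]
    coconeD(2)[OF c ij] by simp

text \<open>The universal arrow is forced on elements.  It is a \<open>K\<close>-embedding since its image is the union of
the images of the \<open>e i\<close>, which lies below \<open>Y\<close> by the chain axioms.\<close>

lemma covering_cocone_is_colimit:
  assumes r: "directed_poset mu r" and d: "diagram C r D d" and c: "cocone C r D d X c"
    and cover: "univ X = (\<Union>i\<in>Field r. rng (c i))"
  shows "colimit C r D d X c"
  unfolding colimit_def
proof (intro conjI allI impI)
  show "cocone C r D d X c" by (rule c)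
  fix Y e assume e: "cocone C r D d Y e"
  have same: "app (c i) x = app (c j) y \<longleftrightarrow> app (e i) x = app (e j) y"
    if ij: "i \<in> Field r" "j \<in> Field r" and x: "x \<in> univ (D i)" and y: "y \<in> univ (D j)" for i j x y
  proof -
    obtain k where k: "(i, k) \<in> r" "(j, k) \<in> r" using directed_two[OF r ij] by blast
    have kF: "k \<in> Field r" using directed_posetD(4)[OF r k(1)] .
    note cx = cocone_app[OF r d c k(1) x] cocone_app[OF r d c k(2) y]
    note ex = cocone_app[OF r d e k(1) x] cocone_app[OF r d e k(2) y]
    show ?thesis
      using cx ex app_inj[OF coconeD(1)[OF c kF] cx(2,4)] app_inj[OF coconeD(1)[OF e kF] cx(2,4)] by simp
  qed
  have ex: "\<exists>i x. i \<in> Field r \<and> x \<in> univ (D i) \<and> y = app (c i) x" if y: "y \<in> univ X" for y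
  proof -
    obtain i where i: "i \<in> Field r" "y \<in> rng (c i)" using y cover by blast
    then show ?thesis using homD(8)[OF coconeD(1)[OF c i(1)]] by blast
  qed
  define u where "u y = (SOME z. \<exists>i x. i \<in> Field r \<and> x \<in> univ (D i) \<and> y = app (c i) x \<and> z = app (e i) x)" for y
  have u: "u (app (c i) x) = app (e i) x" if i: "i \<in> Field r" and x: "x \<in> univ (D i)" for i x
    unfolding u_def
  proof (rule some_equality)
    fix z assume "\<exists>j y. j \<in> Field r \<and> y \<in> univ (D j) \<and> app (c i) x = app (c j) y \<and> z = app (e j) y"
    then show "z = app (e i) x" using same[OF i _ x] by metis
  qed (use i x in blast)
  have inj: "inj_on u (univ X)"
  proof (rule inj_onI)
    fix x y assume xy: "x \<in> univ X" "y \<in> univ X" "u x = u y"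
    obtain i a where a: "i \<in> Field r" "a \<in> univ (D i)" "x = app (c i) a" using ex[OF xy(1)] by blast
    obtain j b where b: "j \<in> Field r" "b \<in> univ (D j)" "y = app (c j) b" using ex[OF xy(2)] by blast
    show "x = y" using xy(3) u[OF a(1,2)] u[OF b(1,2)] same[OF a(1) b(1) a(2) b(2)] a(3) b(3) by simp
  qed
  have im: "image u (img (c i)) = img (e i)" if i: "i \<in> Field r" for i
  proof -
    note hc = homD[OF coconeD(1)[OF c i]] and he = homD[OF coconeD(1)[OF e i]]
    have s: "is_struct (voc K) (img (c i))" using hc(4) leK_models(1) model_struct by blast
    have "iso u (img (c i)) (image u (img (c i)))"
      by (rule struct_iso_image[OF s]) (use inj_on_subset[OF inj hc(9)] in simp)
    then have "image (app (e i)) (D i) = image u (img (c i))"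
      by (rule image_comp[OF hc(5)]) (use u[OF i] in simp)
    then show ?thesis using he(6) by (simp add: img_def)
  qed
  have "(image u X, Y) \<in> leK K"
  proof (rule iso_directed_union[OF r, where M = "\<lambda>i. img (c i)"])
    show "X \<in> models K" by (rule coconeD(3)[OF c])
    show "univ X = (\<Union>i\<in>Field r. univ (img (c i)))" using cover by simp
    show "(img (c i), X) \<in> leK K" if "i \<in> Field r" for i using homD(4)[OF coconeD(1)[OF c that]] .
    show "univ (img (c i)) \<subseteq> univ (img (c j))" if "(i, j) \<in> r" for i j
      using cocone_rng_mono[OF r d c that] by simp
    show "(image u (img (c i)), Y) \<in> leK K" if "i \<in> Field r" for i
      using im[OF that] homD(4)[OF coconeD(1)[OF e that]] by simp
  qed (rule inj)
  moreover have "iso u X (image u X)" by (rule struct_iso_image[OF model_struct[OF coconeD(3)[OF c]] inj])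
  ultimately have U: "arrow X u Y \<in> hom C X Y" using arrow_hom(1) coconeD(3)[OF c] by blast
  show "\<exists>!u. u \<in> hom C X Y \<and> (\<forall>i\<in>Field r. comp C u (c i) = e i)"
  proof (rule ex1I[of _ "arrow X u Y"], intro conjI ballI)
    fix i assume i: "i \<in> Field r"
    note hc = coconeD(1)[OF c i]
    show "comp C (arrow X u Y) (c i) = e i"
      by (rule arrow_eqI[OF comp_hom[OF hc U] coconeD(1)[OF e i]])
        (use app_comp[OF hc U] app_arrow[OF app_in[OF hc]] u[OF i] in simp)
  next
    fix v assume v: "v \<in> hom C X Y \<and> (\<forall>i\<in>Field r. comp C v (c i) = e i)"
    then have vh: "v \<in> hom C X Y" by blast
    show "v = arrow X u Y"
    proof (rule arrow_eqI[OF vh U])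
      fix y assume y: "y \<in> univ X"
      obtain i a where a: "i \<in> Field r" "a \<in> univ (D i)" "y = app (c i) a" using ex[OF y] by blast
      have "app v y = app (comp C v (c i)) a" using app_comp[OF coconeD(1)[OF c a(1)] vh a(2)] a(3) by simp
      also have "\<dots> = app (e i) a" using v a(1) by simp
      finally show "app v y = app (arrow X u Y) y" using u[OF a(1,2)] a(3) app_arrow[OF y] by simp
    qed
  qed (rule U)
qed

text \<open>The elements of the colimit are codes for the equivalence classes of elements of the disjoint
  union of the \<open>D i\<close>.\<close>

lemma covering_cocone_exists:
  assumes r: "directed_poset mu r" and d: "diagram C r D d"
  obtains X c where "cocone C r D d X c" "univ X = (\<Union>i\<in>Field r. rng (c i))"
proof -
  define q where "q i x = {(j, y). j \<in> Field r \<and> y \<in> univ (D j) \<and>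
    (\<exists>k. (i, k) \<in> r \<and> (j, k) \<in> r \<and> app (d i k) x = app (d j k) y)}" for i x
  note tr = directed_posetD(2)[OF r] and F = directed_posetD(3,4)[OF r]
  have dd: "app (d i k) x = app (d j k) (app (d i j) x)" "app (d i j) x \<in> univ (D j)"
    if "(i, j) \<in> r" "(j, k) \<in> r" "x \<in> univ (D i)" for i j k x
    using app_comp[OF diagramD(1)[OF d that(1)] diagramD(1)[OF d that(2)] that(3)]
      diagramD(2)[OF d that(1,2)] app_in[OF diagramD(1)[OF d that(1)] that(3)] by simp_all
  have did: "app (d i i) x = x" if "i \<in> Field r" "x \<in> univ (D i)" for i x
    using d that by (simp add: diagram_def ident_cat_of)
  have q_shift: "q i x = q j (app (d i j) x)" if ij: "(i, j) \<in> r" and x: "x \<in> univ (D i)" for i j x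
  proof (intro set_eqI iffI)
    fix z assume "z \<in> q i x"
    then obtain l y k where z: "z = (l, y)" "l \<in> Field r" "y \<in> univ (D l)" "(i, k) \<in> r" "(l, k) \<in> r"
      "app (d i k) x = app (d l k) y" unfolding q_def by blast
    obtain m where m: "(j, m) \<in> r" "(k, m) \<in> r"
      using directed_two[OF r F(2)[OF ij] F(2)[OF z(4)]] by blast
    have "app (d j m) (app (d i j) x) = app (d l m) y"
      using dd(1)[OF ij m(1) x] dd(1)[OF z(4) m(2) x] dd(1)[OF z(5) m(2) z(3)] z(6) by simp
    then show "z \<in> q j (app (d i j) x)" unfolding q_def using z(1,2,3) m tr[OF z(5) m(2)] by blast
  next
    fix z assume "z \<in> q j (app (d i j) x)"
    then obtain l y k where z: "z = (l, y)" "l \<in> Field r" "y \<in> univ (D l)" "(j, k) \<in> r" "(l, k) \<in> r"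
      "app (d j k) (app (d i j) x) = app (d l k) y" unfolding q_def by blast
    then show "z \<in> q i x" unfolding q_def using tr[OF ij z(4)] dd(1)[OF ij z(4) x] by auto
  qed
  have q_inj: "x = y" if i: "i \<in> Field r" and x: "x \<in> univ (D i)" and y: "y \<in> univ (D i)"
    and e: "q i x = q i y" for i x y
  proof -
    have "(i, y) \<in> q i y" unfolding q_def using i y directed_posetD(1)[OF r i] by blast
    then obtain k where k: "(i, k) \<in> r" "app (d i k) x = app (d i k) y" using e unfolding q_def by blast
    then show ?thesis using app_inj[OF diagramD(1)[OF d k(1)] x y] by simp
  qed
  let ?Q = "Pow (SIGMA j:Field r. univ (D j))"
  have "|?Q| <o \<V>"
    by (intro vsmall_Pow vsmall_Sigma directed_posetD(5)[OF r] model_small diagramD(3)[OF d])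
  then obtain e :: "('v \<times> 'v) set \<Rightarrow> 'v" where e: "inj_on e ?Q" by (rule vsmall_code)
  have qQ: "q i x \<in> ?Q" for i x by (auto simp: q_def)
  define f where "f i x = e (q i x)" for i x
  have f_inj: "inj_on (f i) (univ (D i))" if "i \<in> Field r" for i
    using q_inj[OF that] inj_onD[OF e _ qQ qQ] unfolding f_def by (intro inj_onI) blast
  let ?M = "\<lambda>i. image (f i) (D i)"
  have isoM: "iso (f i) (D i) (?M i)" if i: "i \<in> Field r" for i
    by (rule struct_iso_image[OF model_struct[OF diagramD(3)[OF d i]] f_inj[OF i]])
  have f_shift: "f i x = f j (app (d i j) x)" if "(i, j) \<in> r" "x \<in> univ (D i)" for i j x
    using q_shift[OF that] by (simp add: f_def)
  have M_le: "(?M i, ?M j) \<in> leK K" if ij: "(i, j) \<in> r" for i j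
  proof -
    note h = homD[OF diagramD(1)[OF d ij]]
    note l = leK_iso[OF h(4) isoM[OF F(2)[OF ij]]]
    have "?M i = image (f j) (img (d i j))" by (rule image_comp[OF h(5) l(2)]) (rule f_shift[OF ij])
    then show ?thesis using l(1) by simp
  qed
  have M_mod: "?M i \<in> models K" if "i \<in> Field r" for i
    using models_iso[OF diagramD(3)[OF d that] isoM[OF that]] .
  obtain U where U: "U \<in> models K" "univ U = (\<Union>i\<in>Field r. univ (?M i))"
    "\<And>i. i \<in> Field r \<Longrightarrow> (?M i, U) \<in> leK K"
    using directed_union[OF r, of ?M, OF M_mod M_le] by metis
  let ?c = "\<lambda>i. arrow (D i) (f i) U"
  note c = arrow_hom[OF isoM diagramD(3)[OF d] U(3)]
  have "cocone C r D d U ?c"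
    unfolding cocone_def obj_cat_of
  proof (intro conjI ballI allI impI)
    show "U \<in> models K" by (rule U(1))
    show "?c i \<in> hom C (D i) U" if "i \<in> Field r" for i using c(1)[OF that that that] .
    fix i j assume ij: "(i, j) \<in> r"
    note hd = diagramD(1)[OF d ij] and hj = c(1)[OF F(2)[OF ij] F(2)[OF ij] F(2)[OF ij]]
    show "comp C (?c j) (d i j) = ?c i"
    proof (rule arrow_eqI[OF comp_hom[OF hd hj] c(1)[OF F(1)[OF ij] F(1)[OF ij] F(1)[OF ij]]])
      fix x assume x: "x \<in> univ (D i)"
      show "app (comp C (?c j) (d i j)) x = app (?c i) x"
        using app_comp[OF hd hj x] app_arrow[OF app_in[OF hd x], of "f j"] app_arrow[OF x, of "f i"]
          f_shift[OF ij x] by simp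
    qed
  qed
  moreover have "univ U = (\<Union>i\<in>Field r. rng (?c i))" using U(2) c(3) by simp
  ultimately show thesis using that by blast
qed

end

section \<open>Freeness of sets over models\<close>

locale aec_independence = mu_aec mu K + independence "cat_of K" ind
  for mu :: "'v rel" and K :: "'v aclass" and ind :: "'v K_arrow square_rel"
begin

text \<open>The set \<open>A\<close> in the target of \<open>g2\<close> is independent from \<open>g2\<close> over \<open>f2\<close>: after extending the target,
\<open>A\<close> is covered by an arrow \<open>g1\<close> in an independent square.  This is the relation between sets that
nonforking and the witness property use, with inclusions replaced by arbitrary arrows.\<close>

definition free :: "'v K_arrow \<Rightarrow> 'v K_arrow \<Rightarrow> 'v set \<Rightarrow> bool" where
  "free f2 g2 A \<longleftrightarrow> (\<exists>Q f1 g1 h. h \<in> hom C (snd (snd g2)) Q \<and> ind f1 f2 g1 (comp C h g2) \<and>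
     app h ` A \<subseteq> rng g1)"

lemma freeE:
  assumes fr: "free f2 g2 A" and f2: "f2 \<in> hom C M0 M2" and g2: "g2 \<in> hom C M2 N"
  obtains M1 Q f1 g1 h where "f1 \<in> hom C M0 M1" "g1 \<in> hom C M1 Q" "h \<in> hom C N Q"
    "ind f1 f2 g1 (comp C h g2)" "app h ` A \<subseteq> rng g1"
proof -
  obtain Q f1 g1 h where 1: "h \<in> hom C N Q" "ind f1 f2 g1 (comp C h g2)" "app h ` A \<subseteq> rng g1"
    using fr homD(10)[OF g2] unfolding free_def by blast
  obtain X0 X1 X2 X3 where X: "f1 \<in> hom C X0 X1" "f2 \<in> hom C X0 X2" "g1 \<in> hom C X1 X3"
    "comp C h g2 \<in> hom C X2 X3" using indE[OF 1(2)] by metis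
  have "X0 = M0" "X3 = Q"
    using X(2) f2 X(4) comp_hom[OF g2 1(1)] by (auto simp: hom_def)
  then show thesis using that X(1,3) 1 by blast
qed

lemma freeI:
  assumes "g2 \<in> hom C M2 N" "h \<in> hom C N Q" "ind f1 f2 g1 (comp C h g2)" "app h ` A \<subseteq> rng g1"
  shows "free f2 g2 A"
  unfolding free_def homD(10)[OF assms(1)] using assms(2-) by blast

lemma free_subset: "free f2 g2 A \<Longrightarrow> B \<subseteq> A \<Longrightarrow> free f2 g2 B"
  unfolding free_def by (meson image_mono subset_trans)

lemma ind_free:
  assumes i: "ind f1 f2 g1 g2" shows "free f2 g2 (rng g1)"
proof -
  obtain M0 M1 M2 M3 where h: "g1 \<in> hom C M1 M3" "g2 \<in> hom C M2 M3"
    using indE[OF i] by metis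
  have I: "ident C M3 \<in> hom C M3 M3" using ident_hom homD(2)[OF h(1)] by simp
  have "app (ident C M3) ` rng g1 \<subseteq> rng g1"
    using homD(9)[OF h(1)] by (auto simp: ident_cat_of subset_eq)
  then show ?thesis using freeI[OF h(2) I, of f1 f2 g1] i ident_comp[OF h(2)] by simp
qed

lemma free_base_mono:
  assumes fr: "free (comp C f24 f02) g2 A" and A: "A \<subseteq> univ N"
    and h: "f02 \<in> hom C M0 M2" "f24 \<in> hom C M2 M4" "g2 \<in> hom C M4 N"
  shows "free f24 g2 A"
proof -
  obtain M1 Q f1 g1 e where 1: "f1 \<in> hom C M0 M1" "g1 \<in> hom C M1 Q" "e \<in> hom C N Q"
    "ind f1 (comp C f24 f02) g1 (comp C e g2)" "app e ` A \<subseteq> rng g1"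
    by (rule freeE[OF fr comp_hom[OF h(1,2)] h(3)])
  obtain M3 R f13 f23 e' k where 2: "ind f23 f24 k (comp C e' (comp C e g2))"
    "f13 \<in> hom C M1 M3" "e' \<in> hom C Q R" "k \<in> hom C M3 R" "comp C k f13 = comp C e' g1"
    using base_mono[OF 1(4) 1(1) h(1,2) 1(2)] by metis
  have "app (comp C e' e) ` A = app e' ` app e ` A"
    using app_comp[OF 1(3) 2(3)] A by (force simp: image_iff)
  also have "\<dots> \<subseteq> app e' ` rng g1" using 1(5) by blast
  also have "\<dots> = rng (comp C k f13)" using rng_comp[OF 1(2) 2(3)] 2(5) by simp
  also have "\<dots> \<subseteq> rng k" by (rule rng_comp_subset[OF 2(2,4)])
  finally show ?thesis
    using freeI[OF h(3) comp_hom[OF 1(3) 2(3)], of f23 f24 k A] 2(1) comp_assoc[OF h(3) 1(3) 2(3)]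
    by simp
qed

lemma free_right_mono:
  assumes fr: "free (comp C f24 f02) g2 A"
    and h: "f02 \<in> hom C M0 M2" "f24 \<in> hom C M2 M4" "g2 \<in> hom C M4 N"
  shows "free f02 (comp C g2 f24) A"
proof -
  obtain M1 Q f1 g1 e where 1: "f1 \<in> hom C M0 M1" "g1 \<in> hom C M1 Q" "e \<in> hom C N Q"
    "ind f1 (comp C f24 f02) g1 (comp C e g2)" "app e ` A \<subseteq> rng g1"
    by (rule freeE[OF fr comp_hom[OF h(1,2)] h(3)])
  have "ind f1 f02 g1 (comp C e (comp C g2 f24))"
    using right_mono[OF 1(4) h(1,2)] comp_assoc[OF h(2,3) 1(3)] by simp
  then show ?thesis using freeI[OF comp_hom[OF h(2,3)] 1(3)] 1(5) by blast
qed

section \<open>Local character\<close>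

lemma gtp_stepD:
  assumes "((a, B, N), (b, B', N')) \<in> gtp_step K alpha"
  obtains g g' P where "g \<in> hom C N P" "g' \<in> hom C N' P" "B' = B" "B \<subseteq> univ N" "B \<subseteq> univ N'"
    "a \<in> Field alpha \<rightarrow>\<^sub>E univ N" "b \<in> Field alpha \<rightarrow>\<^sub>E univ N'"
    "\<forall>x\<in>B. app g x = app g' x" "\<forall>i\<in>Field alpha. app g (a i) = app g' (b i)"
proof -
  have s: "B = B'" "B \<subseteq> univ N" "B \<subseteq> univ N'"
    "a \<in> Field alpha \<rightarrow>\<^sub>E univ N" "b \<in> Field alpha \<rightarrow>\<^sub>E univ N'"
    "\<exists>g g' P. K_embedding K g N P \<and> K_embedding K g' N' P \<and>
       (\<forall>b\<in>B. g b = g' b) \<and> (\<forall>i\<in>Field alpha. g (a i) = g' (b i))"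
    using assms unfolding gtp_step_def mem_Collect_eq prod.case by - (elim conjE, assumption)+
  from s(6) obtain g g' P where g: "K_embedding K g N P" "K_embedding K g' N' P"
    "\<forall>x\<in>B. g x = g' x" "\<forall>i\<in>Field alpha. g (a i) = g' (b i)" by - (elim exE conjE, rule that)
  have "(N, g, P) \<in> hom C N P" "(N', g', P) \<in> hom C N' P" using g(1,2) unfolding hom_iff by blast+
  moreover have "app (N, g, P) = g" "app (N', g', P) = g'" by (simp_all add: app_def)
  ultimately show thesis using that[of "(N, g, P)" P "(N', g', P)"] s(1-5) g(3,4) by simp
qed

text \<open>By amalgamation the one-step relation between pretypes is already transitive, so equality of Galois
types is witnessed by a single pair of embeddings.\<close>

lemma gtp_stepsD:
  assumes "((a, B, N), t) \<in> (gtp_step K alpha)\<^sup>+"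
  shows "\<exists>b N' P g g'. t = (b, B, N') \<and> g \<in> hom C N P \<and> g' \<in> hom C N' P \<and>
     B \<subseteq> univ N \<and> B \<subseteq> univ N' \<and> a \<in> Field alpha \<rightarrow>\<^sub>E univ N \<and> b \<in> Field alpha \<rightarrow>\<^sub>E univ N' \<and>
     (\<forall>x\<in>B. app g x = app g' x) \<and> (\<forall>i\<in>Field alpha. app g (a i) = app g' (b i))"
  using assms
proof (induction rule: trancl_induct)
  case (base t)
  obtain b B' N' where t: "t = (b, B', N')" by (cases t)
  show ?case by (rule gtp_stepD[OF base[unfolded t]]) (use t in \<open>intro exI conjI; simp\<close>)
next
  case (step t s)
  obtain b N' P g g' where 1: "t = (b, B, N')" "g \<in> hom C N P" "g' \<in> hom C N' P"
     "B \<subseteq> univ N" "B \<subseteq> univ N'" "a \<in> Field alpha \<rightarrow>\<^sub>E univ N" "b \<in> Field alpha \<rightarrow>\<^sub>E univ N'"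
     "\<forall>x\<in>B. app g x = app g' x" "\<forall>i\<in>Field alpha. app g (a i) = app g' (b i)"
    using step.IH by - (elim exE conjE, rule that)
  obtain c B' N'' where s: "s = (c, B', N'')" by (cases s)
  obtain k k' P' where k: "k \<in> hom C N' P'" "k' \<in> hom C N'' P'"
    and 2: "B' = B" "B \<subseteq> univ N''" "c \<in> Field alpha \<rightarrow>\<^sub>E univ N''"
      "\<forall>x\<in>B. app k x = app k' x" "\<forall>i\<in>Field alpha. app k (b i) = app k' (c i)"
    using gtp_stepD[OF step.hyps(2)[unfolded s 1(1)]] by metis
  obtain R p q where pq: "p \<in> hom C P R" "q \<in> hom C P' R" "comp C p g' = comp C q k"
    using ind_exists[OF 1(3) k(1)] by metis
  have pqx: "app p (app g' x) = app q (app k x)" if "x \<in> univ N'" for x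
    using app_comp[OF 1(3) pq(1) that] app_comp[OF k(1) pq(2) that] pq(3) by simp
  have "app (comp C p g) x = app (comp C q k') x" if x: "x \<in> B" for x
  proof -
    have xN: "x \<in> univ N" "x \<in> univ N'" "x \<in> univ N''" using x 1(4,5) 2(2) by blast+
    show ?thesis using app_comp[OF 1(2) pq(1) xN(1)] app_comp[OF k(2) pq(2) xN(3)] 1(8) 2(4) x
        pqx[OF xN(2)] by simp
  qed
  moreover have "app (comp C p g) (a i) = app (comp C q k') (c i)" if i: "i \<in> Field alpha" for i
  proof -
    have xN: "a i \<in> univ N" "b i \<in> univ N'" "c i \<in> univ N''" using i 1(6,7) 2(3) by auto
    show ?thesis using app_comp[OF 1(2) pq(1) xN(1)] app_comp[OF k(2) pq(2) xN(3)] 1(9) 2(5) i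
        pqx[OF xN(2)] by simp
  qed
  ultimately show ?case
    by (intro exI[of _ c] exI[of _ N''] exI[of _ R] exI[of _ "comp C p g"] exI[of _ "comp C q k'"]
        conjI ballI comp_hom[OF 1(2) pq(1)] comp_hom[OF k(2) pq(2)] 1(4,6) 2(2,3)) (simp_all add: s 2(1))
qed

text \<open>A representative of the type that witnesses nonforking has its own ambient model.  Equality of
types and amalgamation put that model and \<open>N\<close> into one extension, where coherence recovers the arrow
from \<open>M\<close>.\<close>

lemma local_character:
  assumes f: "f \<in> hom C M N" and a: "\<And>i. i \<in> Field alpha \<Longrightarrow> a i \<in> univ N"
    and lc: "\<And>p. p \<in> gS K alpha M \<Longrightarrow>
      \<exists>M0. (M0, M) \<in> leK K \<and> |univ M0| \<le>o lam \<and> nonforking K ind alpha p M0"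
  obtains M0 where "(M0, M) \<in> leK K" "|univ M0| \<le>o lam" "free (inclusion M0 M) f (a ` Field alpha)"
proof -
  obtain N' j where N': "(M, N') \<in> leK K" and j: "j \<in> hom C N N'" "comp C j f = inclusion M N'"
    using rename_to_inclusion[OF f] by metis
  let ?a = "restrict (\<lambda>i. app j (a i)) (Field alpha)"
  have "?a \<in> Field alpha \<rightarrow>\<^sub>E univ N'" using app_in[OF j(1) a] by simp
  then have "gtp K alpha ?a (univ M) N' \<in> gS K alpha M" unfolding gS_def using N' by blast
  then obtain M0 where M0: "(M0, M) \<in> leK K" "|univ M0| \<le>o lam"
    "nonforking K ind alpha (gtp K alpha ?a (univ M) N') M0" using lc by blast
  then obtain b B N3 where b: "(b, B, N3) \<in> gtp K alpha ?a (univ M) N'"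
    "ind_sets K ind M0 (b ` Field alpha) B N3" unfolding nonforking_def by blast
  obtain P g g' where g: "B = univ M" "g \<in> hom C N' P" "g' \<in> hom C N3 P" "univ M \<subseteq> univ N3"
    "b \<in> Field alpha \<rightarrow>\<^sub>E univ N3"
    "\<forall>x\<in>univ M. app g x = app g' x" "\<forall>i\<in>Field alpha. app g (?a i) = app g' (b i)"
    using gtp_stepsD[of ?a "univ M" N' "(b, B, N3)" alpha] b(1) unfolding gtp_def by auto
  obtain M1 M2 M3 where M: "b ` Field alpha \<subseteq> univ M1" "univ M \<subseteq> univ M2" "(N3, M3) \<in> leK K"
    "ind_models K ind M0 M1 M2 M3" using b(2) g(1) unfolding ind_sets_def by blast
  have le: "(M0, M1) \<in> leK K" "(M0, M2) \<in> leK K" "(M1, M3) \<in> leK K" "(M2, M3) \<in> leK K"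
    and i: "ind (inclusion M0 M1) (inclusion M0 M2) (inclusion M1 M3) (inclusion M2 M3)"
    using M(4) unfolding ind_models_def by auto
  obtain Q p q where pq: "p \<in> hom C P Q" "q \<in> hom C M3 Q" "comp C p g' = comp C q (inclusion N3 M3)"
    using ind_exists[OF g(3) inclusion_hom[OF M(3)]] by metis
  have pq': "app p (app g' x) = app q x" if "x \<in> univ N3" for x
    using app_comp[OF g(3) pq(1) that] app_comp[OF inclusion_hom[OF M(3)] pq(2) that] pq(3) that by simp
  let ?e = "comp C p (comp C g j)"
  have e: "?e \<in> hom C N Q" by (rule comp_hom[OF comp_hom[OF j(1) g(2)] pq(1)])
  have ex: "app ?e x = app p (app g (app j x))" if "x \<in> univ N" for x
    using app_comp[OF comp_hom[OF j(1) g(2)] pq(1) that] app_comp[OF j(1) g(2) that] by simp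
  let ?g2 = "comp C q (inclusion M2 M3)"
  have g2: "?g2 \<in> hom C M2 Q" by (rule comp_hom[OF inclusion_hom[OF le(4)] pq(2)])
  have g2x: "app ?g2 x = app q x" if "x \<in> univ M2" for x
    using app_comp[OF inclusion_hom[OF le(4)] pq(2) that] that by simp
  have ef: "comp C ?e f \<in> hom C M Q" by (rule comp_hom[OF f e])
  have efx: "app (comp C ?e f) x = app ?g2 x" if x: "x \<in> univ M" for x
  proof -
    have "app j (app f x) = x" using app_comp[OF f j(1) x] j(2) x by simp
    then have "app (comp C ?e f) x = app p (app g x)" using app_comp[OF f e x] ex[OF app_in[OF f x]] by simp
    also have "\<dots> = app q x" using g(4,6) x pq'[of x] by auto
    finally show ?thesis using g2x M(2) x by auto
  qed
  have "rng (comp C ?e f) \<subseteq> rng ?g2"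
    using efx app_rng[OF g2] M(2) homD(8)[OF ef] by auto
  then obtain m where m: "m \<in> hom C M M2" "comp C ?g2 m = comp C ?e f" by (rule factor[OF ef g2])
  have mi: "comp C m (inclusion M0 M) = inclusion M0 M2"
  proof (rule arrow_eqI[OF comp_hom[OF inclusion_hom[OF M0(1)] m(1)] inclusion_hom[OF le(2)]])
    fix x assume x: "x \<in> univ M0"
    then have xM: "x \<in> univ M" using leK_univ[OF M0(1)] by blast
    have "app ?g2 (app m x) = app ?g2 x" using app_comp[OF m(1) g2 xM] m(2) efx[OF xM] by simp
    then have "app m x = x" using app_inj[OF g2 app_in[OF m(1) xM]] xM M(2) by blast
    then show "app (comp C m (inclusion M0 M)) x = app (inclusion M0 M2) x"
      using app_comp[OF inclusion_hom[OF M0(1)] m(1) x] x by simp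
  qed
  let ?g1 = "comp C q (inclusion M1 M3)"
  have "ind (inclusion M0 M1) (inclusion M0 M2) ?g1 ?g2"
    by (rule ind_extend[OF i inclusion_hom[OF le(3)] pq(2)])
  then have "ind (inclusion M0 M1) (inclusion M0 M) ?g1 (comp C ?e f)"
    using right_mono[of _ m "inclusion M0 M", OF _ inclusion_hom[OF M0(1)] m(1)] mi m(2) by metis
  moreover have "app ?e ` a ` Field alpha \<subseteq> rng ?g1"
  proof (unfold image_image, intro image_subsetI)
    fix i assume i: "i \<in> Field alpha"
    have bi: "b i \<in> univ N3" "b i \<in> univ M1" using g(5) i M(1) by auto
    have "app ?e (a i) = app q (b i)" using ex[OF a[OF i]] g(7) i pq'[OF bi(1)] by simp
    also have "\<dots> = app ?g1 (b i)" using app_comp[OF inclusion_hom[OF le(3)] pq(2) bi(2)] bi(2) by simp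
    also have "\<dots> \<in> rng ?g1" by (rule app_rng[OF comp_hom[OF inclusion_hom[OF le(3)] pq(2)] bi(2)])
    finally show "app ?e (a i) \<in> rng ?g1" .
  qed
  ultimately show thesis using that[OF M0(1,2)] freeI[OF f e] by blast
qed

section \<open>Independence of images\<close>

lemma corestriction:
  assumes a: "a \<in> hom C M N"
  shows "arrow M (app a) (img a) \<in> hom C M (img a)" "rng (arrow M (app a) (img a)) = univ (img a)"
  using arrow_hom[OF homD(5)[OF a] homD(1)[OF a] leK_refl[OF leK_models(1)[OF homD(4)[OF a]]]] by simp_all

text \<open>Every arrow is an isomorphism onto its image followed by an inclusion; the isomorphisms are moved
into and out of the square.\<close>

lemma ind_iff_ind_models_img:
  assumes h: "f1 \<in> hom C M0 M1" "f2 \<in> hom C M0 M2" "g1 \<in> hom C M1 M3" "g2 \<in> hom C M2 M3"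
    and c: "comp C g1 f1 = comp C g2 f2"
  shows "ind f1 f2 g1 g2 \<longleftrightarrow> ind_models K ind (img (comp C g1 f1)) (img g1) (img g2) M3"
proof -
  let ?e = "comp C g1 f1"
  have eh: "?e \<in> hom C M0 M3" by (rule comp_hom[OF h(1,3)])
  note le3 = homD(4)[OF h(3)] homD(4)[OF h(4)] homD(4)[OF eh]
  have le1: "(img ?e, img g1) \<in> leK K"
    by (rule leK_within[OF le3(3,1)]) (use rng_comp_subset[OF h(1,3)] in simp)
  have le2: "(img ?e, img g2) \<in> leK K"
    by (rule leK_within[OF le3(3,2)]) (use rng_comp_subset[OF h(2,4)] c in simp)
  note inc = inclusion_hom[OF le1] inclusion_hom[OF le2] inclusion_hom[OF le3(1)] inclusion_hom[OF le3(2)]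
  let ?c = "\<lambda>M a. arrow M (app a) (img a)"
  note ce = corestriction[OF eh] and c1 = corestriction[OF h(3)] and c2 = corestriction[OF h(4)]
  have sq: "comp C (inclusion (img ?e) (img g)) (?c M0 ?e) = comp C (?c M' g) f"
    if f: "f \<in> hom C M0 M'" "g \<in> hom C M' M3" "comp C g f = ?e" and le: "(img ?e, img g) \<in> leK K" for f g M'
  proof (rule arrow_eqI[OF comp_hom[OF ce(1) inclusion_hom[OF le]] comp_hom[OF f(1) corestriction(1)[OF f(2)]]])
    fix x assume x: "x \<in> univ M0"
    have "app ?e x \<in> univ (img ?e)" using app_rng[OF eh x] by simp
    then show "app (comp C (inclusion (img ?e) (img g)) (?c M0 ?e)) x = app (comp C (?c M' g) f) x"
      using app_comp[OF ce(1) inclusion_hom[OF le] x] app_comp[OF f(1) corestriction(1)[OF f(2)] x]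
        app_arrow[OF x, of "app ?e"] app_arrow[OF app_in[OF f(1) x], of "app g"] app_comp[OF f(1,2) x] f(3)
      by simp
  qed
  note sq1 = sq[OF h(1,3) refl le1] and sq2 = sq[OF h(2,4) c[symmetric] le2]
  have top: "comp C (inclusion (img g) M3) (?c M' g) = g" if g: "g \<in> hom C M' M3" for g M'
  proof (rule arrow_eqI[OF comp_hom[OF corestriction(1)[OF g] inclusion_hom[OF homD(4)[OF g]]] g])
    fix x assume x: "x \<in> univ M'"
    have "app g x \<in> univ (img g)" using app_rng[OF g x] by simp
    then show "app (comp C (inclusion (img g) M3) (?c M' g)) x = app g x"
      using app_comp[OF corestriction(1)[OF g] inclusion_hom[OF homD(4)[OF g]] x]
        app_arrow[OF x, of "app g"] by simp
  qed
  obtain k0 where k0: "k0 \<in> hom C (img ?e) M0" "comp C k0 (?c M0 ?e) = ident C M0"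
    "comp C (?c M0 ?e) k0 = ident C (img ?e)" by (rule surj_iso[OF ce])
  obtain k1 where k1: "k1 \<in> hom C (img g1) M1" "comp C k1 (?c M1 g1) = ident C M1"
    "comp C (?c M1 g1) k1 = ident C (img g1)" by (rule surj_iso[OF c1])
  obtain k2 where k2: "k2 \<in> hom C (img g2) M2" "comp C k2 (?c M2 g2) = ident C M2"
    "comp C (?c M2 g2) k2 = ident C (img g2)" by (rule surj_iso[OF c2])
  have rev: "comp C k i = comp C f k0"
    if t: "k \<in> hom C B A" "b \<in> hom C A B" "comp C b k = ident C B" "i \<in> hom C (img ?e) B" "f \<in> hom C M0 A"
      "comp C i (?c M0 ?e) = comp C b f" for A B b f i k
  proof (rule mono[OF comp_hom[OF t(4,1)] comp_hom[OF k0(1) t(5)] t(2)])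
    show "comp C b (comp C k i) = comp C b (comp C f k0)"
      using comp_assoc[OF t(4,1,2)] t(3) ident_comp[OF t(4)] comp_assoc[OF k0(1) t(5,2)] t(6)
        comp_assoc[OF k0(1) ce(1) t(4)] k0(3) comp_ident[OF t(4)] by simp
  qed
  have drop: "comp C g k = inclusion (img g) M3"
    if t: "g \<in> hom C M' M3" "k \<in> hom C (img g) M'" "comp C (?c M' g) k = ident C (img g)" for g k M'
    using comp_assoc[OF t(2) corestriction(1)[OF t(1)] inclusion_hom[OF homD(4)[OF t(1)]]]
      top[OF t(1)] t(3) comp_ident[OF inclusion_hom[OF homD(4)[OF t(1)]]] by simp
  have "ind f1 f2 g1 g2 \<longleftrightarrow> ind (inclusion (img ?e) (img g1)) (inclusion (img ?e) (img g2))
      (inclusion (img g1) M3) (inclusion (img g2) M3)"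
  proof
    assume i: "ind f1 f2 g1 g2"
    show "ind (inclusion (img ?e) (img g1)) (inclusion (img ?e) (img g2)) (inclusion (img g1) M3) (inclusion (img g2) M3)"
      using ind_transport[OF i h(1,2) inc(1,2) k0(1) ce(1) k0(3,2) k1(1) c1(1) k1(3) k2(1)
          rev[OF k1(1) c1(1) k1(3) inc(1) h(1) sq1] rev[OF k2(1) c2(1) k2(3) inc(2) h(2) sq2]]
        drop[OF h(3) k1(1,3)] drop[OF h(4) k2(1,3)] by simp
  next
    assume i: "ind (inclusion (img ?e) (img g1)) (inclusion (img ?e) (img g2))
      (inclusion (img g1) M3) (inclusion (img g2) M3)"
    show "ind f1 f2 g1 g2"
      using ind_transport[OF i inc(1,2) h(1,2) ce(1) k0(1,2,3) c1(1) k1(1,2) c2(1) sq1[symmetric] sq2[symmetric]]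
        top[OF h(3)] top[OF h(4)] by simp
  qed
  then show ?thesis unfolding ind_models_def using le1 le2 le3 by blast
qed

end

section \<open>Regular cardinals as index posets\<close>

text \<open>Successor cardinals, represented inside the universe, supply the regular cardinals that are needed
as lengths of chains and as indices of accessibility.\<close>

lemma (in universe) regular_successor:
  fixes A :: "'a set"
  assumes A: "infinite A" "|A| <o \<V>"
  obtains l :: "'v rel" where "regular_cardinal l" "|A| <o l" "|Field l| \<le>o |Pow A|"
    "\<And>B :: 'b set. |B| <o l \<Longrightarrow> |B| \<le>o |A|"
proof -
  let ?s = "cardSuc |A|"
  have s: "Card_order ?s" "infinite (Field ?s)" "|A| <o ?s"
    using cardSuc_Card_order card_of_Card_order cardSuc_greater card_of_cardSuc_finite A(1) by blast+
  have sP: "?s \<le>o |Pow A|" by (rule cardSuc_least) (auto simp: card_of_Card_order card_of_Pow)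
  then have "?s <o \<V>" using vsmall_Pow[OF A(2)] ordLeq_ordLess_trans by blast
  then have F: "|Field ?s| <o \<V>" by (rule ordLess_Field)
  then obtain e :: "'a set \<Rightarrow> 'v" where e: "inj_on e (Field ?s)" by (rule vsmall_code)
  let ?l = "|e ` Field ?s|"
  have "|Field ?s| =o ?l" using e by (intro card_of_ordIsoI) (auto simp: bij_betw_def)
  then have iso: "?s =o ?l" using card_of_Field_ordIso[OF s(1)] ordIso_symmetric ordIso_transitive by blast
  have "regularCard ?s" by (rule infinite_cardSuc_regularCard[OF _ card_of_Card_order]) (use A in \<open>simp add: Field_card_of\<close>)
  then have "regularCard ?l" using regularCard_ordIso[OF iso] s by (auto simp: cinfinite_def)
  moreover have "infinite (e ` Field ?s)" using s(2) e finite_image_iff by blast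
  ultimately have 1: "regular_cardinal ?l"
    unfolding regular_cardinal_def infinite_cardinal_def is_cardinal_def small_def
    using vsmall_image[OF F] card_of_Card_order[of "e ` Field ?s"] by (simp add: Field_card_of)
  have 2: "|A| <o ?l" using s(3) iso ordLess_ordIso_trans by blast
  have "|B| \<le>o |A|" if B: "|B| <o ?l" for B :: "'b set"
  proof -
    have "|B| <o ?s" using B iso ordIso_symmetric ordLess_ordIso_trans by blast
    then show ?thesis by (rule cardSuc_ordLeq_ordLess[OF card_of_Card_order card_of_Card_order, THEN iffD1])
  qed
  moreover have "|Field ?l| \<le>o |Pow A|"
    unfolding Field_card_of using iso sP ordIso_symmetric ordIso_ordLeq_trans by blast
  ultimately show thesis using that[OF 1 2] by simp
qed

lemma regular_cardinalD:
  assumes "regular_cardinal l"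
  shows "Card_order l" "Well_order l" "infinite (Field l)" "regularCard l" "small (Field l)"
    "Partial_order l" "Total l"
proof -
  show 1: "Card_order l" "infinite (Field l)" "regularCard l" "small (Field l)"
    using assms unfolding regular_cardinal_def infinite_cardinal_def is_cardinal_def by auto
  show "Well_order l" using 1(1) unfolding card_order_on_def by blast
  then show "Partial_order l" "Total l"
    unfolding well_order_on_def linear_order_on_def by blast+
qed

lemma regular_directed:
  assumes l: "regular_cardinal l" shows "directed_poset l l"
  unfolding directed_poset_def
proof (intro conjI allI impI)
  show "Partial_order l" "small (Field l)" using regular_cardinalD[OF l] by auto
  fix X assume X: "X \<subseteq> Field l" "|X| <o l"
  have "\<not> cofinal X l"
  proof
    assume "cofinal X l"
    then have "|X| =o l" using X(1) regular_cardinalD(4)[OF l] unfolding regularCard_def by blast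
    then show False using X(2) not_ordLess_ordIso by blast
  qed
  then obtain a where a: "a \<in> Field l" "\<And>b. b \<in> X \<Longrightarrow> a = b \<or> (a, b) \<notin> l"
    unfolding cofinal_def by blast
  have "(b, a) \<in> l" if b: "b \<in> X" for b
  proof (cases "a = b")
    case True
    then show ?thesis using a(1) regular_cardinalD(6)[OF l]
      by (simp add: partial_order_on_def preorder_on_def refl_on_def)
  next
    case False
    then show ?thesis using a b X(1) regular_cardinalD(7)[OF l] unfolding total_on_def by blast
  qed
  then show "\<exists>u\<in>Field l. \<forall>x\<in>X. (x, u) \<in> l" using a(1) by blast
qed

section \<open>Symmetry\<close>

context aec_independence
begin

text \<open>Chain bounds for the part of a chain below \<open>j\<close>; if this part is empty, \<open>M0\<close> itself is the bound.\<close>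

lemma bound_above:
  fixes l :: "'v rel"
  assumes cb: "chain_bounds K" and l: "regular_cardinal l" and M0: "M0 \<in> models K"
    and N: "\<And>i. (i, j) \<in> l \<Longrightarrow> i \<noteq> j \<Longrightarrow> (M0, N i) \<in> leK K"
      "\<And>i k. (i, k) \<in> l \<Longrightarrow> i \<noteq> k \<Longrightarrow> (k, j) \<in> l \<Longrightarrow> k \<noteq> j \<Longrightarrow> (N i, N k) \<in> leK K"
  shows "\<exists>P. (M0, P) \<in> leK K \<and> (\<forall>i. (i, j) \<in> l \<longrightarrow> i \<noteq> j \<longrightarrow> (N i, P) \<in> leK K)"
proof (cases "underS l j = {}")
  case True
  then show ?thesis using leK_refl[OF M0] by (auto simp: underS_def)
next
  case False
  let ?r = "Restr l (underS l j)"
  have r: "Well_order ?r" by (rule Well_order_Restr[OF regular_cardinalD(2)[OF l]])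
  have F: "Field ?r = underS l j"
  proof
    show "underS l j \<subseteq> Field ?r"
    proof
      fix i assume i: "i \<in> underS l j"
      then have "(i, i) \<in> l" using regular_cardinalD(6)[OF l]
        by (auto simp: underS_def partial_order_on_def preorder_on_def refl_on_def Field_def)
      then show "i \<in> Field ?r" using i by (auto simp: Field_def)
    qed
  qed (auto simp: Field_def)
  have s: "small (Field ?r)" unfolding F small_def
    by (rule vsmall_subset[of _ "Field l"])
      (use regular_cardinalD(5)[OF l] in \<open>auto simp: small_def underS_def Field_def\<close>)
  have mod: "N i \<in> models K" if "i \<in> Field ?r" for i
    using leK_models(2)[OF N(1)[of i]] that[unfolded F] by (simp add: underS_def)
  have le: "(N i, N k) \<in> leK K" if "(i, k) \<in> ?r" for i k
  proof (cases "i = k")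
    case True then show ?thesis using leK_refl[OF mod[of i]] that by (auto simp: Field_def)
  next
    case False then show ?thesis using N(2)[of i k] that by (auto simp: underS_def)
  qed
  have "\<exists>P\<in>models K. \<forall>i\<in>Field ?r. (N i, P) \<in> leK K"
    by (rule cb[unfolded chain_bounds_def, THEN spec, THEN spec, of ?r N, THEN mp, THEN mp, THEN mp, THEN mp])
      (use r s mod le in auto)
  then obtain P where P: "\<forall>i\<in>Field ?r. (N i, P) \<in> leK K" by blast
  obtain i where i: "i \<in> underS l j" using False by blast
  have "(M0, P) \<in> leK K"
    using leK_trans[OF N(1)[of i]] P i unfolding F by (auto simp: underS_def)
  then show ?thesis using P unfolding F by (auto simp: underS_def)
qed

text \<open>A long increasing chain above \<open>M0\<close> such that at each step a copy of \<open>f2\<close> is added that is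
  independent, on the right, from all that was built before.\<close>

lemma independent_chain:
  fixes l :: "'v rel"
  assumes cb: "chain_bounds K" and l: "regular_cardinal l" and f2: "f2 \<in> hom C M0 M2"
  obtains N where "\<And>j. j \<in> Field l \<Longrightarrow> (M0, N j) \<in> leK K"
    "\<And>i j. (i, j) \<in> l \<Longrightarrow> i \<noteq> j \<Longrightarrow> (N i, N j) \<in> leK K"
    "\<And>i j. (i, j) \<in> l \<Longrightarrow> i \<noteq> j \<Longrightarrow> \<exists>k. ind (inclusion M0 (N i)) f2 (inclusion (N i) (N j)) k"
proof -
  define P where "P F j Q \<longleftrightarrow> (j \<in> Field l \<longrightarrow> (M0, Q) \<in> leK K \<and> (\<forall>i. (i, j) \<in> l - Id \<longrightarrow>
    (F i, Q) \<in> leK K \<and> (\<exists>k. ind (inclusion M0 (F i)) f2 (inclusion (F i) Q) k)))" for F j Q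
  have "\<exists>N. \<forall>j. P N j (N j)"
  proof (rule dependent_wf_choice)
    show "wf (l - Id)" using regular_cardinalD(2)[OF l] by (simp add: well_order_on_def)
    show "P F j Q = P G j Q" if "\<And>z. (z, j) \<in> l - Id \<Longrightarrow> F z = G z" for F G j Q
      unfolding P_def using that by auto
    show "\<exists>Q. P F j Q" if IH: "\<And>i. (i, j) \<in> l - Id \<Longrightarrow> P F i (F i)" for j F
    proof -
      have below: "i \<in> Field l" if "(i, k) \<in> l" for i k using that by (auto simp: Field_def)
      have le0: "(M0, F i) \<in> leK K" if "(i, j) \<in> l" "i \<noteq> j" for i
        using IH[of i] that below unfolding P_def by blast
      have le: "(F i, F k) \<in> leK K" if "(i, k) \<in> l" "i \<noteq> k" "(k, j) \<in> l" "k \<noteq> j" for i k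
        using IH[of k] that below unfolding P_def by blast
      obtain B where B: "(M0, B) \<in> leK K" "\<And>i. (i, j) \<in> l \<Longrightarrow> i \<noteq> j \<Longrightarrow> (F i, B) \<in> leK K"
        proof -
        have "\<exists>B. (M0, B) \<in> leK K \<and> (\<forall>i. (i, j) \<in> l \<longrightarrow> i \<noteq> j \<longrightarrow> (F i, B) \<in> leK K)"
          by (rule bound_above[OF cb l homD(1)[OF f2]]) (use le0 le in auto)
        then show thesis using that by blast
      qed
      obtain R a b where ab: "ind (inclusion M0 B) f2 a b" "a \<in> hom C B R"
        using ind_exists[OF inclusion_hom[OF B(1)] f2] by metis
      obtain Q e where Q: "(B, Q) \<in> leK K" "e \<in> hom C R Q" "comp C e a = inclusion B Q"
        using rename_to_inclusion[OF ab(2)] by metis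
      have i: "ind (inclusion M0 B) f2 (inclusion B Q) (comp C e b)"
        using ind_extend[OF ab Q(2)] Q(3) by simp
      have "(F i, Q) \<in> leK K \<and> (\<exists>k. ind (inclusion M0 (F i)) f2 (inclusion (F i) Q) k)"
        if ij: "(i, j) \<in> l" "i \<noteq> j" for i
      proof -
        note s = le0[OF ij] B(2)[OF ij]
        have "ind (comp C (inclusion (F i) B) (inclusion M0 (F i))) f2 (inclusion B Q) (comp C e b)"
          using i inclusion_comp[OF s] by simp
        then have "ind (inclusion M0 (F i)) f2 (comp C (inclusion B Q) (inclusion (F i) B)) (comp C e b)"
          by (rule left_mono[OF _ inclusion_hom[OF s(1)] inclusion_hom[OF s(2)]])
        then show ?thesis using leK_trans[OF s(2) Q(1)] unfolding inclusion_comp[OF s(2) Q(1)] by blast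
      qed
      then have "P F j Q" unfolding P_def using leK_trans[OF B(1) Q(1)] by blast
      then show ?thesis by blast
    qed
  qed
  then obtain N where N: "\<And>j. P N j (N j)" by blast
  have F: "(i, j) \<in> l \<Longrightarrow> j \<in> Field l" for i j by (auto simp: Field_def)
  show thesis
  proof (rule that[of N])
    show "(M0, N j) \<in> leK K" if "j \<in> Field l" for j using N[of j] that unfolding P_def by blast
    show "(N i, N j) \<in> leK K" if "(i, j) \<in> l" "i \<noteq> j" for i j
      using N[of j] that F[OF that(1)] unfolding P_def by blast
    show "\<exists>k. ind (inclusion M0 (N i)) f2 (inclusion (N i) (N j)) k" if "(i, j) \<in> l" "i \<noteq> j" for i j
      using N[of j] that F[OF that(1)] unfolding P_def by blast
  qed
qed

text \<open>Along an independent chain with union \<open>U\<close>, amalgamate \<open>M1\<close> with \<open>U\<close> so that \<open>U\<close> is on the left.  By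
local character the image of \<open>M1\<close> is free from \<open>U\<close> over some \<open>N i\<close>, and \<open>N i\<close> is independent over
\<open>M0\<close> from the copy of \<open>M2\<close> added next.  Left transitivity puts \<open>M1\<close> to the left of this copy, while
the amalgam had the copy, a part of \<open>U\<close>, to the left of \<open>M1\<close>.\<close>

lemma doubly_independent_amalgam:
  assumes cb: "chain_bounds K" and rlc: "right_local_character K ind"
    and f1: "f1 \<in> hom C M0 M1" and f2: "f2 \<in> hom C M0 M2"
  obtains g1 g2 M3 where "ind f1 f2 g1 g2" "ind f2 f1 g2 g1"
    "g1 \<in> hom C M1 M3" "g2 \<in> hom C M2 M3"
proof -
  have "is_cardinal |univ M1|"
    using model_small[OF homD(2)[OF f1]] card_of_Card_order[of "univ M1"]
    by (simp add: is_cardinal_def small_def Field_card_of)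
  then obtain lam :: "'v rel" where lam: "is_cardinal lam" and lc: "\<And>M p. M \<in> models K \<Longrightarrow>
      p \<in> gS K |univ M1| M \<Longrightarrow>
      \<exists>M0. (M0, M) \<in> leK K \<and> |univ M0| \<le>o lam \<and> nonforking K ind |univ M1| p M0"
    using rlc unfolding right_local_character_def by blast
  let ?W = "Field lam \<union> Field mu"
  have "|?W| <o \<V>"
    using vsmall_Un lam mu_card(4) unfolding is_cardinal_def small_def by blast
  moreover have "infinite ?W" using mu_card(2) by blast
  ultimately obtain l :: "'v rel" where l: "regular_cardinal l" "|?W| <o l"
    using regular_successor[of ?W] by metis
  have lW: "r <o l" if "Card_order r" "Field r \<subseteq> ?W" for r :: "'v rel"
    using that l(2) card_of_Field_ordIso card_of_mono1 ordIso_ordLeq_trans ordIso_symmetric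
      ordLeq_ordLess_trans by meson
  have lam_l: "lam <o l" using lW[of lam] lam unfolding is_cardinal_def by blast
  have mu_l: "mu \<le>o l" using lW[of mu] mu_card(1) ordLess_imp_ordLeq by blast
  note dl = regular_directed[OF l(1)]
  note dmu = directed_mono[OF dl mu_l]
  obtain N where N: "\<And>j. j \<in> Field l \<Longrightarrow> (M0, N j) \<in> leK K"
    "\<And>i j. (i, j) \<in> l \<Longrightarrow> i \<noteq> j \<Longrightarrow> (N i, N j) \<in> leK K"
    "\<And>i j. (i, j) \<in> l \<Longrightarrow> i \<noteq> j \<Longrightarrow> \<exists>k. ind (inclusion M0 (N i)) f2 (inclusion (N i) (N j)) k"
    using independent_chain[OF cb l(1) f2] by metis
  have Nm: "N i \<in> models K" if "i \<in> Field l" for i using leK_models(2)[OF N(1)[OF that]] .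
  have Nle: "(N i, N j) \<in> leK K" if "(i, j) \<in> l" for i j
    using N(2)[OF that] leK_refl[OF Nm] directed_posetD(3)[OF dl that] by (cases "i = j") auto
  obtain U where U: "U \<in> models K" "univ U = (\<Union>i\<in>Field l. univ (N i))"
    "\<And>i. i \<in> Field l \<Longrightarrow> (N i, U) \<in> leK K"
    using directed_union[OF dmu, of N, OF Nm Nle] by metis
  obtain i0 where i0: "i0 \<in> Field l" using directed_nonempty[OF dmu] by blast
  have M0U: "(M0, U) \<in> leK K" using leK_trans[OF N(1)[OF i0] U(3)[OF i0]] .
  obtain Q a b where ab: "ind (inclusion M0 U) f1 a b" "a \<in> hom C U Q" "b \<in> hom C M1 Q"
    "comp C a (inclusion M0 U) = comp C b f1"
    using ind_exists[OF inclusion_hom[OF M0U] f1] by metis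
  obtain M' where M': "(M', U) \<in> leK K" "|univ M'| \<le>o lam" "free (inclusion M' U) a (rng b)"
    using local_character[OF ab(2), of "|univ M1|" "app b" lam] app_in[OF ab(3)] lc[OF U(1)] homD(8)[OF ab(3)]
    unfolding Field_card_of by metis
  \<comment> \<open>The base of the type of \<open>M1\<close> over \<open>U\<close> has fewer than \<open>l\<close> elements, so it lies in some \<open>N i\<close>.\<close>
  obtain i where i: "i \<in> Field l" "univ M' \<subseteq> univ (N i)"
  proof (rule directed_cover[OF dl, of "univ M'" "\<lambda>i. univ (N i)"])
    show "|univ M'| <o l" using M'(2) lam_l ordLeq_ordLess_trans by blast
    show "\<exists>i\<in>Field l. x \<in> univ (N i)" if "x \<in> univ M'" for x
      using that leK_univ[OF M'(1)] U(2) by blast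
    show "univ (N i) \<subseteq> univ (N j)" if "(i, j) \<in> l" for i j by (rule leK_univ[OF Nle[OF that]])
  qed
  obtain j where j: "i \<noteq> j" "(i, j) \<in> l" "j \<in> Field l"
    using infinite_Card_order_limit[OF regular_cardinalD(1,3)[OF l(1)] i(1)] by blast
  obtain k where k: "ind (inclusion M0 (N i)) f2 (inclusion (N i) (N j)) k" using N(3)[OF j(2,1)] by blast
  note leM' = leK_within[OF M'(1) U(3)[OF i(1)] i(2)]
  let ?i = "inclusion (N i) (N j)" and ?u = "inclusion (N j) U"
  note ih = inclusion_hom[OF Nle[OF j(2)]] and uh = inclusion_hom[OF U(3)[OF j(3)]]
    and mh = inclusion_hom[OF leM'] and zh = inclusion_hom[OF N(1)[OF i(1)]]
  have iU: "comp C ?u ?i = inclusion (N i) U" by (rule inclusion_comp[OF Nle[OF j(2)] U(3)[OF j(3)]])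
  have "free (comp C (inclusion (N i) U) (inclusion M' (N i))) a (rng b)"
    using M'(3) inclusion_comp[OF leM' U(3)[OF i(1)]] by simp
  then have "free (inclusion (N i) U) a (rng b)"
    by (rule free_base_mono[OF _ homD(9)[OF ab(3)] mh inclusion_hom[OF U(3)[OF i(1)]] ab(2)])
  then have "free ?i (comp C a ?u) (rng b)"
    using free_right_mono[OF _ ih uh ab(2)] iU by simp
  then obtain P R p q h where 1: "p \<in> hom C (N i) P" "q \<in> hom C P R" "h \<in> hom C Q R"
    "ind p ?i q (comp C h (comp C a ?u))" "app h ` rng b \<subseteq> rng q"
    by (rule freeE[OF _ ih comp_hom[OF uh ab(2)]])
  let ?a = "comp C h a" and ?b = "comp C h b" and ?g = "comp C h (comp C a ?u)"
  let ?z = "inclusion M0 (N i)" and ?k = "comp C ?g k"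
  have kh: "k \<in> hom C M2 (N j)" "comp C ?i ?z = comp C k f2"
    using ind_homs[OF k zh f2] ih by (auto simp: hom_def)
  have gh: "?g \<in> hom C (N j) R" by (rule comp_hom[OF comp_hom[OF uh ab(2)] 1(3)])
  have ah: "?a \<in> hom C U R" "?b \<in> hom C M1 R" using comp_hom ab(2,3) 1(3) by blast+
  have g_au: "?g = comp C ?a ?u" using comp_assoc[OF uh ab(2) 1(3)] by simp
  have 2: "ind (comp C p ?z) f2 q ?k" by (rule left_trans[OF k 1(4)])
  have "rng ?b \<subseteq> rng q" using 1(5) rng_comp[OF ab(3) 1(3)] by simp
  then obtain n where n: "n \<in> hom C M1 P" "comp C q n = ?b" by (rule factor[OF ah(2) 1(2)])
  have U0: "inclusion M0 U = comp C ?u (comp C k f2)"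
    using kh(2) inclusion_comp[OF N(1)[OF i(1)] Nle[OF j(2)]] inclusion_comp[OF N(1)[OF j(3)] U(3)[OF j(3)]]
    by simp
  have "comp C q (comp C n f1) = comp C q (comp C p ?z)"
  proof -
    have "comp C q (comp C n f1) = comp C h (comp C b f1)"
      using comp_assoc[OF f1 n(1) 1(2)] comp_assoc[OF f1 ab(3) 1(3)] n(2) by simp
    also have "\<dots> = comp C ?a (inclusion M0 U)"
      using ab(4) comp_assoc[OF inclusion_hom[OF M0U] ab(2) 1(3)] by simp
    also have "\<dots> = comp C ?g (comp C k f2)"
      using U0 g_au comp_assoc[OF comp_hom[OF f2 kh(1)] uh ah(1)] by simp
    also have "\<dots> = comp C (comp C q p) ?z"
    proof -
      have "comp C q p = comp C ?g ?i" using ind_homs[OF 1(4,1) ih] by metis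
      then show ?thesis using kh(2) comp_assoc[OF zh ih gh] by simp
    qed
    also have "\<dots> = comp C q (comp C p ?z)" by (rule comp_assoc[OF zh 1(1,2)])
    finally show ?thesis .
  qed
  then have "comp C n f1 = comp C p ?z"
    by (rule mono[OF comp_hom[OF f1 n(1)] comp_hom[OF zh 1(1)] 1(2)])
  then have 3: "ind (comp C n f1) f2 q ?k" using 2 by simp
  have I1: "ind f1 f2 ?b ?k" using left_mono[OF 3 f1 n(1)] n(2) by simp
  have "ind (inclusion M0 U) f1 ?a ?b" by (rule ind_extend[OF ab(1,2) 1(3)])
  then have "ind (comp C (comp C ?u k) f2) f1 ?a ?b" using U0 comp_assoc[OF f2 kh(1) uh] by simp
  then have "ind f2 f1 (comp C ?a (comp C ?u k)) ?b" by (rule left_mono[OF _ f2 comp_hom[OF kh(1) uh]])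
  then have I2: "ind f2 f1 ?k ?b" using g_au comp_assoc[OF kh(1) uh ah(1)] by simp
  show thesis by (rule that[OF I1 I2 ah(2) comp_hom[OF kh(1) gh]])
qed

text \<open>By uniqueness it suffices that each span has one amalgam that is independent in both orders.\<close>

theorem symmetric_ind:
  assumes cb: "chain_bounds K" and rlc: "right_local_character K ind"
  shows "symmetric ind"
proof -
  have sym: "ind f2 f1 a2 a1" if i: "ind f1 f2 a1 a2" for f1 f2 a1 a2
  proof -
    obtain M0 M1 M2 N where h: "f1 \<in> hom C M0 M1" "f2 \<in> hom C M0 M2" "a1 \<in> hom C M1 N"
      "a2 \<in> hom C M2 N" "comp C a1 f1 = comp C a2 f2" using indE[OF i] by metis
    obtain g1 g2 P where g: "ind f1 f2 g1 g2" "ind f2 f1 g2 g1" "g1 \<in> hom C M1 P" "g2 \<in> hom C M2 P"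
      using doubly_independent_amalgam[OF cb rlc h(1,2)] by metis
    obtain R ga gb where r: "ga \<in> hom C N R" "gb \<in> hom C P R"
      "comp C ga a1 = comp C gb g1" "comp C ga a2 = comp C gb g2"
      by (rule common_extension[OF i g(1) h(3) g(3)])
    have "ind f2 f1 (comp C ga a2) (comp C ga a1)"
      using ind_extend[OF g(2,4) r(2)] r(3,4) by simp
    then show ?thesis by (rule ind_restrict[OF _ r(1) h(2,1,4,3) h(5)[symmetric]])
  qed
  then show ?thesis unfolding symmetric_def dual_def by blast
qed

end

section \<open>Directed colimits of independent squares\<close>

text \<open>The situation after symmetry is established; \<open>theta\<close> is the cardinal of the witness
  property.\<close>

locale witnessed_independence = aec_independence mu K ind
  for mu :: "'v rel" and K :: "'v aclass" and ind :: "'v K_arrow square_rel" +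
  fixes theta :: "'v rel"
  assumes sym: "symmetric ind"
    and theta: "infinite_cardinal theta"
    and witness: "\<And>M0 M1 M2 M3. (M0, M1) \<in> leK K \<Longrightarrow> (M0, M2) \<in> leK K \<Longrightarrow> (M1, M3) \<in> leK K \<Longrightarrow>
      (M2, M3) \<in> leK K \<Longrightarrow>
      (\<And>A. A \<subseteq> univ M2 \<Longrightarrow> |A| <o theta \<Longrightarrow> ind_sets K ind M0 (univ M1) A M3) \<Longrightarrow>
      ind_models K ind M0 M1 M2 M3"
begin

lemma ind_sym: "ind f1 f2 g1 g2 \<Longrightarrow> ind f2 f1 g2 g1"
  using sym unfolding symmetric_def dual_def by metis

lemma free_empty:
  assumes f: "f \<in> hom C M0 M" and g: "g \<in> hom C M N" shows "free f g {}"
proof -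
  have I: "ident C M \<in> hom C M M" using ident_hom[of M] homD(1)[OF g] by simp
  have "ind (ident C M0) f f (ident C M)" by (rule ind_sym[OF ind_ident[OF f]])
  then have "ind (ident C M0) f (comp C g f) (comp C g (ident C M))" by (rule ind_extend[OF _ f g])
  then show ?thesis using free_subset[OF ind_free] comp_ident[OF g] by auto
qed

text \<open>The witness property speaks of small subsets of the right side and of inclusions: symmetry
  exchanges the sides, and taking images in the top corner turns arrows into inclusions.\<close>

lemma free_witness:
  assumes h: "f1 \<in> hom C M0 M1" "f2 \<in> hom C M0 M2" "g1 \<in> hom C M1 N" "g2 \<in> hom C M2 N"
    and c: "comp C g1 f1 = comp C g2 f2"
    and fr: "\<And>A. A \<subseteq> univ M1 \<Longrightarrow> |A| <o theta \<Longrightarrow> free f2 g2 (app g1 ` A)"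
  shows "ind f1 f2 g1 g2"
proof -
  let ?e = "comp C g2 f2"
  have eh: "?e \<in> hom C M0 N" by (rule comp_hom[OF h(2,4)])
  note le = homD(4)[OF eh] homD(4)[OF h(4)] homD(4)[OF h(3)]
  have le2: "(img ?e, img g2) \<in> leK K"
    by (rule leK_within[OF le(1,2)]) (use rng_comp_subset[OF h(2,4)] in simp)
  have le1: "(img ?e, img g1) \<in> leK K"
    by (rule leK_within[OF le(1,3)]) (use rng_comp_subset[OF h(1,3)] c in simp)
  have "ind_models K ind (img ?e) (img g2) (img g1) N"
  proof (rule witness[OF le2 le1 le(2,3)])
    fix A assume A: "A \<subseteq> univ (img g1)" "|A| <o theta"
    let ?B = "inv_into (univ M1) (app g1) ` A"
    have "A \<subseteq> app g1 ` univ M1" using A(1) homD(8)[OF h(3)] by simp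
    then have B: "?B \<subseteq> univ M1" "app g1 ` ?B = A"
      by (auto simp: inv_into_into f_inv_into_f image_iff subset_eq)
    have "|?B| <o theta" using A(2) card_of_image ordLeq_ordLess_trans by blast
    then have "free f2 g2 A" using fr[OF B(1)] B(2) by simp
    then obtain P R p q r where 1: "p \<in> hom C M0 P" "q \<in> hom C P R" "r \<in> hom C N R"
      "ind p f2 q (comp C r g2)" "app r ` A \<subseteq> rng q" by (rule freeE[OF _ h(2,4)])
    obtain R' j where R: "(N, R') \<in> leK K" "j \<in> hom C R R'" "comp C j r = inclusion N R'"
      using rename_to_inclusion[OF 1(3)] by metis
    note ih = inclusion_hom[OF R(1)]
    let ?q = "comp C j q" and ?g = "comp C (inclusion N R') g2"
    have qh: "?q \<in> hom C P R'" and gh: "?g \<in> hom C M2 R'"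
      using comp_hom[OF 1(2) R(2)] comp_hom[OF h(4) ih] by auto
    have "comp C j (comp C r g2) = ?g" using comp_assoc[OF h(4) 1(3) R(2)] R(3) by simp
    then have "ind p f2 ?q ?g" using ind_extend[OF 1(4,2) R(2)] by simp
    then have i: "ind f2 p ?g ?q" by (rule ind_sym)
    have cc: "comp C ?g f2 = comp C ?q p" using ind_homs[OF i h(2) 1(1)] by metis
    have same: "img (comp C (inclusion N R') a) = img a" if a: "a \<in> hom C X N" for a X
    proof (rule leK_eq[OF homD(4)[OF comp_hom[OF a ih]] leK_trans[OF homD(4)[OF a] R(1)]])
      show "univ (img (comp C (inclusion N R') a)) = univ (img a)"
        using rng_comp[OF a ih] homD(9)[OF a] by (force simp: image_iff)
    qed
    have "ind_models K ind (img (comp C ?g f2)) (img ?g) (img ?q) R'"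
      using ind_iff_ind_models_img[OF h(2) 1(1) gh qh cc] i by simp
    moreover have "comp C ?g f2 = comp C (inclusion N R') ?e" by (rule comp_assoc[OF h(2,4) ih])
    ultimately have m: "ind_models K ind (img ?e) (img g2) (img ?q) R'"
      using same[OF eh] same[OF h(4)] by simp
    have "A \<subseteq> univ (img ?q)"
    proof
      fix x assume x: "x \<in> A"
      then have xN: "x \<in> univ N" using A(1) homD(9)[OF h(3)] by auto
      have "app r x \<in> rng q" using 1(5) x by blast
      then have "app j (app r x) \<in> rng ?q" using rng_comp[OF 1(2) R(2)] by simp
      then show "x \<in> univ (img ?q)" using app_comp[OF 1(3) R(2) xN] R(3) xN by simp
    qed
    then show "ind_sets K ind (img ?e) (univ (img g2)) A N"
      unfolding ind_sets_def using le(1) m R(1) A(1) homD(9)[OF h(3)] homD(9)[OF h(4)]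
      by (intro conjI exI[of _ "img g2"] exI[of _ "img ?q"] exI[of _ R']) auto
  qed
  then have "ind f2 f1 g2 g1" using ind_iff_ind_models_img[OF h(2,1,4,3) c[symmetric]] by simp
  then show ?thesis by (rule ind_sym)
qed

abbreviation NF :: "('v K_arrow, 'v K_arrow \<times> 'v K_arrow \<times> 'v K_arrow \<times> 'v K_arrow) cat" where
  "NF \<equiv> NF_cat C ind"

text \<open>A morphism of the category of independent squares from \<open>f\<close> to \<open>g\<close> consists of an arrow between the
sources of \<open>f\<close> and \<open>g\<close>, its lower part, and one between their targets, its upper part.\<close>

definition lower :: "'v K_arrow \<times> 'v K_arrow \<times> 'v K_arrow \<times> 'v K_arrow \<Rightarrow> 'v K_arrow" where
  "lower a = fst (snd a)"

definition upper :: "'v K_arrow \<times> 'v K_arrow \<times> 'v K_arrow \<times> 'v K_arrow \<Rightarrow> 'v K_arrow" where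
  "upper a = fst (snd (snd a))"

abbreviation tg :: "'v K_arrow \<Rightarrow> 'v struct" where "tg a \<equiv> snd (snd a)"

lemma NF_hom_iff: "a \<in> hom NF f g \<longleftrightarrow> a = (f, lower a, upper a, g) \<and> ind f (lower a) (upper a) g"
  by (cases a) (auto simp: NF_cat_def hom_def lower_def upper_def)

lemma NF_homI: "ind f h1 h2 g \<Longrightarrow> (f, h1, h2, g) \<in> hom NF f g"
  by (simp add: NF_hom_iff lower_def upper_def)

lemma lower_simp [simp]: "lower (f, h1, h2, g) = h1" and upper_simp [simp]: "upper (f, h1, h2, g) = h2"
  by (simp_all add: lower_def upper_def)

lemma NF_obj: "obj NF = arr C"
  by (simp add: NF_cat_def)

lemma arr_iff: "f \<in> arr C \<longleftrightarrow> f \<in> hom C (fst f) (tg f)"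
  by (simp add: hom_def)

lemma NF_homD:
  assumes "a \<in> hom NF f g"
  shows "ind f (lower a) (upper a) g" "f \<in> hom C (fst f) (tg f)" "g \<in> hom C (fst g) (tg g)"
    "lower a \<in> hom C (fst f) (fst g)" "upper a \<in> hom C (tg f) (tg g)"
    "comp C (upper a) f = comp C g (lower a)"
proof -
  show i: "ind f (lower a) (upper a) g" using assms unfolding NF_hom_iff by blast
  obtain X0 X1 X2 X3 where X: "f \<in> hom C X0 X1" "lower a \<in> hom C X0 X2" "upper a \<in> hom C X1 X3"
    "g \<in> hom C X2 X3" "comp C (upper a) f = comp C g (lower a)" using indE[OF i] by metis
  note e = homD(6,10)[OF X(1)] homD(6,10)[OF X(4)]
  show "f \<in> hom C (fst f) (tg f)" "g \<in> hom C (fst g) (tg g)"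
    "lower a \<in> hom C (fst f) (fst g)" "upper a \<in> hom C (tg f) (tg g)" using X unfolding e by auto
  show "comp C (upper a) f = comp C g (lower a)" by (rule X(5))
qed

lemma NF_comp:
  assumes "a \<in> hom NF f g" "b \<in> hom NF g k"
  shows "comp NF b a = (f, comp C (lower b) (lower a), comp C (upper b) (upper a), k)"
    "lower (comp NF b a) = comp C (lower b) (lower a)" "upper (comp NF b a) = comp C (upper b) (upper a)"
    "comp NF b a \<in> hom NF f k"
proof -
  have a: "a = (f, lower a, upper a, g)" and b: "b = (g, lower b, upper b, k)"
    using assms unfolding NF_hom_iff by blast+
  show 1: "comp NF b a = (f, comp C (lower b) (lower a), comp C (upper b) (upper a), k)"
    by (subst a, subst b) (simp add: NF_cat_def)
  show "lower (comp NF b a) = comp C (lower b) (lower a)" "upper (comp NF b a) = comp C (upper b) (upper a)"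
    by (simp_all add: 1)
  show "comp NF b a \<in> hom NF f k"
    unfolding 1 by (rule NF_homI[OF right_trans[OF NF_homD(1)[OF assms(1)] NF_homD(1)[OF assms(2)]]])
qed

lemma NF_eqI: "a \<in> hom NF f g \<Longrightarrow> b \<in> hom NF f g \<Longrightarrow> lower a = lower b \<Longrightarrow> upper a = upper b \<Longrightarrow> a = b"
  unfolding NF_hom_iff by metis

lemma NF_ident: "lower (ident NF f) = ident C (fst f)" "upper (ident NF f) = ident C (tg f)"
  by (simp_all add: NF_cat_def)

sublocale nf: category_laws NF by unfold_locales (rule NF_category)

lemma NF_mono:
  assumes a: "a \<in> hom NF f g" and b: "b \<in> hom NF f g" and m: "m \<in> hom NF g k"
    and e: "comp NF m a = comp NF m b"
  shows "a = b"
proof (rule NF_eqI[OF a b])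
  show "lower a = lower b"
    by (rule mono[OF NF_homD(4)[OF a] NF_homD(4)[OF b] NF_homD(4)[OF m]])
      (use NF_comp(2)[OF a m] NF_comp(2)[OF b m] e in simp)
  show "upper a = upper b"
    by (rule mono[OF NF_homD(5)[OF a] NF_homD(5)[OF b] NF_homD(5)[OF m]])
      (use NF_comp(3)[OF a m] NF_comp(3)[OF b m] e in simp)
qed

text \<open>Factor both parts; the resulting square is independent by right monotonicity.\<close>

lemma NF_factor:
  assumes a: "a \<in> hom NF f k" and b: "b \<in> hom NF g k"
    and r: "rng (lower a) \<subseteq> rng (lower b)" "rng (upper a) \<subseteq> rng (upper b)"
  obtains c where "c \<in> hom NF f g" "comp NF b c = a"
proof -
  note A = NF_homD[OF a] and B = NF_homD[OF b]
  obtain c1 where c1: "c1 \<in> hom C (fst f) (fst g)" "comp C (lower b) c1 = lower a"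
    by (rule factor[OF A(4) B(4) r(1)])
  obtain c2 where c2: "c2 \<in> hom C (tg f) (tg g)" "comp C (upper b) c2 = upper a"
    by (rule factor[OF A(5) B(5) r(2)])
  have "ind f (comp C (lower b) c1) (upper a) k" using A(1) c1(2) by simp
  then have "ind f c1 (upper a) (comp C k (lower b))" by (rule right_mono[OF _ c1(1) B(4)])
  then have i: "ind f c1 (comp C (upper b) c2) (comp C (upper b) g)" using c2(2) B(6) by simp
  have "comp C (upper b) (comp C c2 f) = comp C (upper b) (comp C g c1)"
    using comp_assoc[OF A(2) c2(1) B(5)] comp_assoc[OF c1(1) B(2,5)] c2(2) A(6) B(6) c1(2)
      comp_assoc[OF c1(1) B(4,3)] by simp
  then have "comp C c2 f = comp C g c1"
    by (rule mono[OF comp_hom[OF A(2) c2(1)] comp_hom[OF c1(1) B(2)] B(5)])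
  then have "ind f c1 c2 g" by (rule ind_restrict[OF i B(5) A(2) c1(1) c2(1) B(2)])
  then have h: "(f, c1, c2, g) \<in> hom NF f g" by (rule NF_homI)
  have "comp NF b (f, c1, c2, g) = a"
    by (rule NF_eqI[OF NF_comp(4)[OF h b] a]) (use NF_comp(2,3)[OF h b] c1(2) c2(2) in simp_all)
  then show thesis using that h by blast
qed

text \<open>Every element of the two models in \<open>X\<close> comes from the diagram.  This turns out to characterize the
colimits among the cocones.\<close>

definition covers :: "'v rel \<Rightarrow> 'v K_arrow \<Rightarrow> ('v \<Rightarrow> 'v K_arrow \<times> 'v K_arrow \<times> 'v K_arrow \<times> 'v K_arrow) \<Rightarrow> bool" where
  "covers r X c \<longleftrightarrow> univ (fst X) = (\<Union>i\<in>Field r. rng (lower (c i))) \<and>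
     univ (tg X) = (\<Union>i\<in>Field r. rng (upper (c i)))"

lemma NF_diagramD:
  assumes d: "diagram NF r D d"
  shows "\<And>i j. (i, j) \<in> r \<Longrightarrow> d i j \<in> hom NF (D i) (D j)"
    "\<And>i. i \<in> Field r \<Longrightarrow> D i \<in> hom C (fst (D i)) (tg (D i))"
    "diagram C r (\<lambda>i. fst (D i)) (\<lambda>i j. lower (d i j))"
    "diagram C r (\<lambda>i. tg (D i)) (\<lambda>i j. upper (d i j))"
proof -
  have D: "\<And>i. i \<in> Field r \<Longrightarrow> D i \<in> arr C" "\<And>i. i \<in> Field r \<Longrightarrow> d i i = ident NF (D i)"
    and dh: "\<And>i j. (i, j) \<in> r \<Longrightarrow> d i j \<in> hom NF (D i) (D j)"
    and dc: "\<And>i j k. (i, j) \<in> r \<Longrightarrow> (j, k) \<in> r \<Longrightarrow> comp NF (d j k) (d i j) = d i k"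
    using d by (auto simp: diagram_def NF_obj)
  show "\<And>i j. (i, j) \<in> r \<Longrightarrow> d i j \<in> hom NF (D i) (D j)" by (rule dh)
  show Dh: "D i \<in> hom C (fst (D i)) (tg (D i))" if "i \<in> Field r" for i using D(1)[OF that] arr_iff by blast
  have c: "comp C (lower (d j k)) (lower (d i j)) = lower (d i k)" "comp C (upper (d j k)) (upper (d i j)) = upper (d i k)"
    if "(i, j) \<in> r" "(j, k) \<in> r" for i j k
    using NF_comp(2,3)[OF dh[OF that(1)] dh[OF that(2)]] dc[OF that] by simp_all
  show "diagram C r (\<lambda>i. fst (D i)) (\<lambda>i j. lower (d i j))" "diagram C r (\<lambda>i. tg (D i)) (\<lambda>i j. upper (d i j))"
    unfolding diagram_def
    using D(2) NF_ident homD(1,2)[OF Dh] NF_homD(4,5)[OF dh] c by simp_all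
qed

lemma NF_coconeD:
  assumes c: "cocone NF r D d X c" and d: "diagram NF r D d"
  shows "\<And>i. i \<in> Field r \<Longrightarrow> c i \<in> hom NF (D i) X" "X \<in> hom C (fst X) (tg X)"
    "\<And>i j. (i, j) \<in> r \<Longrightarrow> comp NF (c j) (d i j) = c i"
    "cocone C r (\<lambda>i. fst (D i)) (\<lambda>i j. lower (d i j)) (fst X) (\<lambda>i. lower (c i))"
    "cocone C r (\<lambda>i. tg (D i)) (\<lambda>i j. upper (d i j)) (tg X) (\<lambda>i. upper (c i))"
proof -
  have ch: "\<And>i. i \<in> Field r \<Longrightarrow> c i \<in> hom NF (D i) X"
    and cc: "\<And>i j. (i, j) \<in> r \<Longrightarrow> comp NF (c j) (d i j) = c i" and X: "X \<in> arr C"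
    using c by (auto simp: cocone_def NF_obj)
  show "\<And>i. i \<in> Field r \<Longrightarrow> c i \<in> hom NF (D i) X"
    "\<And>i j. (i, j) \<in> r \<Longrightarrow> comp NF (c j) (d i j) = c i" by (fact ch, fact cc)
  show Xh: "X \<in> hom C (fst X) (tg X)" using X arr_iff by blast
  have "comp C (lower (c j)) (lower (d i j)) = lower (c i)" "comp C (upper (c j)) (upper (d i j)) = upper (c i)"
    if "(i, j) \<in> r" for i j
    using NF_comp(2,3)[OF NF_diagramD(1)[OF d that] ch[OF FieldI2[OF that]]] cc[OF that] by simp_all
  then show "cocone C r (\<lambda>i. fst (D i)) (\<lambda>i j. lower (d i j)) (fst X) (\<lambda>i. lower (c i))"
    "cocone C r (\<lambda>i. tg (D i)) (\<lambda>i j. upper (d i j)) (tg X) (\<lambda>i. upper (c i))"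
    unfolding cocone_def using homD(1,2)[OF Xh] NF_homD(4,5)[OF ch] by simp_all
qed

text \<open>Both parts have colimits in \<open>K\<close>.  The induced square is independent: a small subset of the target of
\<open>X\<close> comes from one \<open>D i\<close>, so it is free from \<open>Y\<close> over \<open>D i\<close>, and by base monotonicity over \<open>X\<close>.\<close>

lemma NF_covering_cocone_is_colimit:
  assumes lam: "mu \<le>o lam" "theta \<le>o lam" and r: "directed_poset lam r"
    and d: "diagram NF r D d" and c: "cocone NF r D d X c" and cov: "covers r X c"
  shows "colimit NF r D d X c"
  unfolding colimit_def
proof (intro conjI allI impI)
  show "cocone NF r D d X c" by (rule c)
  fix Y e assume e: "cocone NF r D d Y e"
  note rmu = directed_mono[OF r lam(1)] and rth = directed_mono[OF r lam(2)]
  note D = NF_diagramD[OF d] and X = NF_coconeD[OF c d] and Y = NF_coconeD[OF e d]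
  have cov1: "univ (fst X) = (\<Union>i\<in>Field r. rng (lower (c i)))"
    and cov2: "univ (tg X) = (\<Union>i\<in>Field r. rng (upper (c i)))" using cov by (auto simp: covers_def)
  have ex1: "\<exists>!u. u \<in> hom C (fst X) (fst Y) \<and> (\<forall>i\<in>Field r. comp C u (lower (c i)) = lower (e i))"
    using covering_cocone_is_colimit[OF rmu D(3) X(4) cov1] Y(4) unfolding colimit_def by blast
  have ex2: "\<exists>!u. u \<in> hom C (tg X) (tg Y) \<and> (\<forall>i\<in>Field r. comp C u (upper (c i)) = upper (e i))"
    using covering_cocone_is_colimit[OF rmu D(4) X(5) cov2] Y(5) unfolding colimit_def by blast
  obtain u1 where u1: "u1 \<in> hom C (fst X) (fst Y)" "\<And>i. i \<in> Field r \<Longrightarrow> comp C u1 (lower (c i)) = lower (e i)"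
    using ex1 by blast
  obtain u2 where u2: "u2 \<in> hom C (tg X) (tg Y)" "\<And>i. i \<in> Field r \<Longrightarrow> comp C u2 (upper (c i)) = upper (e i)"
    using ex2 by blast
  have comm: "comp C u2 X = comp C Y u1"
  proof (rule arrow_eqI[OF comp_hom[OF X(2) u2(1)] comp_hom[OF u1(1) Y(2)]])
    fix x assume "x \<in> univ (fst X)"
    then obtain i where i: "i \<in> Field r" "x \<in> rng (lower (c i))" using cov1 by blast
    note hc = NF_homD[OF X(1)[OF i(1)]] and he = NF_homD[OF Y(1)[OF i(1)]]
    obtain a where a: "a \<in> univ (fst (D i))" "x = app (lower (c i)) a" using i(2) homD(8)[OF hc(4)] by blast
    have "comp C (comp C u2 X) (lower (c i)) = comp C (comp C Y u1) (lower (c i))"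
      using comp_assoc[OF hc(4,3) u2(1)] hc(6) comp_assoc[OF hc(2,5) u2(1)] u2(2)[OF i(1)] he(6)
        comp_assoc[OF hc(4) u1(1) Y(2)] u1(2)[OF i(1)] by simp
    then show "app (comp C u2 X) x = app (comp C Y u1) x"
      using app_comp[OF hc(4) comp_hom[OF X(2) u2(1)] a(1)] app_comp[OF hc(4) comp_hom[OF u1(1) Y(2)] a(1)] a(2)
      by simp
  qed
  have "ind X u1 u2 Y"
  proof (rule free_witness[OF X(2) u1(1) u2(1) Y(2) comm])
    fix A assume A: "A \<subseteq> univ (tg X)" "|A| <o theta"
    obtain i where i: "i \<in> Field r" "A \<subseteq> rng (upper (c i))"
    proof (rule directed_cover[OF rth A(2), of "\<lambda>i. rng (upper (c i))"])
      show "\<exists>i\<in>Field r. x \<in> rng (upper (c i))" if "x \<in> A" for x using that A(1) cov2 by blast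
      show "rng (upper (c i)) \<subseteq> rng (upper (c j))" if "(i, j) \<in> r" for i j
        by (rule cocone_rng_mono[OF rmu D(4) X(5) that])
    qed
    note hc = NF_homD[OF X(1)[OF i(1)]] and he = NF_homD[OF Y(1)[OF i(1)]]
    have "free (lower (e i)) Y (rng (upper (e i)))" by (rule ind_free[OF he(1)])
    then have "free (comp C u1 (lower (c i))) Y (rng (upper (e i)))" using u1(2)[OF i(1)] by simp
    then have "free u1 Y (rng (upper (e i)))"
      by (rule free_base_mono[OF _ homD(9)[OF he(5)] hc(4) u1(1) Y(2)])
    moreover have "app u2 ` A \<subseteq> rng (upper (e i))"
      using rng_comp[OF hc(5) u2(1)] u2(2)[OF i(1)] i(2) by auto
    ultimately show "free u1 Y (app u2 ` A)" by (rule free_subset)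
  qed
  then have uh: "(X, u1, u2, Y) \<in> hom NF X Y" by (rule NF_homI)
  show "\<exists>!u. u \<in> hom NF X Y \<and> (\<forall>i\<in>Field r. comp NF u (c i) = e i)"
  proof (rule ex1I[of _ "(X, u1, u2, Y)"], intro conjI ballI uh)
    fix i assume i: "i \<in> Field r"
    show "comp NF (X, u1, u2, Y) (c i) = e i"
      by (rule NF_eqI[OF NF_comp(4)[OF X(1)[OF i] uh] Y(1)[OF i]])
        (use NF_comp(2,3)[OF X(1)[OF i] uh] u1(2)[OF i] u2(2)[OF i] in simp_all)
  next
    fix v assume v: "v \<in> hom NF X Y \<and> (\<forall>i\<in>Field r. comp NF v (c i) = e i)"
    then have vh: "v \<in> hom NF X Y" by blast
    have vi: "comp C (lower v) (lower (c i)) = lower (e i)" "comp C (upper v) (upper (c i)) = upper (e i)"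
      if i: "i \<in> Field r" for i
      using NF_comp(2,3)[OF X(1)[OF i] vh] v i by simp_all
    have "lower v = u1" using ex1 u1 NF_homD(4)[OF vh] vi(1) by blast
    moreover have "upper v = u2" using ex2 u2 NF_homD(5)[OF vh] vi(2) by blast
    ultimately show "v = (X, u1, u2, Y)" using NF_eqI[OF vh uh] by simp
  qed
qed

text \<open>Take colimits of the sources and of the targets.  The coprojections are independent squares: a
small subset of the colimit of the sources comes from one stage, where the diagram gives
independence.\<close>

lemma NF_covering_cocone_exists:
  assumes lam: "mu \<le>o lam" "theta \<le>o lam" and r: "directed_poset lam r"
    and d: "diagram NF r D d"
  obtains X c where "cocone NF r D d X c" "covers r X c"
proof -
  note rmu = directed_mono[OF r lam(1)] and rth = directed_mono[OF r lam(2)]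
  note D = NF_diagramD[OF d] and F = directed_posetD(3,4)[OF r]
  obtain M c1 where c1: "cocone C r (\<lambda>i. fst (D i)) (\<lambda>i j. lower (d i j)) M c1"
    "univ M = (\<Union>i\<in>Field r. rng (c1 i))" by (rule covering_cocone_exists[OF rmu D(3)])
  obtain N c2 where c2: "cocone C r (\<lambda>i. tg (D i)) (\<lambda>i j. upper (d i j)) N c2"
    "univ N = (\<Union>i\<in>Field r. rng (c2 i))" by (rule covering_cocone_exists[OF rmu D(4)])
  note C1 = coconeD[OF c1(1)] and C2 = coconeD[OF c2(1)]
  have "cocone C r (\<lambda>i. fst (D i)) (\<lambda>i j. lower (d i j)) N (\<lambda>i. comp C (c2 i) (D i))"
    unfolding cocone_def obj_cat_of
  proof (intro conjI ballI allI impI)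
    show "N \<in> models K" by (rule C2(3))
    show "comp C (c2 i) (D i) \<in> hom C (fst (D i)) N" if "i \<in> Field r" for i
      by (rule comp_hom[OF D(2)[OF that] C2(1)[OF that]])
    show "comp C (comp C (c2 j) (D j)) (lower (d i j)) = comp C (c2 i) (D i)" if ij: "(i, j) \<in> r" for i j
    proof -
      note dh = NF_homD[OF D(1)[OF ij]]
      show ?thesis
        using comp_assoc[OF dh(4,3) C2(1)[OF F(2)[OF ij]]] comp_assoc[OF dh(2,5) C2(1)[OF F(2)[OF ij]]]
          dh(6) C2(2)[OF ij] by simp
    qed
  qed
  then obtain u where u: "u \<in> hom C M N" "\<And>i. i \<in> Field r \<Longrightarrow> comp C u (c1 i) = comp C (c2 i) (D i)"
    using covering_cocone_is_colimit[OF rmu D(3) c1] unfolding colimit_def by blast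
  have ui: "ind (D i) (c1 i) (c2 i) u" if i: "i \<in> Field r" for i
  proof -
    have "ind (c1 i) (D i) u (c2 i)"
    proof (rule free_witness[OF C1(1)[OF i] D(2)[OF i] u(1) C2(1)[OF i] u(2)[OF i]])
      fix A assume A: "A \<subseteq> univ M" "|A| <o theta"
      obtain j where j: "j \<in> Field r" "A \<subseteq> rng (c1 j)"
      proof (rule directed_cover[OF rth A(2), of "\<lambda>i. rng (c1 i)"])
        show "\<exists>i\<in>Field r. x \<in> rng (c1 i)" if "x \<in> A" for x using that A(1) c1(2) by blast
        show "rng (c1 i) \<subseteq> rng (c1 j)" if "(i, j) \<in> r" for i j
          by (rule cocone_rng_mono[OF rmu D(3) c1(1) that])
      qed
      obtain k where k: "(i, k) \<in> r" "(j, k) \<in> r" using directed_two[OF rmu i j(1)] by blast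
      have kF: "k \<in> Field r" by (rule F(2)[OF k(1)])
      have Ak: "A \<subseteq> rng (c1 k)" using j(2) cocone_rng_mono[OF rmu D(3) c1(1) k(2)] by blast
      note dh = NF_homD[OF D(1)[OF k(1)]]
      have "ind (lower (d i k)) (D i) (comp C (c2 k) (D k)) (comp C (c2 k) (upper (d i k)))"
        by (rule ind_extend[OF ind_sym[OF dh(1)] D(2)[OF kF] C2(1)[OF kF]])
      then have "free (D i) (c2 i) (rng (comp C u (c1 k)))"
        using ind_free C2(2)[OF k(1)] u(2)[OF kF] by metis
      moreover have "app u ` A \<subseteq> rng (comp C u (c1 k))" using rng_comp[OF C1(1)[OF kF] u(1)] Ak by auto
      ultimately show "free (D i) (c2 i) (app u ` A)" by (rule free_subset)
    qed
    then show ?thesis by (rule ind_sym)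
  qed
  let ?c = "\<lambda>i. (D i, c1 i, c2 i, u)"
  have e: "fst u = M" "tg u = N" by (rule homD(6)[OF u(1)], rule homD(10)[OF u(1)])
  have "cocone NF r D d u ?c"
    unfolding cocone_def NF_obj
  proof (intro conjI ballI allI impI)
    show "u \<in> arr C" by (rule hom_arr[OF u(1)])
    show "?c i \<in> hom NF (D i) u" if "i \<in> Field r" for i by (rule NF_homI[OF ui[OF that]])
    show "comp NF (?c j) (d i j) = ?c i" if ij: "(i, j) \<in> r" for i j
    proof -
      have "comp NF (?c j) (d i j) = (D i, comp C (c1 j) (lower (d i j)), comp C (c2 j) (upper (d i j)), u)"
        using NF_comp(1)[OF D(1)[OF ij] NF_homI[OF ui[OF F(2)[OF ij]]]] by simp
      then show ?thesis using C1(2)[OF ij] C2(2)[OF ij] by simp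
    qed
  qed
  moreover have "covers r u ?c" unfolding covers_def e using c1(2) c2(2) by simp
  ultimately show thesis by (rule that)
qed

lemma NF_colimit_covers:
  assumes lam: "mu \<le>o lam" "theta \<le>o lam" and r: "directed_poset lam r"
    and d: "diagram NF r D d" and X: "colimit NF r D d X c"
  shows "covers r X c"
proof -
  obtain Y e where e: "cocone NF r D d Y e" "covers r Y e"
    by (rule NF_covering_cocone_exists[OF lam r d])
  have Y: "colimit NF r D d Y e" by (rule NF_covering_cocone_is_colimit[OF lam r d e])
  have c: "cocone NF r D d X c" using X by (simp add: colimit_def)
  note XC = NF_coconeD[OF c d] and YC = NF_coconeD[OF e(1) d]
  obtain u where u: "u \<in> hom NF Y X" "\<And>i. i \<in> Field r \<Longrightarrow> comp NF u (e i) = c i"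
    using Y c unfolding colimit_def by blast
  obtain v where v: "v \<in> hom NF X Y" "\<And>i. i \<in> Field r \<Longrightarrow> comp NF v (c i) = e i"
    using X e(1) unfolding colimit_def by blast
  have X1: "\<exists>!w. w \<in> hom NF X X \<and> (\<forall>i\<in>Field r. comp NF w (c i) = c i)"
    using X c unfolding colimit_def by blast
  have I: "ident NF X \<in> hom NF X X" using nf.ident_hom c by (simp add: cocone_def)
  have "\<forall>i\<in>Field r. comp NF (comp NF u v) (c i) = c i"
    using nf.comp_assoc[OF XC(1) v(1) u(1)] u(2) v(2) by simp
  then have uv: "comp NF u v = ident NF X"
    using X1 I nf.comp_hom[OF v(1) u(1)] nf.ident_comp[OF XC(1)] by metis
  note uh = NF_homD[OF u(1)] and vh = NF_homD[OF v(1)]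
  have "rng (comp C (lower u) (lower v)) = univ (fst X)" "rng (comp C (upper u) (upper v)) = univ (tg X)"
    unfolding NF_comp(2,3)[OF v(1) u(1), symmetric] uv NF_ident ident_cat_of by (rule rng_inclusion)+
  then have s: "univ (fst X) = rng (lower u)" "univ (tg X) = rng (upper u)"
    using rng_comp_subset[OF vh(4) uh(4)] rng_comp_subset[OF vh(5) uh(5)] homD(9)[OF uh(4)] homD(9)[OF uh(5)]
    by auto
  have "rng (lower (c i)) = app (lower u) ` rng (lower (e i))" "rng (upper (c i)) = app (upper u) ` rng (upper (e i))"
    if i: "i \<in> Field r" for i
    using NF_homD(4,5)[OF YC(1)[OF i]] NF_comp(2,3)[OF YC(1)[OF i] u(1)] u(2)[OF i]
      rng_comp[OF _ uh(4)] rng_comp[OF _ uh(5)] by metis+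
  then show ?thesis
    using s e(2) homD(8)[OF uh(4)] homD(8)[OF uh(5)] unfolding covers_def by (auto simp: image_UN)
qed

text \<open>The colimit is covered by the diagram, so both parts of a morphism from a small object land in one
stage, and there the morphism factors.\<close>

lemma NF_presentable:
  fixes lam :: "'v rel"
  assumes lam: "mu \<le>o lam" "theta \<le>o lam" and A: "A \<in> arr C" "|univ (tg A)| <o lam"
  shows "presentable NF lam A"
  unfolding presentable_def NF_obj
proof (intro conjI allI impI)
  show "A \<in> arr C" by (rule A(1))
  fix r :: "'v rel" and D d X c
  assume r: "directed_poset lam r" and d: "diagram NF r D d" and X: "colimit NF r D d X c"
  have c: "cocone NF r D d X c" using X by (simp add: colimit_def)
  note rmu = directed_mono[OF r lam(1)]
  note D = NF_diagramD[OF d] and XC = NF_coconeD[OF c d] and F = directed_posetD(3,4)[OF r]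
  have cov: "univ (fst X) = (\<Union>i\<in>Field r. rng (lower (c i)))" "univ (tg X) = (\<Union>i\<in>Field r. rng (upper (c i)))"
    using NF_colimit_covers[OF lam r d X] by (auto simp: covers_def)
  have Ah: "A \<in> hom C (fst A) (tg A)" using A(1) arr_iff by blast
  have "|univ (fst A)| \<le>o |univ (tg A)|"
    by (rule card_of_ordLeqI[OF homD(3)[OF Ah] app_in[OF Ah]])
  then have A1: "|univ (fst A)| <o lam" using A(2) ordLeq_ordLess_trans by blast
  note m1 = cocone_rng_mono[OF rmu D(3) XC(4)] and m2 = cocone_rng_mono[OF rmu D(4) XC(5)]
  show "\<forall>f\<in>hom NF A X. \<exists>i\<in>Field r. \<exists>g\<in>hom NF A (D i). comp NF (c i) g = f"
  proof
    fix f assume f: "f \<in> hom NF A X"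
    note fh = NF_homD[OF f]
    obtain i where i: "i \<in> Field r" "rng (lower f) \<subseteq> rng (lower (c i))"
    proof (rule directed_cover[OF r, of "rng (lower f)" "\<lambda>i. rng (lower (c i))"])
      show "|rng (lower f)| <o lam" unfolding homD(8)[OF fh(4)] using A1 card_of_image ordLeq_ordLess_trans by blast
      show "\<exists>i\<in>Field r. x \<in> rng (lower (c i))" if "x \<in> rng (lower f)" for x
        using that homD(9)[OF fh(4)] cov(1) by blast
    qed (rule m1)
    obtain j where j: "j \<in> Field r" "rng (upper f) \<subseteq> rng (upper (c j))"
    proof (rule directed_cover[OF r, of "rng (upper f)" "\<lambda>i. rng (upper (c i))"])
      show "|rng (upper f)| <o lam" unfolding homD(8)[OF fh(5)] using A(2) card_of_image ordLeq_ordLess_trans by blast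
      show "\<exists>i\<in>Field r. x \<in> rng (upper (c i))" if "x \<in> rng (upper f)" for x
        using that homD(9)[OF fh(5)] cov(2) by blast
    qed (rule m2)
    obtain k where k: "(i, k) \<in> r" "(j, k) \<in> r" using directed_two[OF rmu i(1) j(1)] by blast
    have "rng (lower f) \<subseteq> rng (lower (c k))" "rng (upper f) \<subseteq> rng (upper (c k))"
      using i(2) j(2) m1[OF k(1)] m2[OF k(2)] by blast+
    then obtain g where "g \<in> hom NF A (D k)" "comp NF (c k) g = f"
      by (rule NF_factor[OF f XC(1)[OF F(2)[OF k(1)]]])
    then show "\<exists>i\<in>Field r. \<exists>g\<in>hom NF A (D i). comp NF (c i) g = f" using F(2)[OF k(1)] by blast
  qed
  show "\<forall>i\<in>Field r. \<forall>j\<in>Field r. \<forall>g\<in>hom NF A (D i). \<forall>h\<in>hom NF A (D j).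
     comp NF (c i) g = comp NF (c j) h \<longrightarrow>
     (\<exists>k. (i, k) \<in> r \<and> (j, k) \<in> r \<and> comp NF (d i k) g = comp NF (d j k) h)"
  proof (intro ballI impI)
    fix i j g h assume ij: "i \<in> Field r" "j \<in> Field r" and g: "g \<in> hom NF A (D i)" and h: "h \<in> hom NF A (D j)"
      and e: "comp NF (c i) g = comp NF (c j) h"
    obtain k where k: "(i, k) \<in> r" "(j, k) \<in> r" using directed_two[OF rmu ij] by blast
    have kF: "k \<in> Field r" by (rule F(2)[OF k(1)])
    have "comp NF (c k) (comp NF (d i k) g) = comp NF (c k) (comp NF (d j k) h)"
      using nf.comp_assoc[OF g D(1)[OF k(1)] XC(1)[OF kF]] nf.comp_assoc[OF h D(1)[OF k(2)] XC(1)[OF kF]]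
        XC(3)[OF k(1)] XC(3)[OF k(2)] e by simp
    then have "comp NF (d i k) g = comp NF (d j k) h"
      by (rule NF_mono[OF nf.comp_hom[OF g D(1)[OF k(1)]] nf.comp_hom[OF h D(1)[OF k(2)]] XC(1)[OF kF]])
    then show "\<exists>k. (i, k) \<in> r \<and> (j, k) \<in> r \<and> comp NF (d i k) g = comp NF (d j k) h" using k by blast
  qed
qed

end

section \<open>Small independent squares generate\<close>

lemma card_of_Pow_mono:
  assumes "|A| \<le>o |B|" shows "|Pow A| \<le>o |Pow B|"
proof -
  obtain f where "inj_on f A" "f ` A \<subseteq> B" using assms unfolding card_of_ordLeq[symmetric] by blast
  then have "inj_on (image f) (Pow A)" "image f ` Pow A \<subseteq> Pow B"
    by (auto simp: inj_on_image_Pow)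
  then show ?thesis unfolding card_of_ordLeq[symmetric] by blast
qed

lemma card_of_PiE_le_Pow:
  assumes Z: "infinite Z" and I: "|I| \<le>o |Z|" and A: "|A| \<le>o |Pow Z|"
  shows "|I \<rightarrow>\<^sub>E A| \<le>o |Pow Z|"
proof -
  obtain e where e: "inj_on e A" "e ` A \<subseteq> Pow Z" using A unfolding card_of_ordLeq[symmetric] by blast
  let ?f = "\<lambda>f. SIGMA i:I. e (f i)"
  have "inj_on ?f (I \<rightarrow>\<^sub>E A)"
  proof (rule inj_onI)
    fix f g assume f: "f \<in> I \<rightarrow>\<^sub>E A" and g: "g \<in> I \<rightarrow>\<^sub>E A" and fg: "?f f = ?f g"
    show "f = g"
    proof (rule PiE_ext[OF f g])
      fix i assume i: "i \<in> I"
      have "e (f i) = ?f f `` {i}" "e (g i) = ?f g `` {i}" using i by auto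
      then have "e (f i) = e (g i)" using fg by simp
      then show "f i = g i" using inj_onD[OF e(1)] f g i by (auto simp: PiE_iff)
    qed
  qed
  moreover have "?f ` (I \<rightarrow>\<^sub>E A) \<subseteq> Pow (I \<times> Z)" using e(2) by (auto simp: PiE_iff)
  ultimately have "|I \<rightarrow>\<^sub>E A| \<le>o |Pow (I \<times> Z)|" unfolding card_of_ordLeq[symmetric] by blast
  moreover have "|I \<times> Z| \<le>o |Z|"
    by (rule card_of_Sigma_ordLeq_infinite[OF Z I]) (simp add: ordLeq_reflexive card_of_Well_order)
  ultimately show ?thesis using card_of_Pow_mono ordLeq_transitive by blast
qed

lemma card_of_Un_le: "infinite W \<Longrightarrow> |A| \<le>o |W| \<Longrightarrow> |B| \<le>o |W| \<Longrightarrow> |A \<union> B| \<le>o |W|"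
  using card_of_Un_ordLeq_infinite_Field[of "|W|" A B] card_of_Card_order[of W] by (simp add: Field_card_of)

lemma card_of_image_le: "|A| \<le>o |W| \<Longrightarrow> |f ` A| \<le>o |W|"
  using card_of_image ordLeq_transitive by blast

lemma card_of_subset_le: "A \<subseteq> B \<Longrightarrow> |B| \<le>o |W| \<Longrightarrow> |A| \<le>o |W|"
  using card_of_mono1 ordLeq_transitive by blast

text \<open>A cardinal of the form \<open>|Pow Z|\<close> with \<open>|Z| \<ge> mu\<close> is its own power \<open><mu\<close>, so the Loewenheim-Skolem
axiom finds submodels of at most this size around all sets of at most this size.\<close>

lemma (in mu_aec) LST_Pow:
  obtains Z0 :: "'v set" where "|Z0| <o \<V>"
    "\<And>Z M A. Z0 \<subseteq> Z \<Longrightarrow> Field mu \<subseteq> Z \<Longrightarrow> M \<in> models K \<Longrightarrow> A \<subseteq> univ M \<Longrightarrow> |A| \<le>o |Pow Z| \<Longrightarrow>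
      \<exists>M0. (M0, M) \<in> leK K \<and> A \<subseteq> univ M0 \<and> |univ M0| \<le>o |Pow (Z :: 'v set)|"
proof -
  have "LST_axiom mu K" using aec by (simp add: mu_AEC_def)
  then obtain lam :: "'v rel" where L: "is_cardinal lam \<and> |seqs_less mu (Field lam)| =o lam \<and>
      |fsym (voc K) <+> rsym (voc K)| +c mu \<le>o lam \<and>
      (\<forall>M \<in> models K. \<forall>A \<subseteq> univ M. \<exists>M0. (M0, M) \<in> leK K \<and> A \<subseteq> univ M0 \<and>
         |univ M0| \<le>o |seqs_less mu A| +c lam)"
    unfolding LST_axiom_def by (rule exE)
  then have lam: "is_cardinal lam" by (rule conjunct1)
  have lst: "\<exists>M0. (M0, M) \<in> leK K \<and> A \<subseteq> univ M0 \<and> |univ M0| \<le>o |seqs_less mu A| +c lam"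
    if "M \<in> models K" "A \<subseteq> univ M" for M A
    using L[THEN conjunct2, THEN conjunct2, THEN conjunct2] that by blast
  show thesis
  proof (rule that[of "Field lam"])
    show "|Field lam| <o \<V>" using lam by (simp add: is_cardinal_def small_def)
    fix Z :: "'v set" and M A
    assume Z: "Field lam \<subseteq> Z" "Field mu \<subseteq> Z" and M: "M \<in> models K" "A \<subseteq> univ M" and A: "|A| \<le>o |Pow Z|"
    have Zi: "infinite Z" "infinite (Pow Z)" using Z(2) mu_card(2) finite_subset by auto
    have "|seqs_less mu A| \<le>o |Pow Z|"
      unfolding seqs_less_def
    proof (rule card_of_Sigma_ordLeq_infinite[OF Zi(2)], safe)
      show "|Field mu| \<le>o |Pow Z|"
        by (rule card_of_subset_le[OF Z(2)]) (simp add: card_of_Pow ordLess_imp_ordLeq)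
      fix i assume "i \<in> Field mu"
      have "underS mu i \<subseteq> Z" using Z(2) by (auto simp: underS_def Field_def)
      then show "|underS mu i \<rightarrow>\<^sub>E A| \<le>o |Pow Z|"
        by (intro card_of_PiE_le_Pow[OF Zi(1) card_of_mono1 A])
    qed
    moreover have "|Field lam| \<le>o |Pow Z|"
      by (rule card_of_subset_le[OF Z(1)]) (simp add: card_of_Pow ordLess_imp_ordLeq)
    ultimately have "|seqs_less mu A| +c lam \<le>o |Pow Z|"
      unfolding csum_def Field_card_of
      using card_of_Plus_ordLeq_infinite_Field[of "|Pow Z|" "seqs_less mu A" "Field lam"]
        card_of_Card_order[of "Pow Z"] Zi(2) by (simp add: Field_card_of)
    then show "\<exists>M0. (M0, M) \<in> leK K \<and> A \<subseteq> univ M0 \<and> |univ M0| \<le>o |Pow Z|"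
      using lst[OF M] ordLeq_transitive by blast
  qed
qed

context witnessed_independence
begin

text \<open>Iterate, along the regular cardinal \<open>l\<close>, the operation that adds to a subset of the target the bases of all short sequences from it.  In the
  union every subset of size less than \<open>theta\<close> appears at some stage, hence is free over a base that
  was added at that stage, and the witness property applies.\<close>

lemma small_independent_subsquare:
  fixes Z :: "'v set" and l :: "'v rel"
  assumes Z: "infinite Z" "|Field theta| \<le>o |Z|"
    and lst: "\<And>M A. M \<in> models K \<Longrightarrow> A \<subseteq> univ M \<Longrightarrow> |A| \<le>o |Pow Z| \<Longrightarrow>
      \<exists>M0. (M0, M) \<in> leK K \<and> A \<subseteq> univ M0 \<and> |univ M0| \<le>o |Pow Z|"
    and l: "regular_cardinal l" "mu \<le>o l" "theta \<le>o l" "|Field l| \<le>o |Pow Z|"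
    and X: "X \<in> hom C M N"
    and base: "\<And>a. a \<in> Field theta \<rightarrow>\<^sub>E univ N \<Longrightarrow>
      \<exists>M0. (M0, M) \<in> leK K \<and> |univ M0| \<le>o |Pow Z| \<and> free (inclusion M0 M) X (a ` Field theta)"
    and B: "B \<subseteq> univ N" "|B| \<le>o |Pow Z|"
  obtains M' N' x where "(M', M) \<in> leK K" "(N', N) \<in> leK K" "x \<in> hom C M' N'"
    "ind x (inclusion M' M) (inclusion N' N) X" "B \<subseteq> univ N'"
    "{m \<in> univ M. app X m \<in> B} \<subseteq> univ M'" "|univ N'| \<le>o |Pow Z|"
proof -
  let ?W = "Pow Z"
  have W: "infinite ?W" using Z(1) by simp
  obtain G where G: "\<And>a. a \<in> Field theta \<rightarrow>\<^sub>E univ N \<Longrightarrow> (G a, M) \<in> leK K \<and> |univ (G a)| \<le>o |?W| \<and>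
      free (inclusion (G a) M) X (a ` Field theta)" using base by metis
  \<comment> \<open>The closure conditions that one step of the iteration achieves for the set \<open>E\<close>.\<close>
  define good where "good E M' N' \<longleftrightarrow> (M', M) \<in> leK K \<and> (N', N) \<in> leK K \<and> |univ N'| \<le>o |?W| \<and>
      E \<subseteq> univ N' \<and> app X ` univ M' \<subseteq> univ N' \<and> {m \<in> univ M. app X m \<in> E} \<subseteq> univ M' \<and>
      (\<forall>a\<in>Field theta \<rightarrow>\<^sub>E E. univ (G a) \<subseteq> univ M')" for E M' N'
  have step: "\<exists>M' N'. good E M' N'" if E: "E \<subseteq> univ N" "|E| \<le>o |?W|" for E
  proof -
    let ?P = "{m \<in> univ M. app X m \<in> E}" and ?S = "Field theta \<rightarrow>\<^sub>E E"
    have S: "?S \<subseteq> Field theta \<rightarrow>\<^sub>E univ N" using E(1) by (rule PiE_mono)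
    have "|?P| \<le>o |E|"
      by (rule card_of_ordLeqI[of "app X"]) (use homD(3)[OF X] in \<open>auto simp: inj_on_def\<close>)
    then have P: "|?P| \<le>o |?W|" using E(2) ordLeq_transitive by blast
    have "|\<Union>a\<in>?S. univ (G a)| \<le>o |?W|"
      by (rule card_of_UNION_ordLeq_infinite[OF W card_of_PiE_le_Pow[OF Z E(2)]]) (use G S in blast)
    then have 1: "|?P \<union> (\<Union>a\<in>?S. univ (G a))| \<le>o |?W|" by (rule card_of_Un_le[OF W P])
    have 2: "?P \<union> (\<Union>a\<in>?S. univ (G a)) \<subseteq> univ M" using G S leK_univ by blast
    obtain M' where M': "(M', M) \<in> leK K" "?P \<union> (\<Union>a\<in>?S. univ (G a)) \<subseteq> univ M'" "|univ M'| \<le>o |?W|"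
      using lst[OF homD(1)[OF X] 2 1] by blast
    have 3: "|E \<union> app X ` univ M'| \<le>o |?W|" by (rule card_of_Un_le[OF W E(2) card_of_image_le[OF M'(3)]])
    have 4: "E \<union> app X ` univ M' \<subseteq> univ N" using E(1) app_in[OF X] leK_univ[OF M'(1)] by blast
    obtain N' where "(N', N) \<in> leK K" "E \<union> app X ` univ M' \<subseteq> univ N'" "|univ N'| \<le>o |?W|"
      using lst[OF homD(2)[OF X] 4 3] by blast
    then have "good E M' N'" unfolding good_def using M' by blast
    then show ?thesis by blast
  qed
  then obtain Mf Nf where f: "\<And>E. E \<subseteq> univ N \<Longrightarrow> |E| \<le>o |?W| \<Longrightarrow> good E (Mf E) (Nf E)" by metis
  \<comment> \<open>Stage \<open>j\<close> collects \<open>B\<close> and the targets produced at all earlier stages.\<close>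
  define P where "P F j Q \<longleftrightarrow> (j \<in> Field l \<longrightarrow> Q = B \<union> (\<Union>i\<in>{i. (i, j) \<in> l - Id}. univ (Nf (F i))) \<and>
      Q \<subseteq> univ N \<and> |Q| \<le>o |?W| )" for F j Q
  have "\<exists>E. \<forall>j. P E j (E j)"
  proof (rule dependent_wf_choice)
    show "wf (l - Id)" using regular_cardinalD(2)[OF l(1)] by (simp add: well_order_on_def)
    show "P F j Q = P F' j Q" if "\<And>z. (z, j) \<in> l - Id \<Longrightarrow> F z = F' z" for F F' j Q
      unfolding P_def using that by auto
    show "\<exists>Q. P F j Q" if IH: "\<And>i. (i, j) \<in> l - Id \<Longrightarrow> P F i (F i)" for j F
    proof -
      let ?I = "{i. (i, j) \<in> l - Id}" 
      have sub: "?I \<subseteq> Field l" by (auto simp: Field_def)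
      have g: "good (F i) (Mf (F i)) (Nf (F i))" if "i \<in> ?I" for i
        using f[of "F i"] IH[of i] that sub unfolding P_def by blast
      have "|\<Union>i\<in>?I. univ (Nf (F i))| \<le>o |?W|"
        by (rule card_of_UNION_ordLeq_infinite[OF W card_of_subset_le[OF sub l(4)]])
          (use g in \<open>simp add: good_def\<close>)
      then have "|B \<union> (\<Union>i\<in>?I. univ (Nf (F i)))| \<le>o |?W|" by (rule card_of_Un_le[OF W B(2)])
      moreover have "(\<Union>i\<in>?I. univ (Nf (F i))) \<subseteq> univ N" using g leK_univ unfolding good_def by blast
      ultimately show ?thesis unfolding P_def using B(1) by blast
    qed
  qed
  then obtain E where E: "\<And>j. P E j (E j)" by blast
  have E_sub: "B \<subseteq> E j" "E j \<subseteq> univ N" "|E j| \<le>o |?W|" if "j \<in> Field l" for j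
    using E[of j] that unfolding P_def by auto
  have E_step: "univ (Nf (E i)) \<subseteq> E j" if "(i, j) \<in> l" "i \<noteq> j" for i j
    using E[of j] that FieldI2[OF that(1)] unfolding P_def by auto
  let ?M = "\<lambda>i. Mf (E i)" and ?N = "\<lambda>i. Nf (E i)"
  have g: "good (E i) (?M i) (?N i)" if "i \<in> Field l" for i using f E_sub[OF that] by blast
  have M_le: "(?M i, M) \<in> leK K" and N_le: "(?N i, N) \<in> leK K" and N_card: "|univ (?N i)| \<le>o |?W|"
    and E_N: "E i \<subseteq> univ (?N i)" and XMN: "app X ` univ (?M i) \<subseteq> univ (?N i)"
    and pre: "{m \<in> univ M. app X m \<in> E i} \<subseteq> univ (?M i)"
    and GM: "\<And>a. a \<in> Field theta \<rightarrow>\<^sub>E E i \<Longrightarrow> univ (G a) \<subseteq> univ (?M i)"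
    if "i \<in> Field l" for i using g[OF that] unfolding good_def by blast+
  note F = FieldI1 FieldI2
  have N_mono: "univ (?N i) \<subseteq> univ (?N j)" if ij: "(i, j) \<in> l" for i j
    using E_step[OF ij] E_N[OF F(2)[OF ij]] by (cases "i = j") auto
  \<comment> \<open>The sources increase because each contains the preimage of its stage under \<open>X\<close>.\<close>
  have M_mono: "univ (?M i) \<subseteq> univ (?M j)" if ij: "(i, j) \<in> l" for i j
  proof (cases "i = j")
    case False
    show ?thesis
    proof
      fix m assume m: "m \<in> univ (?M i)"
      then have "app X m \<in> E j" using XMN[OF F(1)[OF ij]] E_step[OF ij False] by blast
      moreover have "m \<in> univ M" using m leK_univ[OF M_le[OF F(1)[OF ij]]] by blast
      ultimately show "m \<in> univ (?M j)" using pre[OF F(2)[OF ij]] by blast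
    qed
  qed simp
  note dl = regular_directed[OF l(1)]
  note dmu = directed_mono[OF dl l(2)] and dth = directed_mono[OF dl l(3)]
  obtain M' where M': "(M', M) \<in> leK K" "univ M' = (\<Union>i\<in>Field l. univ (?M i))"
    "\<And>i. i \<in> Field l \<Longrightarrow> (?M i, M') \<in> leK K"
    using directed_union_within[OF dmu, of ?M M, OF M_le M_mono] by metis
  obtain N' where N': "(N', N) \<in> leK K" "univ N' = (\<Union>i\<in>Field l. univ (?N i))"
    using directed_union_within[OF dmu, of ?N N, OF N_le N_mono] by metis
  note ihM = inclusion_hom[OF M'(1)] and ihN = inclusion_hom[OF N'(1)]
  have XM: "comp C X (inclusion M' M) \<in> hom C M' N" by (rule comp_hom[OF ihM X])
  have "rng (comp C X (inclusion M' M)) \<subseteq> rng (inclusion N' N)"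
    unfolding rng_comp[OF ihM X] rng_inclusion M'(2) N'(2) image_UN by (rule UN_mono[OF subset_refl XMN])
  then obtain x where x: "x \<in> hom C M' N'" "comp C (inclusion N' N) x = comp C X (inclusion M' M)"
    by (rule factor[OF XM ihN])
  have "ind x (inclusion M' M) (inclusion N' N) X"
  proof (rule free_witness[OF x(1) ihM ihN X x(2)])
    fix A assume A: "A \<subseteq> univ N'" "|A| <o theta"
    have A_eq: "app (inclusion N' N) ` A = A" using A(1) by (force simp: image_iff)
    show "free (inclusion M' M) X (app (inclusion N' N) ` A)"
    proof (cases "A = {}")
      case True
      then show ?thesis using free_empty[OF ihM X] by simp
    next
      case False
      obtain i where i: "i \<in> Field l" "A \<subseteq> univ (?N i)"
      proof (rule directed_cover[OF dth A(2), of "\<lambda>i. univ (?N i)"])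
        show "\<exists>i\<in>Field l. x \<in> univ (?N i)" if "x \<in> A" for x using that A(1) N'(2) by blast
      qed (rule N_mono)
      obtain j where j: "i \<noteq> j" "(i, j) \<in> l" "j \<in> Field l"
        using infinite_Card_order_limit[OF regular_cardinalD(1,3)[OF l(1)] i(1)] by blast
      have "Card_order theta" using theta by (simp add: infinite_cardinal_def is_cardinal_def)
      then have "|A| \<le>o |Field theta|"
        using A(2) card_of_Field_ordIso ordLess_imp_ordLeq ordIso_symmetric ordLeq_ordIso_trans by blast
      then obtain s where s: "s ` Field theta = A"
        unfolding card_of_ordLeq2[OF False, symmetric] by (rule exE)
      let ?a = "restrict s (Field theta)"
      have a: "?a \<in> Field theta \<rightarrow>\<^sub>E E j" "?a ` Field theta = A" using s i(2) E_step[OF j(2,1)] by auto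
      have "?a \<in> Field theta \<rightarrow>\<^sub>E univ N" using a(1) E_sub(2)[OF j(3)] by auto
      then have Ga: "(G ?a, M) \<in> leK K" "free (inclusion (G ?a) M) X A" using G[of ?a] a(2) by auto
      have "univ (G ?a) \<subseteq> univ M'" using GM[OF j(3) a(1)] M'(2) j(3) by blast
      then have le: "(G ?a, M') \<in> leK K" by (rule leK_within[OF Ga(1) M'(1)])
      have "free (comp C (inclusion M' M) (inclusion (G ?a) M')) X A"
        using Ga(2) inclusion_comp[OF le M'(1)] by simp
      then have "free (inclusion M' M) X A"
        by (rule free_base_mono[OF _ _ inclusion_hom[OF le] ihM X]) (use A(1) leK_univ[OF N'(1)] in blast)
      then show ?thesis using A_eq by simp
    qed
  qed
  moreover obtain i0 where i0: "i0 \<in> Field l" using directed_nonempty[OF dmu] by blast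
  have "B \<subseteq> univ N'" using E_sub(1)[OF i0] E_N[OF i0] N'(2) i0 by blast
  moreover have "{m \<in> univ M. app X m \<in> B} \<subseteq> univ M'" using pre[OF i0] E_sub(1)[OF i0] M'(2) i0 by blast
  moreover have "|univ N'| \<le>o |?W|"
    unfolding N'(2) by (rule card_of_UNION_ordLeq_infinite[OF W l(4)]) (use N_card in blast)
  ultimately show thesis using that[OF M'(1) N'(1) x(1)] by blast
qed

end

section \<open>Accessibility\<close>

context mu_aec
begin

text \<open>A structure is determined by its universe and the graphs of its interpretations, and inaccessibility
bounds the number of these.\<close>

lemma vsmall_structures:
  assumes V: "|V| <o \<V>"
  shows "|{M \<in> models K. univ M \<subseteq> V}| <o \<V>"
proof (rule vsmall_inj)
  let ?tau = "voc K"
  let ?F = "\<lambda>M. (univ M, restrict (fint M) (fsym ?tau), restrict (rint M) (rsym ?tau))"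
  let ?T = "Pow V \<times> (\<Pi>\<^sub>E s\<in>fsym ?tau. \<Union>U\<in>Pow V. (farity ?tau s \<rightarrow>\<^sub>E U) \<rightarrow>\<^sub>E U) \<times>
      (\<Pi>\<^sub>E s\<in>rsym ?tau. Pow (rarity ?tau s \<rightarrow>\<^sub>E V))"
  have ar: "mu_ary mu ?tau" using abs_class by (simp add: abstract_class_def)
  have U: "|U| <o \<V>" if "U \<in> Pow V" for U using vsmall_subset[OF _ V] that by blast
  have s: "|fsym ?tau| <o \<V>" "|rsym ?tau| <o \<V>"
    "\<And>s. s \<in> fsym ?tau \<Longrightarrow> |farity ?tau s| <o \<V>"
    "\<And>s. s \<in> rsym ?tau \<Longrightarrow> |rarity ?tau s| <o \<V>"
    using ar vsmall_less_mu by (auto simp: mu_ary_def small_def)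
  show "|?T| <o \<V>"
    by (intro vsmall_Sigma vsmall_PiE vsmall_UN vsmall_Pow V U s)
  show "inj_on ?F {M \<in> models K. univ M \<subseteq> V}"
  proof (rule inj_onI)
    fix M N assume M: "M \<in> {M \<in> models K. univ M \<subseteq> V}" and N: "N \<in> {M \<in> models K. univ M \<subseteq> V}"
      and e: "?F M = ?F N"
    have ms: "is_struct ?tau M" "is_struct ?tau N" using M N model_struct by auto
    show "M = N"
    proof (rule struct_eqI[OF ms])
      show "univ M = univ N" using e by simp
      show "fint M s t = fint N s t" if "s \<in> fsym ?tau" for s t
        using e that by (metis prod.inject restrict_apply')
      show "t \<in> rint M s \<longleftrightarrow> t \<in> rint N s" if "s \<in> rsym ?tau" for s t
        using e that by (metis prod.inject restrict_apply')
    qed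
  qed
  show "?F ` {M \<in> models K. univ M \<subseteq> V} \<subseteq> ?T"
  proof (rule image_subsetI)
    fix M assume M: "M \<in> {M \<in> models K. univ M \<subseteq> V}"
    have ms: "is_struct ?tau M" and MV: "univ M \<subseteq> V" using M model_struct by auto
    have "fint M s \<in> (\<Union>U\<in>Pow V. (farity ?tau s \<rightarrow>\<^sub>E U) \<rightarrow>\<^sub>E U)" if "s \<in> fsym ?tau" for s
      by (rule UN_I[of "univ M"]) (use ms MV that in \<open>auto simp: is_struct_def\<close>)
    moreover have "rint M s \<in> Pow (rarity ?tau s \<rightarrow>\<^sub>E V)" if "s \<in> rsym ?tau" for s
    proof -
      have "rint M s \<subseteq> rarity ?tau s \<rightarrow>\<^sub>E univ M" using ms that by (simp add: is_struct_def)
      also have "\<dots> \<subseteq> rarity ?tau s \<rightarrow>\<^sub>E V" by (rule PiE_mono) (rule MV)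
      finally show ?thesis by blast
    qed
    ultimately show "?F M \<in> ?T" using MV by (simp only: mem_Sigma_iff restrict_PiE_iff) blast
  qed
qed

lemma vsmall_arrows:
  assumes V: "|V| <o \<V>"
  shows "|{A \<in> arr C. univ (fst A) \<subseteq> V \<and> univ (snd (snd A)) \<subseteq> V}| <o \<V>"
proof (rule vsmall_subset)
  let ?M = "{M \<in> models K. univ M \<subseteq> V}"
  show "|?M \<times> (\<Union>U\<in>Pow V. U \<rightarrow>\<^sub>E V) \<times> ?M| <o \<V>"
  proof (intro vsmall_Sigma vsmall_structures V vsmall_UN vsmall_Pow vsmall_PiE)
    show "|U| <o \<V>" if "U \<in> Pow V" for U using vsmall_subset[OF _ V] that by blast
  qed
  show "{A \<in> arr C. univ (fst A) \<subseteq> V \<and> univ (snd (snd A)) \<subseteq> V} \<subseteq> ?M \<times> (\<Union>U\<in>Pow V. U \<rightarrow>\<^sub>E V) \<times> ?M"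
  proof
    fix A assume A: "A \<in> {A \<in> arr C. univ (fst A) \<subseteq> V \<and> univ (snd (snd A)) \<subseteq> V}"
    obtain M f N where e: "A = (M, f, N)" by (cases A)
    have h: "A \<in> hom C M N" using A e by (simp add: hom_def)
    have "f \<in> univ M \<rightarrow>\<^sub>E V"
      using homD(7)[OF h] app_in[OF h] A e by (auto simp: app_def PiE_iff)
    then show "A \<in> ?M \<times> (\<Union>U\<in>Pow V. U \<rightarrow>\<^sub>E V) \<times> ?M" using A e homD(1,2)[OF h] by auto
  qed
qed

lemma copy_within:
  assumes M: "M \<in> models K" "|univ M| \<le>o |V|"
  obtains M' j k where "j \<in> hom C M' M" "k \<in> hom C M M'" "comp C k j = ident C M'" "comp C j k = ident C M"
    "univ M' \<subseteq> V" "rng j = univ M"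
proof -
  obtain b where b: "inj_on b (univ M)" "b ` univ M \<subseteq> V" using M(2) unfolding card_of_ordLeq[symmetric] by blast
  have i: "iso b M (image b M)" by (rule struct_iso_image[OF model_struct[OF M(1)] b(1)])
  have mod: "image b M \<in> models K" by (rule models_iso[OF M(1) i])
  note a = arrow_hom[OF i M(1) leK_refl[OF mod]]
  obtain j where j: "j \<in> hom C (image b M) M" "comp C j (arrow M b (image b M)) = ident C M"
    "comp C (arrow M b (image b M)) j = ident C (image b M)"
    using surj_iso[OF a(1,3)] by metis
  have "univ M = rng (comp C j (arrow M b (image b M)))" using j(2) by (simp add: ident_cat_of)
  then have "rng j = univ M" using rng_comp_subset[OF a(1) j(1)] homD(9)[OF j(1)] by blast
  then show thesis using that[OF j(1) a(1) j(3,2)] b(2) by simp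
qed

end

context witnessed_independence
begin

text \<open>Independent squares are monic, and they factor as soon as the ranges are nested, so the connecting
  morphisms exist and are compatible with composition.\<close>

lemma subobject_diagram:
  assumes r: "Partial_order r" "Field r \<noteq> {}"
    and c: "\<And>i. i \<in> Field r \<Longrightarrow> c i \<in> hom NF (D i) X"
    and le: "\<And>i j. (i, j) \<in> r \<Longrightarrow> rng (lower (c i)) \<subseteq> rng (lower (c j)) \<and> rng (upper (c i)) \<subseteq> rng (upper (c j))"
  obtains d where "diagram NF r D d" "cocone NF r D d X c"
proof -
  have "\<exists>d. d \<in> hom NF (D i) (D j) \<and> comp NF (c j) d = c i" if ij: "(i, j) \<in> r" for i j
    using NF_factor[OF c[OF FieldI1[OF ij]] c[OF FieldI2[OF ij]]] le[OF ij] by metis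
  then obtain d where d: "\<And>i j. (i, j) \<in> r \<Longrightarrow> d i j \<in> hom NF (D i) (D j)"
    "\<And>i j. (i, j) \<in> r \<Longrightarrow> comp NF (c j) (d i j) = c i" by metis
  have r': "\<And>i. i \<in> Field r \<Longrightarrow> (i, i) \<in> r" "\<And>i j k. (i, j) \<in> r \<Longrightarrow> (j, k) \<in> r \<Longrightarrow> (i, k) \<in> r"
    using r(1) unfolding partial_order_on_def preorder_on_def by (auto dest: transD refl_onD)
  have Do: "D i \<in> obj NF" if "i \<in> Field r" for i by (rule nf.hom_obj(1)[OF c[OF that]])
  have Xo: "X \<in> obj NF" using r(2) nf.hom_obj(2)[OF c] by blast
  have "diagram NF r D d"
    unfolding diagram_def
  proof (intro conjI ballI allI impI)
    fix i assume i: "i \<in> Field r"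
    show "D i \<in> obj NF" by (rule Do[OF i])
    note dii = d(1)[OF r'(1)[OF i]]
    show "d i i = ident NF (D i)"
      by (rule NF_mono[OF dii nf.ident_hom[OF Do[OF i]] c[OF i]])
        (use d(2)[OF r'(1)[OF i]] nf.comp_ident[OF c[OF i]] in simp)
  next
    fix i j k assume ij: "(i, j) \<in> r" and jk: "(j, k) \<in> r"
    note ck = c[OF FieldI2[OF jk]]
    show "comp NF (d j k) (d i j) = d i k"
      by (rule NF_mono[OF nf.comp_hom[OF d(1)[OF ij] d(1)[OF jk]] d(1)[OF r'(2)[OF ij jk]] ck])
        (use nf.comp_assoc[OF d(1)[OF ij] d(1)[OF jk] ck] d(2)[OF ij] d(2)[OF jk] d(2)[OF r'(2)[OF ij jk]] in simp)
  qed (rule d(1))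
  moreover have "cocone NF r D d X c" unfolding cocone_def using Xo c d(2) by blast
  ultimately show thesis by (rule that)
qed

text \<open>Independent subsquares up to isomorphism: both models are copied into \<open>V\<close>.\<close>

lemma subsquare_copy_within:
  assumes X: "X \<in> hom C M N"
    and s: "(M', M) \<in> leK K" "(N', N) \<in> leK K" "x \<in> hom C M' N'"
      "ind x (inclusion M' M) (inclusion N' N) X"
    and V: "|univ N'| \<le>o |V|"
  obtains A c where "A \<in> arr C" "univ (fst A) \<subseteq> V" "univ (tg A) \<subseteq> V" "c \<in> hom NF A X"
    "rng (lower c) = univ M'" "rng (upper c) = univ N'"
proof -
  have "|univ M'| \<le>o |univ N'|" by (rule card_of_ordLeqI[OF homD(3)[OF s(3)] app_in[OF s(3)]])
  then have M'V: "|univ M'| \<le>o |V|" by (rule ordLeq_transitive[OF _ V])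
  obtain M2 j1 k1 where j1: "j1 \<in> hom C M2 M'" "k1 \<in> hom C M' M2" "comp C k1 j1 = ident C M2"
    "comp C j1 k1 = ident C M'" "univ M2 \<subseteq> V" "rng j1 = univ M'"
    by (rule copy_within[OF leK_models(1)[OF s(1)] M'V])
  obtain N2 j2 k2 where j2: "j2 \<in> hom C N2 N'" "k2 \<in> hom C N' N2" "comp C k2 j2 = ident C N2"
    "comp C j2 k2 = ident C N'" "univ N2 \<subseteq> V" "rng j2 = univ N'"
    by (rule copy_within[OF leK_models(1)[OF s(2)] V])
  let ?x = "comp C k2 (comp C x j1)"
  have xj: "comp C x j1 \<in> hom C M2 N'" by (rule comp_hom[OF j1(1) s(3)])
  have xh: "?x \<in> hom C M2 N2" by (rule comp_hom[OF xj j2(2)])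
  have sq: "comp C j2 ?x = comp C x j1"
    using comp_assoc[OF xj j2(2,1)] j2(4) ident_comp[OF xj] by simp
  have "ind ?x j1 j2 x" by (rule ind_iso[OF xh j1(1) j2(1) s(3) sq j2(2,3) j1(2,3,4)])
  note i = right_trans[OF this s(4)]
  let ?c = "(?x, comp C (inclusion M' M) j1, comp C (inclusion N' N) j2, X)"
  have ch: "?c \<in> hom NF ?x X" by (rule NF_homI[OF i])
  have "?x \<in> arr C" "univ (fst ?x) \<subseteq> V" "univ (tg ?x) \<subseteq> V"
    using hom_arr[OF xh] homD(6,10)[OF xh] j1(5) j2(5) by simp_all
  moreover have "rng (lower ?c) = univ M'" "rng (upper ?c) = univ N'"
    using rng_comp[OF j1(1) inclusion_hom[OF s(1)]] rng_comp[OF j2(1) inclusion_hom[OF s(2)]] j1(6) j2(6)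
    by (auto simp: image_iff)
  ultimately show thesis using that[OF _ _ _ ch] by blast
qed

text \<open>\<open>X\<close> is the colimit of its subobjects from \<open>S\<close>.  They cover \<open>X\<close>, and fewer than \<open>lam\<close> of them have
an upper bound, since the union of their upper ranges has size at most \<open>|W|\<close>.  Requiring the
preimage of \<open>B\<close> in the lower range makes the lower ranges increase along with the upper ones.\<close>

lemma generated_by_subobjects:
  fixes lam :: "'v rel"
  assumes lam_le: "mu \<le>o lam" "theta \<le>o lam" and W: "infinite W"
    and lam: "\<And>B :: 'v set. |B| <o lam \<Longrightarrow> |B| \<le>o |W|"
    and X: "X \<in> arr C" and S_card: "\<And>A. A \<in> S \<Longrightarrow> |univ (tg A)| \<le>o |W|"
    and cofinal: "\<And>B. B \<subseteq> univ (tg X) \<Longrightarrow> |B| \<le>o |W| \<Longrightarrow>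
      \<exists>A\<in>S. \<exists>c\<in>hom NF A X. B \<subseteq> rng (upper c) \<and> {m \<in> univ (fst X). app X m \<in> B} \<subseteq> rng (lower c)"
  shows "\<exists>(r :: 'v rel) D d c. directed_poset lam r \<and> diagram NF r D d \<and> (\<forall>i \<in> Field r. D i \<in> S) \<and>
    colimit NF r D d X c"
proof -
  have Xh: "X \<in> hom C (fst X) (tg X)" using X arr_iff by blast
  \<comment> \<open>Subobjects are given by their ranges, so that there is only a small set of them.\<close>
  define T where "T = {p. \<exists>A c. A \<in> S \<and> c \<in> hom NF A X \<and> p = (rng (lower c), rng (upper c))}"
  have TI: "(rng (lower c), rng (upper c)) \<in> T" if "A \<in> S" "c \<in> hom NF A X" for A c
    unfolding T_def using that by blast
  have "T \<subseteq> Pow (univ (fst X)) \<times> Pow (univ (tg X))"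
  proof
    fix p assume "p \<in> T"
    then obtain A c where c: "c \<in> hom NF A X" "p = (rng (lower c), rng (upper c))"
      unfolding T_def by blast
    show "p \<in> Pow (univ (fst X)) \<times> Pow (univ (tg X))"
      using homD(9)[OF NF_homD(4)[OF c(1)]] homD(9)[OF NF_homD(5)[OF c(1)]] c(2) by simp
  qed
  moreover have "|Pow (univ (fst X)) \<times> Pow (univ (tg X))| <o \<V>"
    by (intro vsmall_Sigma vsmall_Pow model_small homD(1,2)[OF Xh])
  ultimately have Ts: "|T| <o \<V>" by (rule vsmall_subset)
  then obtain q :: "'v set \<times> 'v set \<Rightarrow> 'v" where q: "inj_on q T" by (rule vsmall_code)
  \<comment> \<open>The inclusion order on \<open>T\<close>, transported to the universe along the code \<open>q\<close>.\<close>
  define r where "r = {(q s, q t) | s t. s \<in> T \<and> t \<in> T \<and> fst s \<subseteq> fst t \<and> snd s \<subseteq> snd t}"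
  have F: "Field r = q ` T"
  proof
    show "q ` T \<subseteq> Field r"
    proof (rule image_subsetI)
      fix s assume "s \<in> T"
      then have "(q s, q s) \<in> r" unfolding r_def by blast
      then show "q s \<in> Field r" by (rule FieldI1)
    qed
    show "Field r \<subseteq> q ` T" unfolding r_def Field_def by blast
  qed
  define g where "g = inv_into T q"
  have g: "g i \<in> T" "q (g i) = i" if "i \<in> Field r" for i
    using that unfolding F g_def by (auto simp: inv_into_into f_inv_into_f)
  have gq: "g (q s) = s" if "s \<in> T" for s using q that by (simp add: g_def)
  have r_iff: "(i, j) \<in> r \<longleftrightarrow> i \<in> Field r \<and> j \<in> Field r \<and> fst (g i) \<subseteq> fst (g j) \<and> snd (g i) \<subseteq> snd (g j)" for i j
  proof
    assume "(i, j) \<in> r"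
    then show "i \<in> Field r \<and> j \<in> Field r \<and> fst (g i) \<subseteq> fst (g j) \<and> snd (g i) \<subseteq> snd (g j)"
      unfolding F unfolding r_def using gq by auto
  next
    assume a: "i \<in> Field r \<and> j \<in> Field r \<and> fst (g i) \<subseteq> fst (g j) \<and> snd (g i) \<subseteq> snd (g j)"
    then have "g i \<in> T" "g j \<in> T" using g(1) by blast+
    then have "(q (g i), q (g j)) \<in> r" using a unfolding r_def mem_Collect_eq by blast
    then show "(i, j) \<in> r" using g(2) a by simp
  qed
  have po: "Partial_order r"
    unfolding partial_order_on_def preorder_on_def
  proof (intro conjI)
    show "r \<subseteq> Field r \<times> Field r" by (auto simp: r_iff)
    show "Refl r" by (auto simp: refl_on_def r_iff)
    show "Relation.trans r" by (rule transI) (auto simp: r_iff)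
    show "antisym r"
    proof (rule antisymI)
      fix i j assume "(i, j) \<in> r" "(j, i) \<in> r"
      then have "g i = g j" "i \<in> Field r" "j \<in> Field r" by (auto simp: r_iff prod_eq_iff)
      then show "i = j" using g(2) by metis
    qed
  qed
  have "\<exists>A c. A \<in> S \<and> c \<in> hom NF A X \<and> g i = (rng (lower c), rng (upper c))" if "i \<in> Field r" for i
    using g(1)[OF that] unfolding T_def by blast
  then obtain D c where D: "\<And>i. i \<in> Field r \<Longrightarrow> D i \<in> S" and c: "\<And>i. i \<in> Field r \<Longrightarrow> c i \<in> hom NF (D i) X"
    and gc: "\<And>i. i \<in> Field r \<Longrightarrow> g i = (rng (lower (c i)), rng (upper (c i)))" by metis
  have above: "\<exists>u\<in>Field r. B \<subseteq> rng (upper (c u)) \<and> {m \<in> univ (fst X). app X m \<in> B} \<subseteq> rng (lower (c u))"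
    if B: "B \<subseteq> univ (tg X)" "|B| \<le>o |W|" for B
  proof -
    obtain A a where A: "A \<in> S" "a \<in> hom NF A X" "B \<subseteq> rng (upper a)"
      "{m \<in> univ (fst X). app X m \<in> B} \<subseteq> rng (lower a)" using cofinal[OF B] by blast
    let ?u = "q (rng (lower a), rng (upper a))"
    have u: "?u \<in> Field r" using TI[OF A(1,2)] unfolding F by blast
    have "g ?u = (rng (lower a), rng (upper a))" by (rule gq[OF TI[OF A(1,2)]])
    then show ?thesis using u gc[OF u] A(3,4) by (intro bexI[of _ ?u]) auto
  qed
  have dir: "directed_poset lam r"
    unfolding directed_poset_def
  proof (intro conjI allI impI po)
    show "small (Field r)" unfolding small_def F by (rule vsmall_image[OF Ts])
    fix Y assume Y: "Y \<subseteq> Field r" "|Y| <o lam"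
    let ?B = "\<Union>i\<in>Y. rng (upper (c i))"
    have "|rng (upper (c i))| \<le>o |W|" if i: "i \<in> Y" for i
    proof -
      have iF: "i \<in> Field r" using i Y(1) by blast
      show ?thesis unfolding homD(8)[OF NF_homD(5)[OF c[OF iF]]]
        by (rule card_of_image_le[OF S_card[OF D[OF iF]]])
    qed
    then have B2: "|?B| \<le>o |W|"
      by (intro card_of_UNION_ordLeq_infinite[OF W lam[OF Y(2)]]) blast
    have B1: "?B \<subseteq> univ (tg X)" using homD(9)[OF NF_homD(5)[OF c]] Y(1) by blast
    from above[OF B1 B2] obtain u where u: "u \<in> Field r" "?B \<subseteq> rng (upper (c u))"
      "{m \<in> univ (fst X). app X m \<in> ?B} \<subseteq> rng (lower (c u))" by (elim bexE conjE)
    have "(i, u) \<in> r" if i: "i \<in> Y" for i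
    proof -
      have iF: "i \<in> Field r" using i Y(1) by blast
      note h = NF_homD[OF c[OF iF]]
      have "rng (lower (c i)) \<subseteq> rng (lower (c u))"
      proof
        fix z assume z: "z \<in> rng (lower (c i))"
        have "app X z \<in> rng (comp C X (lower (c i)))" using rng_comp[OF h(4,3)] z by blast
        then have "app X z \<in> rng (upper (c i))" using h(6) rng_comp_subset[OF h(2,5)] by auto
        moreover have "z \<in> univ (fst X)" using z homD(9)[OF h(4)] by blast
        ultimately show "z \<in> rng (lower (c u))" using u(3) i by blast
      qed
      moreover have "rng (upper (c i)) \<subseteq> rng (upper (c u))" using u(2) i by blast
      ultimately show ?thesis unfolding r_iff using gc[OF iF] gc[OF u(1)] iF u(1) by simp
    qed
    then show "\<exists>u\<in>Field r. \<forall>x\<in>Y. (x, u) \<in> r" using u(1) by blast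
  qed
  have ne: "Field r \<noteq> {}" by (rule directed_nonempty[OF directed_mono[OF dir lam_le(1)]])
  obtain d where d: "diagram NF r D d" "cocone NF r D d X c"
  proof (rule subobject_diagram[OF po ne c])
    show "rng (lower (c i)) \<subseteq> rng (lower (c j)) \<and> rng (upper (c i)) \<subseteq> rng (upper (c j))"
      if "(i, j) \<in> r" for i j using that gc[of i] gc[of j] unfolding r_iff by auto
  qed
  have one: "|{y}| \<le>o |W|" for y :: 'v
    by (rule card_of_singl_ordLeq) (use W in auto)
  have "covers r X c"
    unfolding covers_def
  proof (intro conjI equalityI subsetI)
    fix m assume m: "m \<in> univ (fst X)"
    obtain u where "u \<in> Field r" "{n \<in> univ (fst X). app X n \<in> {app X m}} \<subseteq> rng (lower (c u))"
      using above[OF _ one, of "app X m"] app_in[OF Xh m] by blast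
    then show "m \<in> (\<Union>i\<in>Field r. rng (lower (c i)))" using m by blast
  next
    fix y assume y: "y \<in> univ (tg X)"
    then show "y \<in> (\<Union>i\<in>Field r. rng (upper (c i)))" using above[OF _ one, of y] by blast
  next
    fix m assume "m \<in> (\<Union>i\<in>Field r. rng (lower (c i)))"
    then show "m \<in> univ (fst X)" using homD(9)[OF NF_homD(4)[OF c]] by blast
  next
    fix y assume "y \<in> (\<Union>i\<in>Field r. rng (upper (c i)))"
    then show "y \<in> univ (tg X)" using homD(9)[OF NF_homD(5)[OF c]] by blast
  qed
  then have "colimit NF r D d X c" by (rule NF_covering_cocone_is_colimit[OF lam_le dir d])
  then show ?thesis using dir d(1) D by blast
qed

text \<open>The generators are the arrows between models whose universes are contained in a fixed set of size
\<open>|Pow Z|\<close>, and the index of accessibility is the successor of that cardinal.\<close>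

lemma NF_accessible:
  assumes rlc: "right_local_character K ind"
  shows "accessible TYPE('v) NF"
proof -
  have th: "is_cardinal theta" "infinite (Field theta)" using theta by (auto simp: infinite_cardinal_def)
  obtain Z0 :: "'v set" where Z0: "|Z0| <o \<V>" and
    lst: "\<And>Z M A. Z0 \<subseteq> Z \<Longrightarrow> Field mu \<subseteq> Z \<Longrightarrow> M \<in> models K \<Longrightarrow> A \<subseteq> univ M \<Longrightarrow> |A| \<le>o |Pow Z| \<Longrightarrow>
      \<exists>M0. (M0, M) \<in> leK K \<and> A \<subseteq> univ M0 \<and> |univ M0| \<le>o |Pow (Z :: 'v set)|"
    using LST_Pow by metis
  obtain kap :: "'v rel" where kap: "is_cardinal kap" and lc: "\<And>M p. M \<in> models K \<Longrightarrow>
      p \<in> gS K theta M \<Longrightarrow> \<exists>M0. (M0, M) \<in> leK K \<and> |univ M0| \<le>o kap \<and> nonforking K ind theta p M0"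
    using rlc th(1) unfolding right_local_character_def by blast
  \<comment> \<open>Large enough that the submodels and bases chosen below have size at most \<open>|Pow Z|\<close>.\<close>
  define Z where "Z = Z0 \<union> Field mu \<union> Field theta \<union> Field kap"
  have Zs: "|Z| <o \<V>"
    unfolding Z_def using vsmall_Un Z0 mu_card(4) th(1) kap unfolding is_cardinal_def small_def by blast
  have sub: "Z0 \<subseteq> Z" "Field mu \<subseteq> Z" "Field theta \<subseteq> Z" "Field kap \<subseteq> Z" by (auto simp: Z_def)
  have Zi: "infinite Z" using sub(2) mu_card(2) finite_subset by blast
  have leZ: "r \<le>o |Pow Z|" "|Field r| \<le>o |Z|" "r \<le>o |Z|" if "Card_order r" "Field r \<subseteq> Z" for r :: "'v rel"
  proof -
    show 1: "|Field r| \<le>o |Z|" by (rule card_of_mono1[OF that(2)])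
    show "r \<le>o |Z|" by (rule ordIso_ordLeq_trans[OF ordIso_symmetric[OF card_of_Field_ordIso[OF that(1)]] 1])
    then show "r \<le>o |Pow Z|" using card_of_Pow ordLess_imp_ordLeq ordLeq_transitive by blast
  qed
  have co: "Card_order theta" "Card_order kap" using th kap by (auto simp: is_cardinal_def)
  note lst' = lst[OF sub(1,2)]
  obtain l :: "'v rel" where l: "regular_cardinal l" "|Z| <o l" "|Field l| \<le>o |Pow Z|"
    using regular_successor[OF Zi Zs] by metis
  have l_le: "mu \<le>o l" "theta \<le>o l"
    using leZ(3)[OF mu_card(1) sub(2)] leZ(3)[OF co(1) sub(3)] l(2) ordLeq_ordLess_trans
      ordLess_imp_ordLeq by blast+
  have Ws: "|Pow Z| <o \<V>" "infinite (Pow Z)" using vsmall_Pow[OF Zs] Zi by auto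
  obtain lam :: "'v rel" where lam: "regular_cardinal lam" "|Pow Z| <o lam"
    "\<And>B :: 'v set. |B| <o lam \<Longrightarrow> |B| \<le>o |Pow Z|"
    using regular_successor[OF Ws(2,1)] by metis
  have lam_le: "mu \<le>o lam" "theta \<le>o lam"
    using leZ(1)[OF mu_card(1) sub(2)] leZ(1)[OF co(1) sub(3)] lam(2) ordLeq_ordLess_trans
      ordLess_imp_ordLeq by blast+
  obtain e :: "'v set \<Rightarrow> 'v" where e: "inj_on e (Pow Z)" using vsmall_code[OF Ws(1)] by metis
  define V where "V = e ` Pow Z"
  have VW: "|Pow Z| =o |V|" unfolding V_def by (rule card_of_ordIsoI[of e]) (use e in \<open>simp add: bij_betw_def\<close>)
  have Vs: "|V| <o \<V>" unfolding V_def by (rule vsmall_image[OF Ws(1)])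
  have VleW: "|V| \<le>o |Pow Z|" and WleV: "|Pow Z| \<le>o |V|"
    using VW ordIso_iff_ordLeq by blast+
  define S where "S = {A \<in> arr C. univ (fst A) \<subseteq> V \<and> univ (tg A) \<subseteq> V}"
  have Ss: "|S| <o \<V>" unfolding S_def by (rule vsmall_arrows[OF Vs])
  have S_card: "|univ (tg A)| \<le>o |Pow Z|" if "A \<in> S" for A
    by (rule card_of_subset_le[OF _ VleW]) (use that in \<open>simp add: S_def\<close>)
  have cofinal: "\<exists>A\<in>S. \<exists>c\<in>hom NF A X. B \<subseteq> rng (upper c) \<and> {m \<in> univ (fst X). app X m \<in> B} \<subseteq> rng (lower c)"
    if X: "X \<in> arr C" and B: "B \<subseteq> univ (tg X)" "|B| \<le>o |Pow Z|" for X B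
  proof -
    have Xh: "X \<in> hom C (fst X) (tg X)" using X arr_iff by blast
    have base: "\<exists>M0. (M0, fst X) \<in> leK K \<and> |univ M0| \<le>o |Pow Z| \<and> free (inclusion M0 (fst X)) X (a ` Field theta)"
      if a: "a \<in> Field theta \<rightarrow>\<^sub>E univ (tg X)" for a
    proof -
      have ai: "a i \<in> univ (tg X)" if "i \<in> Field theta" for i using a that by auto
      obtain M0 where "(M0, fst X) \<in> leK K" "|univ M0| \<le>o kap" "free (inclusion M0 (fst X)) X (a ` Field theta)"
        by (rule local_character[OF Xh ai lc[OF homD(1)[OF Xh]]])
      then show ?thesis using leZ(1)[OF co(2) sub(4)] ordLeq_transitive by blast
    qed
    obtain M' N' x where s: "(M', fst X) \<in> leK K" "(N', tg X) \<in> leK K" "x \<in> hom C M' N'"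
      "ind x (inclusion M' (fst X)) (inclusion N' (tg X)) X" "B \<subseteq> univ N'"
      "{m \<in> univ (fst X). app X m \<in> B} \<subseteq> univ M'" "|univ N'| \<le>o |Pow Z|"
      by (rule small_independent_subsquare[OF Zi leZ(2)[OF co(1) sub(3)] lst' l(1) l_le l(3) Xh base B])
    obtain A c where A: "A \<in> arr C" "univ (fst A) \<subseteq> V" "univ (tg A) \<subseteq> V" "c \<in> hom NF A X"
      "rng (lower c) = univ M'" "rng (upper c) = univ N'"
      by (rule subsquare_copy_within[OF Xh s(1-4) ordLeq_transitive[OF s(7) WleV]])
    have "A \<in> S" using A(1-3) by (simp add: S_def)
    then show ?thesis using A(4-6) s(5,6) by (intro bexI[of _ A] bexI[of _ c]) auto
  qed
  have gen: "\<exists>(r :: 'v rel) D d c. directed_poset lam r \<and> diagram NF r D d \<and> (\<forall>i \<in> Field r. D i \<in> S) \<and>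
      colimit NF r D d X c" if X: "X \<in> arr C" for X
    by (rule generated_by_subobjects[OF lam_le Ws(2) lam(3) X S_card cofinal[OF X]])
  have "accessible_at NF lam"
    unfolding accessible_at_def NF_obj
  proof (intro conjI allI impI)
    fix r :: "'v rel" and D d
    assume r: "directed_poset lam r" and d: "diagram NF r D d"
    obtain X c where "cocone NF r D d X c" "covers r X c"
      by (rule NF_covering_cocone_exists[OF lam_le r d])
    then show "\<exists>X c. colimit NF r D d X c" using NF_covering_cocone_is_colimit[OF lam_le r d] by blast
  next
    show "\<exists>S. |S| <o \<V> \<and> (\<forall>A\<in>S. presentable NF lam A) \<and>
        (\<forall>X\<in>arr C. \<exists>(r :: 'v rel) D d c. directed_poset lam r \<and> diagram NF r D d \<and> (\<forall>i\<in>Field r. D i \<in> S) \<and>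
           colimit NF r D d X c)"
    proof (rule exI[of _ S], intro conjI ballI Ss gen)
      fix A assume A: "A \<in> S"
      have "|univ (tg A)| <o lam" by (rule ordLeq_ordLess_trans[OF S_card[OF A] lam(2)])
      moreover have "A \<in> arr C" using A by (simp add: S_def)
      ultimately show "presentable NF lam A" by (rule NF_presentable[OF lam_le, rotated])
    qed
  qed
  then show ?thesis unfolding accessible_def using NF_category lam(1) by blast
qed

end

section \<open>Symmetry and stability\<close>

theorem corollary9p3:
  fixes mu :: "'v rel"
    and K :: "'v aclass"
    and ind :: "'v K_arrow square_rel"
  assumes "inaccessible_universe TYPE('v)"
    and "regular_cardinal mu"
    and "mu_AEC mu K"
    and "chain_bounds K"
    and "independence_relation (cat_of K) ind"
    and "invariant (cat_of K) ind"
    and "transitive (cat_of K) ind"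
    and "existence (cat_of K) ind"
    and "uniqueness (cat_of K) ind"
    and "right_local_character K ind"
  shows "symmetric ind \<and>
    (right_witness K ind \<or> left_witness K ind \<longrightarrow>
       stable_independence TYPE('v) (cat_of K) ind)"
proof -
  interpret S: structures mu "voc K" using assms(1,2) by unfold_locales
  interpret M: mu_aec mu K using assms(3) by unfold_locales
  interpret I: aec_independence mu K ind using assms(5,7-9) by unfold_locales
  have sym: "symmetric ind" by (rule I.symmetric_ind[OF assms(4,10)])
  then have dual: "dual ind = ind" by (simp add: symmetric_def)
  have "stable_independence TYPE('v) (cat_of K) ind" if "right_witness K ind \<or> left_witness K ind"
  proof -
    have "right_witness K ind" using that dual by (auto simp: left_witness_def)
    then obtain theta :: "'v rel" where theta: "infinite_cardinal theta"
      and wit: "\<And>M0 M1 M2 M3. (M0, M1) \<in> leK K \<Longrightarrow> (M0, M2) \<in> leK K \<Longrightarrow> (M1, M3) \<in> leK K \<Longrightarrow>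
        (M2, M3) \<in> leK K \<Longrightarrow> (\<And>A. A \<subseteq> univ M2 \<Longrightarrow> |A| <o theta \<Longrightarrow> ind_sets K ind M0 (univ M1) A M3) \<Longrightarrow>
        ind_models K ind M0 M1 M2 M3"
      unfolding right_witness_def by auto
    interpret W: witnessed_independence mu K ind theta by (unfold_locales; (fact sym theta | rule wit))
    have "accessible TYPE('v) (NF_cat (cat_of K) ind)" by (rule W.NF_accessible[OF assms(10)])
    then have "right_accessible TYPE('v) (cat_of K) ind"
      using assms(7) by (simp add: right_accessible_def transitive_def)
    then show ?thesis
      unfolding stable_independence_def accessible_ind_def left_accessible_def dual
      using assms(5,7-9) sym by blast
  qed
  then show ?thesis using sym by blast
qed

end
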